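(* Let $n\geq 1$. Let $\sigma_n$ denote the smallest positive integer such that, for each character $\chi$ of $S_n$ that depends only on $\ell$, $\sigma_n\chi$ is a non-negative integer linear combination of the Foulkes characters $\phi_0,\phi_1,\ldots,\phi_{n-1}$ of $S_n$. Then $$\sigma_n=\frac{\operatorname{lcm}(1,2,\ldots,n)}{n}=\frac{e^{f(n)}}{n},$$ where $f$ is the second Chebyshev function.
   Context: The second Chebyshev function is $f(x)=\sum_{p^k\leq x}\log p$, the sum being over all prime powers $p^k\le x$ with $p$ prime and $k\geq 1$. Convention: $\binom{u}{v}=0$ unless $u\geq v\geq 0$. For $\pi\in S_n$, $\ell(\pi)$ is the number of cycles of $\pi$ (fixed points counted). A class function $\theta$ of $S_n$ depends only on $\ell$ if $\theta(\pi)=\theta(\sigma)$ whenever $\ell(\pi)=\ell(\sigma)$. A character of $S_n$ is a non-negative integer linear combination of the irreducible complex characters of $S_n$ (the zero function is included). The Foulkes character $\phi_i$ of $S_n$ ($0\leq i\leq n-1$) is the character afforded by the direct sum of the (skew) Specht modules $V_\beta$ over all border shapes (ribbons: connected skew shapes containing no $2\times 2$ square) $\beta$ with exactly $n$ boxes and $i+1$ rows; equivalently (well known), $\phi_i(\pi)=\sum_{j=0}^{n-1}(-1)^{i-j}\binom{n+1}{i-j}(j+1)^{\ell(\pi)}$. *)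

theory Defs
  imports
    Complex_Main
    "HOL-Library.Function_Algebras"
    "HOL-Combinatorics.Orbits"
    "HOL-Algebra.Sym_Groups"
    "HOL-Computational_Algebra.Primes"
    "Jordan_Normal_Form.VS_Connect"
begin

text \<open>
  The symmetric group is \<^term>\<open>sym_group n\<close>, acting on \<open>{1..n}\<close>. Functions on it are total functions
  of type \<open>(nat \<Rightarrow> nat) \<Rightarrow> complex\<close>, and only their values on its carrier are ever used.
\<close>

section \<open>Characters of the symmetric group\<close>

definition matrix_rep :: "nat \<Rightarrow> nat \<Rightarrow> ((nat \<Rightarrow> nat) \<Rightarrow> complex mat) \<Rightarrow> bool" where
  "matrix_rep n d \<rho> \<longleftrightarrow>
     (\<forall>\<pi> \<in> carrier (sym_group n). \<rho> \<pi> \<in> carrier_mat d d) \<and>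
     \<rho> id = 1\<^sub>m d \<and>
     (\<forall>\<pi> \<in> carrier (sym_group n). \<forall>\<tau> \<in> carrier (sym_group n). \<rho> (\<pi> \<circ> \<tau>) = \<rho> \<pi> * \<rho> \<tau>)"

definition irreducible_rep :: "nat \<Rightarrow> nat \<Rightarrow> ((nat \<Rightarrow> nat) \<Rightarrow> complex mat) \<Rightarrow> bool" where
  "irreducible_rep n d \<rho> \<longleftrightarrow>
     matrix_rep n d \<rho> \<and> d > 0 \<and>
     (\<forall>W. VectorSpace.subspace class_ring W (module_vec TYPE(complex) d) \<longrightarrow>
          (\<forall>\<pi> \<in> carrier (sym_group n). \<forall>w \<in> W. \<rho> \<pi> *\<^sub>v w \<in> W) \<longrightarrow>
          W = {0\<^sub>v d} \<or> W = carrier_vec d)"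

definition irreducible_character :: "nat \<Rightarrow> ((nat \<Rightarrow> nat) \<Rightarrow> complex) \<Rightarrow> bool" where
  "irreducible_character n \<psi> \<longleftrightarrow>
     (\<exists>d \<rho>. irreducible_rep n d \<rho> \<and>
        (\<forall>\<pi> \<in> carrier (sym_group n). \<psi> \<pi> = (\<Sum>i<d. \<rho> \<pi> $$ (i, i))))"

text \<open>The zero function is the case \<open>k = 0\<close>.\<close>

definition character :: "nat \<Rightarrow> ((nat \<Rightarrow> nat) \<Rightarrow> complex) \<Rightarrow> bool" where
  "character n \<chi> \<longleftrightarrow>
     (\<exists>(k::nat) \<psi> (m :: nat \<Rightarrow> nat). (\<forall>j<k. irreducible_character n (\<psi> j)) \<and>
        (\<forall>\<pi> \<in> carrier (sym_group n). \<chi> \<pi> = (\<Sum>j<k. of_nat (m j) * \<psi> j \<pi>)))"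

text \<open>A fixed point \<open>x\<close> contributes the orbit \<open>{x}\<close>.\<close>

definition num_cycles :: "nat \<Rightarrow> (nat \<Rightarrow> nat) \<Rightarrow> nat" where
  "num_cycles n \<pi> = card (orbit \<pi> ` {1..n})"

definition depends_only_on_num_cycles :: "nat \<Rightarrow> ((nat \<Rightarrow> nat) \<Rightarrow> complex) \<Rightarrow> bool" where
  "depends_only_on_num_cycles n \<theta> \<longleftrightarrow>
     (\<forall>\<pi> \<in> carrier (sym_group n). \<forall>\<tau> \<in> carrier (sym_group n).
        num_cycles n \<pi> = num_cycles n \<tau> \<longrightarrow> \<theta> \<pi> = \<theta> \<tau>)"

section \<open>Complex function spaces\<close>

definition fscale :: "complex \<Rightarrow> ('a \<Rightarrow> complex) \<Rightarrow> 'a \<Rightarrow> complex" where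
  "fscale c v = (\<lambda>x. c * v x)"

global_interpretation cfun: vector_space "fscale :: complex \<Rightarrow> ('a \<Rightarrow> complex) \<Rightarrow> 'a \<Rightarrow> complex"
  by unfold_locales (auto simp: fscale_def fun_eq_iff algebra_simps)

text \<open>
  The trace of \<open>T\<close> on a finite-dimensional \<open>T\<close>-invariant subspace \<open>V\<close> on which \<open>T\<close> is linear;
  it does not depend on the chosen basis \<open>B\<close>.
\<close>

definition trace_on :: "('a \<Rightarrow> complex) set \<Rightarrow> (('a \<Rightarrow> complex) \<Rightarrow> ('a \<Rightarrow> complex)) \<Rightarrow> complex" where
  "trace_on V T =
     (let B = (SOME B. \<not> cfun.dependent B \<and> cfun.span B = V)
      in \<Sum>b\<in>B. cfun.representation B (T b) b)"

section \<open>Skew shapes and skew Specht modules\<close>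

text \<open>A box is a pair (row, column); rows are numbered downwards and columns to the right, from 0.\<close>

type_synonym box = "nat \<times> nat"

definition young_diagram :: "box set \<Rightarrow> bool" where
  "young_diagram D \<longleftrightarrow> finite D \<and> (\<forall>r c r' c'. (r, c) \<in> D \<and> r' \<le> r \<and> c' \<le> c \<longrightarrow> (r', c') \<in> D)"

definition skew_shape :: "box set \<Rightarrow> bool" where
  "skew_shape \<beta> \<longleftrightarrow> (\<exists>L M. young_diagram L \<and> young_diagram M \<and> M \<subseteq> L \<and> \<beta> = L - M)"

definition adjacent :: "box \<Rightarrow> box \<Rightarrow> bool" where
  "adjacent a b \<longleftrightarrow>
     (fst a = fst b \<and> (snd a = Suc (snd b) \<or> snd b = Suc (snd a))) \<or>
     (snd a = snd b \<and> (fst a = Suc (fst b) \<or> fst b = Suc (fst a)))"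

definition connected_shape :: "box set \<Rightarrow> bool" where
  "connected_shape \<beta> \<longleftrightarrow>
     (\<forall>a\<in>\<beta>. \<forall>b\<in>\<beta>. (a, b) \<in> {(x, y). x \<in> \<beta> \<and> y \<in> \<beta> \<and> adjacent x y}\<^sup>*)"

text \<open>
  Border shapes are taken up to translation: each one is represented by its translate that meets
  row 0 and column 0.
\<close>

definition border_shape :: "box set \<Rightarrow> bool" where
  "border_shape \<beta> \<longleftrightarrow>
     skew_shape \<beta> \<and> connected_shape \<beta> \<and>
     \<not> (\<exists>r c. {(r, c), (r, Suc c), (Suc r, c), (Suc r, Suc c)} \<subseteq> \<beta>) \<and>
     0 \<in> fst ` \<beta> \<and> 0 \<in> snd ` \<beta>"

definition border_shapes :: "nat \<Rightarrow> nat \<Rightarrow> box set set" where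
  "border_shapes n k = {\<beta>. border_shape \<beta> \<and> card \<beta> = n \<and> card (fst ` \<beta>) = k}"

definition tableau :: "nat \<Rightarrow> box set \<Rightarrow> (box \<Rightarrow> nat) \<Rightarrow> bool" where
  "tableau n \<beta> t \<longleftrightarrow> bij_betw t \<beta> {1..n}"

text \<open>
  The tabloid of \<open>t\<close>, that is, its class up to permuting the entries within each row, is
  encoded as the function that maps each row to its set of entries.
\<close>

type_synonym tabloid = "nat \<Rightarrow> nat set"

definition tabloid_of :: "box set \<Rightarrow> (box \<Rightarrow> nat) \<Rightarrow> tabloid" where
  "tabloid_of \<beta> t = (\<lambda>r. t ` {b \<in> \<beta>. fst b = r})"

definition column_stabilizer :: "nat \<Rightarrow> box set \<Rightarrow> (box \<Rightarrow> nat) \<Rightarrow> (nat \<Rightarrow> nat) set" where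
  "column_stabilizer n \<beta> t =
     {\<tau> \<in> carrier (sym_group n).
        \<forall>c. \<tau> ` (t ` {b \<in> \<beta>. snd b = c}) = t ` {b \<in> \<beta>. snd b = c}}"

text \<open>
  The formal linear combination \<open>\<Sum>\<^sub>X v X \<cdot> X\<close> of tabloids \<open>X\<close> is the function \<open>v\<close>. The symmetric
  group permutes the tabloids by \<open>X \<mapsto> (\<lambda>r. \<pi> ` X r)\<close>; in terms of coefficient functions
  this is \<open>perm_action\<close>.
\<close>

definition polytabloid :: "nat \<Rightarrow> box set \<Rightarrow> (box \<Rightarrow> nat) \<Rightarrow> tabloid \<Rightarrow> complex" where
  "polytabloid n \<beta> t =
     (\<lambda>X. \<Sum>\<tau> \<in> column_stabilizer n \<beta> t.
            of_int (sign \<tau>) * (if X = tabloid_of \<beta> (\<tau> \<circ> t) then 1 else 0))"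

definition perm_action :: "(nat \<Rightarrow> nat) \<Rightarrow> (tabloid \<Rightarrow> complex) \<Rightarrow> tabloid \<Rightarrow> complex" where
  "perm_action \<pi> v = (\<lambda>X. v (\<lambda>r. Hilbert_Choice.inv \<pi> ` X r))"

definition specht_module :: "nat \<Rightarrow> box set \<Rightarrow> (tabloid \<Rightarrow> complex) set" where
  "specht_module n \<beta> = cfun.span {polytabloid n \<beta> t | t. tableau n \<beta> t}"

definition specht_character :: "nat \<Rightarrow> box set \<Rightarrow> (nat \<Rightarrow> nat) \<Rightarrow> complex" where
  "specht_character n \<beta> \<pi> = trace_on (specht_module n \<beta>) (perm_action \<pi>)"

section \<open>Foulkes characters and the Chebyshev function\<close>

text \<open>The character of a direct sum is the sum of the characters of its summands.\<close>

definition foulkes_character :: "nat \<Rightarrow> nat \<Rightarrow> (nat \<Rightarrow> nat) \<Rightarrow> complex" where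
  "foulkes_character n i \<pi> = (\<Sum>\<beta> \<in> border_shapes n (i + 1). specht_character n \<beta> \<pi>)"

definition foulkes_multiplier :: "nat \<Rightarrow> nat \<Rightarrow> bool" where
  "foulkes_multiplier n s \<longleftrightarrow>
     s > 0 \<and>
     (\<forall>\<chi>. character n \<chi> \<and> depends_only_on_num_cycles n \<chi> \<longrightarrow>
        (\<exists>c :: nat \<Rightarrow> nat. \<forall>\<pi> \<in> carrier (sym_group n).
           of_nat s * \<chi> \<pi> = (\<Sum>i<n. of_nat (c i) * foulkes_character n i \<pi>)))"

definition sigma_min :: "nat \<Rightarrow> nat" where
  "sigma_min n = (LEAST s. foulkes_multiplier n s)"

definition chebyshev_second :: "real \<Rightarrow> real" where
  "chebyshev_second x =
     (\<Sum>(p, k) \<in> {(p, k). prime (p::nat) \<and> k \<ge> (1::nat) \<and> real (p ^ k) \<le> x}. ln (real p))"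

end

theory Submission
  imports
    Defs
    "Jordan_Normal_Form.Schur_Decomposition"
    "HOL-Number_Theory.Cong"
begin

text \<open>
  Foulkes characters are governed by two expansions. A surjective word \<open>f\<close> on \<open>{1..n}\<close> with \<open>k\<close>
  letters is the row word of a unique ribbon tabloid with \<open>k\<close> rows. Let \<open>U\<close> be the set of up-steps
  of a ribbon with \<open>n\<close> boxes. The functions on tabloids of the ribbon \<open>U\<close> decompose as the direct
  sum of the Specht modules of the ribbons \<open>V \<subseteq> U\<close>. Taking traces and summing over all \<open>U\<close> with
  \<open>k - 1\<close> elements shows that the number \<open>B\<^sub>k(\<pi>)\<close> of surjective words with \<open>k\<close> letters fixed by \<open>\<pi>\<close>
  equals \<open>\<Sum>\<^sub>i C(n - 1 - i, n - k) \<phi>\<^sub>i(\<pi>)\<close> (\<open>surj_count_foulkes\<close>). A word with letters among \<open>x\<close> is a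
  surjective word onto a subset, hence Vandermonde's identity gives
  \<open>x ^ \<ell>(\<pi>) = \<Sum>\<^sub>i C(x + n - 1 - i, n) \<phi>\<^sub>i(\<pi>)\<close> (\<open>power_foulkes\<close>). In particular every function of \<open>\<ell>\<close>
  is a linear combination of Foulkes characters (\<open>foulkes_span\<close>).

  The coefficient of \<open>\<phi>\<^sub>k\<close> is read off with a hook. Let \<open>A\<close> and \<open>B\<close> be the arm and the leg of the
  hook with leg length \<open>k\<close>, sharing the corner. The product of the sum over the permutations of \<open>A\<close>
  and the signed sum over those of \<open>B\<close> is a Young symmetrizer: its square is \<open>(n - 1 - k)! k! n\<close>
  times itself. So in every representation its trace is a natural multiple of this scalar
  (\<open>hook_pairing_character_nat\<close>). On \<open>x ^ \<ell>\<close> the same trace sum can be evaluated in closed form by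
  removing points of the hook one at a time, and comparison with the expansion of \<open>x ^ \<ell>\<close> shows that
  it vanishes on \<open>\<phi>\<^sub>i\<close> for \<open>i \<noteq> k\<close> and is the scalar times \<open>C(n - 1, k)\<close> on \<open>\<phi>\<^sub>k\<close>
  (\<open>hook_pairing_foulkes\<close>). Thus if a character is \<open>\<Sum>\<^sub>i c\<^sub>i \<phi>\<^sub>i\<close>, then every \<open>C(n - 1, k) c\<^sub>k\<close> is a
  natural number. Since \<open>n C(n - 1, k)\<close> divides \<open>lcm(1, \<dots>, n)\<close> (the denominators of Leibniz's
  harmonic triangle), \<open>lcm(1, \<dots>, n) / n\<close> clears all denominators: \<open>Lcm_div_is_multiplier\<close>.

  For the converse, classify surjective words with \<open>k\<close> letters by the sum of their letters modulo
  \<open>k\<close>. Rotating the alphabet shifts this weight by \<open>n\<close>, so the weight classes are equinumerous along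
  residues modulo \<open>g = gcd(n, k)\<close>, and \<open>(g / k) B\<^sub>k\<close> is a permutation character that depends only on
  \<open>\<ell>\<close>. Its coefficient at \<open>\<phi>\<close> with index \<open>k - 1\<close> is \<open>g / k\<close>, so a multiplier \<open>s\<close> satisfies \<open>k / g\<close>
  divides \<open>s\<close>, whence \<open>k\<close> divides \<open>s n\<close> (\<open>foulkes_multiplier_divisible\<close>). As \<open>k\<close> ranges over
  \<open>1, \<dots>, n\<close>, the least common multiple divides \<open>s n\<close>. Finally \<open>lcm(1, \<dots>, n)\<close> is multiplied by \<open>p\<close>
  when \<open>n\<close> reaches a power of a prime \<open>p\<close> and is unchanged otherwise, which is the recursion of \<open>e\<close>
  to the second Chebyshev function.
\<close>

section \<open>Traces on spaces of complex functions\<close>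

abbreviation flinear :: "(('a \<Rightarrow> complex) \<Rightarrow> ('b \<Rightarrow> complex)) \<Rightarrow> bool" where
  "flinear \<equiv> Vector_Spaces.linear fscale fscale"

text \<open>
  Invariance under base change: expand each \<open>b\<close> of the given basis in the chosen basis \<open>C\<close>, apply
  \<open>T\<close>, and exchange the sums over the two bases; the inner sum is then the coordinate of \<open>T c\<close> at
  \<open>c\<close>.
\<close>

lemma trace_on_eq:
  assumes B: "cfun.independent B" "finite B" "cfun.span B = V"
    and T: "flinear T" "\<And>v. v \<in> V \<Longrightarrow> T v \<in> V"
  shows "trace_on V T = (\<Sum>b\<in>B. cfun.representation B (T b) b)"
proof -
  define C where "C = (SOME C. cfun.independent C \<and> cfun.span C = V)"
  have "cfun.independent C \<and> cfun.span C = V"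
    unfolding C_def by (rule someI[of _ B]) (use B in auto)
  hence C: "cfun.independent C" "cfun.span C = V" by auto
  have finC: "finite C"
    using cfun.independent_span_bound[OF B(2) C(1)] B(3) C(2) cfun.span_superset by blast
  interpret T: Vector_Spaces.linear fscale fscale T by (rule T(1))
  have CV: "c \<in> V" if "c \<in> C" for c using that C(2) cfun.span_base by blast
  have BV: "b \<in> V" if "b \<in> B" for b using that B(3) cfun.span_base by blast
  let ?r = cfun.representation
  have expC: "T v = (\<Sum>c\<in>C. fscale (?r C v c) (T c))" if "v \<in> V" for v
  proof -
    have "v = (\<Sum>c\<in>C. fscale (?r C v c) c)"
      using cfun.sum_representation_eq[OF C(1) _ finC subset_refl, of v] that C(2) by simp
    hence "T v = T (\<Sum>c\<in>C. fscale (?r C v c) c)" by simp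
    thus ?thesis by (simp add: T.sum T.scale)
  qed
  have "(\<Sum>b\<in>B. ?r B (T b) b) = (\<Sum>b\<in>B. \<Sum>c\<in>C. ?r C b c * ?r B (T c) b)"
  proof (rule sum.cong[OF refl])
    fix b assume b: "b \<in> B"
    have "?r B (T b) = ?r B (\<Sum>c\<in>C. fscale (?r C b c) (T c))" using expC[OF BV[OF b]] by simp
    also have "\<dots> = (\<lambda>x. \<Sum>c\<in>C. ?r B (fscale (?r C b c) (T c)) x)"
      by (rule cfun.representation_sum[OF B(1)])
        (use CV T(2) B(3) cfun.span_scale in \<open>metis\<close>)
    finally show "?r B (T b) b = (\<Sum>c\<in>C. ?r C b c * ?r B (T c) b)"
      using CV T(2) B by (simp add: cfun.representation_scale)
  qed
  also have "\<dots> = (\<Sum>c\<in>C. \<Sum>b\<in>B. ?r B (T c) b * ?r C b c)"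
    by (subst sum.swap) (simp add: mult.commute)
  also have "\<dots> = (\<Sum>c\<in>C. ?r C (T c) c)"
  proof (rule sum.cong[OF refl])
    fix c assume c: "c \<in> C"
    have "T c = (\<Sum>b\<in>B. fscale (?r B (T c) b) b)"
      using cfun.sum_representation_eq[OF B(1) _ B(2) subset_refl, of "T c"] CV T(2) c B(3) by simp
    hence "?r C (T c) = ?r C (\<Sum>b\<in>B. fscale (?r B (T c) b) b)" by simp
    also have "\<dots> = (\<lambda>x. \<Sum>b\<in>B. ?r C (fscale (?r B (T c) b) b) x)"
      by (rule cfun.representation_sum[OF C(1)])
        (use BV C(2) cfun.span_scale in \<open>metis\<close>)
    finally show "(\<Sum>b\<in>B. ?r B (T c) b * ?r C b c) = ?r C (T c) c"
      using BV C by (simp add: cfun.representation_scale)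
  qed
  finally show ?thesis unfolding trace_on_def Let_def C_def[symmetric] by simp
qed

text \<open>
  An injective intertwiner carries a basis to a basis and preserves coordinates. This is how the
  trace on a module of tabloids is computed in a space of functions on permutations.
\<close>

lemma trace_on_transport:
  fixes \<Theta> :: "('a \<Rightarrow> complex) \<Rightarrow> ('b \<Rightarrow> complex)"
  assumes B: "cfun.independent B" "finite B" "cfun.span B = V"
    and \<Theta>: "flinear \<Theta>" "inj_on \<Theta> V"
    and T: "flinear T" "\<And>v. v \<in> V \<Longrightarrow> T v \<in> V"
    and S: "flinear S" "\<And>v. v \<in> V \<Longrightarrow> \<Theta> (T v) = S (\<Theta> v)"
  shows "trace_on V T = trace_on (\<Theta> ` V) S"
proof -
  interpret \<Theta>: Vector_Spaces.linear fscale fscale \<Theta> by (rule \<Theta>(1))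
  have injB: "inj_on \<Theta> B" using \<Theta>(2) B(3) cfun.span_superset inj_on_subset by blast
  have ind: "cfun.independent (\<Theta> ` B)"
    using \<Theta>.independent_inj_on_image[OF B(1)] \<Theta>(2) B(3) by simp
  have span: "cfun.span (\<Theta> ` B) = \<Theta> ` V" using \<Theta>.span_image B(3) by simp
  have BV: "b \<in> V" if "b \<in> B" for b using that B(3) cfun.span_base by blast
  have rep: "cfun.representation (\<Theta> ` B) (\<Theta> v) (\<Theta> b) = cfun.representation B v b"
    if "v \<in> V" "b \<in> B" for v b
  proof -
    let ?f = "\<lambda>y. if y \<in> \<Theta> ` B then cfun.representation B v (inv_into B \<Theta> y) else 0"
    have "cfun.representation (\<Theta> ` B) (\<Theta> v) = ?f"
    proof (rule cfun.representation_eqI[OF ind])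
      show "\<Theta> v \<in> cfun.span (\<Theta> ` B)" using that span by auto
      show "y \<in> \<Theta> ` B" if "?f y \<noteq> 0" for y using that by (auto split: if_splits)
      show "finite {y. ?f y \<noteq> 0}" by (rule finite_subset[of _ "\<Theta> ` B"]) (use B(2) in auto)
      have "(\<Sum>y | ?f y \<noteq> 0. fscale (?f y) y) = (\<Sum>y\<in>\<Theta> ` B. fscale (?f y) y)"
        by (rule sum.mono_neutral_left) (use B(2) in \<open>auto simp: fscale_def\<close>)
      also have "\<dots> = (\<Sum>b\<in>B. fscale (cfun.representation B v b) (\<Theta> b))"
        by (subst sum.reindex[OF injB]) (auto simp: injB)
      also have "\<dots> = \<Theta> (\<Sum>b\<in>B. fscale (cfun.representation B v b) b)"
        by (simp add: \<Theta>.sum \<Theta>.scale)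
      also have "(\<Sum>b\<in>B. fscale (cfun.representation B v b) b) = v"
        using cfun.sum_representation_eq[OF B(1) _ B(2) subset_refl, of v] that B(3) by simp
      finally show "(\<Sum>y | ?f y \<noteq> 0. fscale (?f y) y) = \<Theta> v" .
    qed
    thus ?thesis using that injB by simp
  qed
  have "trace_on (\<Theta> ` V) S = (\<Sum>c\<in>\<Theta> ` B. cfun.representation (\<Theta> ` B) (S c) c)"
    by (rule trace_on_eq) (use ind span B(2) S T(2) in \<open>auto simp: S(2)[symmetric]\<close>)
  also have "\<dots> = (\<Sum>b\<in>B. cfun.representation (\<Theta> ` B) (\<Theta> (T b)) (\<Theta> b))"
    by (subst sum.reindex[OF injB]) (auto simp: S(2) BV)
  also have "\<dots> = (\<Sum>b\<in>B. cfun.representation B (T b) b)"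
    by (intro sum.cong refl rep) (auto simp: T(2) BV)
  also have "\<dots> = trace_on V T" by (rule trace_on_eq[symmetric]) (use assms in auto)
  finally show ?thesis ..
qed

lemma trace_on_direct_sum:
  assumes I: "finite I" and Bi: "\<And>i. i \<in> I \<Longrightarrow> finite (B i)"
    and dis: "disjoint_family_on B I"
    and ind: "cfun.independent (\<Union>i\<in>I. B i)"
    and T: "flinear T" "\<And>i v. i \<in> I \<Longrightarrow> v \<in> cfun.span (B i) \<Longrightarrow> T v \<in> cfun.span (B i)"
  shows "trace_on (cfun.span (\<Union>i\<in>I. B i)) T = (\<Sum>i\<in>I. trace_on (cfun.span (B i)) T)"
proof -
  let ?B = "\<Union>i\<in>I. B i"
  interpret T: Vector_Spaces.linear fscale fscale T by (rule T(1))
  have inv: "T v \<in> cfun.span ?B" if "v \<in> cfun.span ?B" for v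
    using that
  proof (induction rule: cfun.span_induct_alt)
    case (step c x y)
    then obtain i where i: "i \<in> I" "x \<in> B i" by auto
    have "T x \<in> cfun.span ?B"
      using T(2)[OF i(1) cfun.span_base[OF i(2)]] cfun.span_mono[of "B i" ?B] i(1) by auto
    thus ?case unfolding T.add T.scale using step by (intro cfun.span_add cfun.span_scale)
  qed (metis T.zero cfun.span_zero)
  have "trace_on (cfun.span ?B) T = (\<Sum>b\<in>?B. cfun.representation ?B (T b) b)"
    by (rule trace_on_eq) (use I Bi ind T(1) inv in auto)
  also have "\<dots> = (\<Sum>i\<in>I. \<Sum>b\<in>B i. cfun.representation ?B (T b) b)"
    by (rule sum.UNION_disjoint) (use I Bi dis in \<open>auto simp: disjoint_family_on_def\<close>)
  also have "\<dots> = (\<Sum>i\<in>I. trace_on (cfun.span (B i)) T)"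
  proof (rule sum.cong[OF refl])
    fix i assume i: "i \<in> I"
    have indi: "cfun.independent (B i)" using ind i cfun.independent_mono by blast
    have "trace_on (cfun.span (B i)) T = (\<Sum>b\<in>B i. cfun.representation (B i) (T b) b)"
      by (rule trace_on_eq) (use i Bi indi T in auto)
    also have "\<dots> = (\<Sum>b\<in>B i. cfun.representation ?B (T b) b)"
    proof (rule sum.cong[OF refl])
      fix b assume b: "b \<in> B i"
      have "cfun.representation ?B (T b) = cfun.representation (B i) (T b)"
        by (rule cfun.representation_extend[OF ind])
          (use i T(2)[OF i cfun.span_base[OF b]] in auto)
      thus "cfun.representation (B i) (T b) b = cfun.representation ?B (T b) b" by simp
    qed
    finally show "(\<Sum>b\<in>B i. cfun.representation ?B (T b) b) = trace_on (cfun.span (B i)) T" ..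
  qed
  finally show ?thesis .
qed

section \<open>Representations on function spaces and their characters\<close>

lemma flinearI:
  assumes "\<And>x y. f (x + y) = f x + f y" "\<And>c x. f (fscale c x) = fscale c (f x)"
  shows "flinear f"
  using assms by (simp add: Vector_Spaces.linear_iff cfun.vector_space_axioms)

text \<open>
  The coordinates of \<open>T v\<close> are the matrix of \<open>T\<close> applied to the coordinates of \<open>v\<close>.
\<close>

lemma flinear_representation_expand:
  assumes B: "cfun.independent B" "finite B" and T: "flinear T"
    and TB: "\<And>b. b \<in> B \<Longrightarrow> T b \<in> cfun.span B" and v: "v \<in> cfun.span B"
  shows "cfun.representation B (T v) x = (\<Sum>c\<in>B. cfun.representation B v c * cfun.representation B (T c) x)"
proof -
  interpret T: Vector_Spaces.linear fscale fscale T by (rule T(1))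
  let ?r = cfun.representation
  have "T v = T (\<Sum>c\<in>B. fscale (?r B v c) c)"
    using cfun.sum_representation_eq[OF B(1) v B(2) subset_refl] by simp
  also have "\<dots> = (\<Sum>c\<in>B. fscale (?r B v c) (T c))" by (simp add: T.sum T.scale)
  finally have "?r B (T v) = (\<lambda>x. \<Sum>c\<in>B. ?r B (fscale (?r B v c) (T c)) x)"
    using cfun.representation_sum[OF B(1), of B "\<lambda>c. fscale (?r B v c) (T c)"] TB cfun.span_scale by metis
  thus ?thesis using TB B by (simp add: cfun.representation_scale)
qed

lemma character_cong:
  assumes "character n \<chi>" "\<And>\<pi>. \<pi> \<in> carrier (sym_group n) \<Longrightarrow> \<chi>' \<pi> = \<chi> \<pi>"
  shows "character n \<chi>'"
  using assms unfolding character_def by simp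

lemma character_zero: "character n (\<lambda>\<pi>. 0)"
  unfolding character_def by (intro exI[of _ 0]) simp

lemma character_irreducible: "irreducible_character n \<psi> \<Longrightarrow> character n \<psi>"
  unfolding character_def by (rule exI[of _ 1], rule exI[of _ "\<lambda>_. \<psi>"], rule exI[of _ "\<lambda>_. 1"]) auto

lemma character_add:
  assumes "character n \<chi>1" "character n \<chi>2"
  shows "character n (\<lambda>\<pi>. \<chi>1 \<pi> + \<chi>2 \<pi>)"
proof -
  from assms(1) obtain k1 :: nat and \<psi>1 and m1 :: "nat \<Rightarrow> nat"
    where 1: "\<forall>j<k1. irreducible_character n (\<psi>1 j)"
      "\<forall>\<pi> \<in> carrier (sym_group n). \<chi>1 \<pi> = (\<Sum>j<k1. of_nat (m1 j) * \<psi>1 j \<pi>)"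
    unfolding character_def by blast
  from assms(2) obtain k2 :: nat and \<psi>2 and m2 :: "nat \<Rightarrow> nat"
    where 2: "\<forall>j<k2. irreducible_character n (\<psi>2 j)"
      "\<forall>\<pi> \<in> carrier (sym_group n). \<chi>2 \<pi> = (\<Sum>j<k2. of_nat (m2 j) * \<psi>2 j \<pi>)"
    unfolding character_def by blast
  let ?\<psi> = "\<lambda>j. if j < k1 then \<psi>1 j else \<psi>2 (j - k1)"
  let ?m = "\<lambda>j. if j < k1 then m1 j else m2 (j - k1)"
  have "irreducible_character n (?\<psi> j)" if "j < k1 + k2" for j using 1 2 that by auto
  moreover have "\<chi>1 \<pi> + \<chi>2 \<pi> = (\<Sum>j<k1 + k2. of_nat (?m j) * ?\<psi> j \<pi>)"
    if "\<pi> \<in> carrier (sym_group n)" for \<pi>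
  proof -
    have "(\<Sum>j<k1 + k2. of_nat (?m j) * ?\<psi> j \<pi>)
        = (\<Sum>j<k1. of_nat (?m j) * ?\<psi> j \<pi>) + (\<Sum>j=k1..<k1 + k2. of_nat (?m j) * ?\<psi> j \<pi>)"
      using sum.atLeastLessThan_concat[of 0 k1 "k1 + k2" "\<lambda>j. of_nat (?m j) * ?\<psi> j \<pi>"]
      by (simp add: lessThan_atLeast0)
    also have "(\<Sum>j=k1..<k1 + k2. of_nat (?m j) * ?\<psi> j \<pi>) = (\<Sum>j<k2. of_nat (m2 j) * \<psi>2 j \<pi>)"
      using sum.shift_bounds_nat_ivl[of "\<lambda>j. of_nat (?m j) * ?\<psi> j \<pi>" 0 k1 k2]
      by (simp add: lessThan_atLeast0 add.commute)
    finally show ?thesis using 1(2) 2(2) that by simp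
  qed
  ultimately show ?thesis unfolding character_def
    by (intro exI[of _ "k1 + k2"] exI[of _ ?\<psi>] exI[of _ ?m]) auto
qed

lemma character_sum:
  assumes "finite I" "\<And>i. i \<in> I \<Longrightarrow> character n (\<chi> i)"
  shows "character n (\<lambda>\<pi>. \<Sum>i\<in>I. \<chi> i \<pi>)"
  using assms by (induction I rule: finite_induct) (auto simp: character_zero intro: character_add)

text \<open>
  Isolates the vector space axioms of an invariant subspace in elementary form, away from the record
  based notion of subspace.
\<close>

lemma not_irreducible_rep_obtain_subspace:
  assumes "matrix_rep n d \<rho>" "d > 0" "\<not> irreducible_rep n d \<rho>"
  obtains W where "W \<subseteq> carrier_vec d" "0\<^sub>v d \<in> W" "\<And>v w. v \<in> W \<Longrightarrow> w \<in> W \<Longrightarrow> v + w \<in> W"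
    "\<And>c v. v \<in> W \<Longrightarrow> c \<cdot>\<^sub>v v \<in> W"
    "\<And>\<pi> w. \<pi> \<in> carrier (sym_group n) \<Longrightarrow> w \<in> W \<Longrightarrow> \<rho> \<pi> *\<^sub>v w \<in> W"
    "W \<noteq> {0\<^sub>v d}" "W \<noteq> carrier_vec d"
proof -
  from assms obtain W where W: "VectorSpace.subspace class_ring W (module_vec TYPE(complex) d)"
    "\<forall>\<pi> \<in> carrier (sym_group n). \<forall>w \<in> W. \<rho> \<pi> *\<^sub>v w \<in> W" "W \<noteq> {0\<^sub>v d}" "W \<noteq> carrier_vec d"
    unfolding irreducible_rep_def by blast
  show ?thesis
    by (rule that[of W])
      (use W in \<open>auto simp: VectorSpace.subspace_def LinearCombinations.submodule_def
         module_vec_simps class_ring_simps\<close>)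
qed

text \<open>
  The trace is additive along a composition series. If the representation is reducible, an invariant
  subspace and the quotient by it (realized on a complement) have smaller dimension, and the trace
  is the sum of their traces.
\<close>

lemma trace_representation_character_aux:
  fixes T :: "(nat \<Rightarrow> nat) \<Rightarrow> ('a \<Rightarrow> complex) \<Rightarrow> ('a \<Rightarrow> complex)"
  assumes "cfun.independent B" "finite B" "card B = d"
    and "\<And>\<pi>. \<pi> \<in> carrier (sym_group n) \<Longrightarrow> flinear (T \<pi>)"
    and "\<And>\<pi> v. \<pi> \<in> carrier (sym_group n) \<Longrightarrow> v \<in> cfun.span B \<Longrightarrow> T \<pi> v \<in> cfun.span B"
    and "\<And>v. v \<in> cfun.span B \<Longrightarrow> T id v = v"
    and "\<And>\<pi> \<tau> v. \<pi> \<in> carrier (sym_group n) \<Longrightarrow> \<tau> \<in> carrier (sym_group n) \<Longrightarrow> v \<in> cfun.span B \<Longrightarrow>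
      T (\<pi> \<circ> \<tau>) v = T \<pi> (T \<tau> v)"
  shows "character n (\<lambda>\<pi>. \<Sum>b\<in>B. cfun.representation B (T \<pi> b) b)"
  using assms
proof (induction d arbitrary: B T rule: less_induct)
  case (less d)
  note B = less.prems(1,2) and cardB = less.prems(3)
  note T = less.prems(4-7)
  let ?r = cfun.representation
  let ?G = "carrier (sym_group n)"
  let ?V = "cfun.span B"
  have idG: "id \<in> ?G" by (simp add: sym_group_carrier permutes_id)
  have compG: "\<pi> \<circ> \<tau> \<in> ?G" if "\<pi> \<in> ?G" "\<tau> \<in> ?G" for \<pi> \<tau>
    using that by (simp add: sym_group_carrier permutes_compose)
  have BV: "b \<in> ?V" if "b \<in> B" for b using that cfun.span_base by blast
  obtain b where b: "bij_betw b {0..<d} B" using ex_bij_betw_nat_finite[OF B(2)] cardB by auto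
  have bB: "b i \<in> B" if "i < d" for i using bij_betwE[OF b] that by auto
  have binj: "b i = b j \<longleftrightarrow> i = j" if "i < d" "j < d" for i j
    using bij_betw_imp_inj_on[OF b] that by (auto simp: inj_on_def)
  have sumB: "(\<Sum>c\<in>B. f c) = (\<Sum>i=0..<d. f (b i))" for f :: "_ \<Rightarrow> complex"
    by (rule sum.reindex_bij_betw[OF b, symmetric])
  have expand: "?r B (T \<pi> v) x = (\<Sum>i=0..<d. ?r B v (b i) * ?r B (T \<pi> (b i)) x)"
    if "\<pi> \<in> ?G" "v \<in> ?V" for \<pi> v x
    using flinear_representation_expand[OF B T(1)[OF that(1)] _ that(2)] T(2)[OF that(1)] BV
    by (simp add: sumB)
  define \<rho> where "\<rho> = (\<lambda>\<pi>. mat d d (\<lambda>(i, j). ?r B (T \<pi> (b j)) (b i)))"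
  have rep: "matrix_rep n d \<rho>"
    unfolding matrix_rep_def
  proof (intro conjI ballI)
    show "\<rho> id = 1\<^sub>m d" unfolding \<rho>_def
      by (rule eq_matI) (auto simp: T(3) BV bB B cfun.representation_basis binj)
    show "\<rho> (\<pi> \<circ> \<tau>) = \<rho> \<pi> * \<rho> \<tau>" if "\<pi> \<in> ?G" "\<tau> \<in> ?G" for \<pi> \<tau>
    proof (rule eq_matI)
      fix i j assume "i < dim_row (\<rho> \<pi> * \<rho> \<tau>)" "j < dim_col (\<rho> \<pi> * \<rho> \<tau>)"
      hence ij: "i < d" "j < d" by (auto simp: \<rho>_def)
      have "?r B (T (\<pi> \<circ> \<tau>) (b j)) (b i) = ?r B (T \<pi> (T \<tau> (b j))) (b i)"
        by (simp only: T(4)[OF that BV[OF bB[OF ij(2)]]])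
      also have "\<dots> = (\<Sum>k=0..<d. ?r B (T \<tau> (b j)) (b k) * ?r B (T \<pi> (b k)) (b i))"
        by (rule expand[OF that(1) T(2)[OF that(2) BV[OF bB[OF ij(2)]]]])
      finally show "\<rho> (\<pi> \<circ> \<tau>) $$ (i, j) = (\<rho> \<pi> * \<rho> \<tau>) $$ (i, j)"
        using ij by (simp add: \<rho>_def scalar_prod_def mult.commute)
    qed (auto simp: \<rho>_def)
  qed (simp add: \<rho>_def)
  have tr: "(\<Sum>c\<in>B. ?r B (T \<pi> c) c) = (\<Sum>i<d. \<rho> \<pi> $$ (i, i))" for \<pi>
    by (simp add: sumB \<rho>_def lessThan_atLeast0)
  show ?case
  proof (cases "d = 0 \<or> irreducible_rep n d \<rho>")
    case True
    thus ?thesis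
    proof
      assume "d = 0"
      thus ?thesis by (simp add: tr character_zero)
    next
      assume "irreducible_rep n d \<rho>"
      hence "irreducible_character n (\<lambda>\<pi>. \<Sum>c\<in>B. ?r B (T \<pi> c) c)"
        unfolding irreducible_character_def tr by blast
      thus ?thesis by (rule character_irreducible)
    qed
  next
    case False
    then obtain W where W: "W \<subseteq> carrier_vec d" "0\<^sub>v d \<in> W" "\<And>v w. v \<in> W \<Longrightarrow> w \<in> W \<Longrightarrow> v + w \<in> W"
      "\<And>c v. v \<in> W \<Longrightarrow> c \<cdot>\<^sub>v v \<in> W" "\<And>\<pi> w. \<pi> \<in> ?G \<Longrightarrow> w \<in> W \<Longrightarrow> \<rho> \<pi> *\<^sub>v w \<in> W"
      "W \<noteq> {0\<^sub>v d}" "W \<noteq> carrier_vec d"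
      using not_irreducible_rep_obtain_subspace[OF rep] by blast
    \<comment> \<open>The invariant subspace of the matrix representation, read in coordinates with respect to \<open>B\<close>.\<close>
    define coord where "coord = (\<lambda>v. vec d (\<lambda>i. ?r B v (b i)))"
    define V' where "V' = {v \<in> ?V. coord v \<in> W}"
    have coord_inj: "v = w" if "coord v = coord w" "v \<in> ?V" "w \<in> ?V" for v w
    proof -
      have "?r B v (b i) = ?r B w (b i)" if "i < d" for i
        using arg_cong[OF \<open>coord v = coord w\<close>, of "\<lambda>u. u $ i"] that by (simp add: coord_def)
      hence "?r B v c = ?r B w c" if "c \<in> B" for c
        using that bij_betw_imp_surj_on[OF b] by auto
      hence "(\<Sum>c\<in>B. fscale (?r B v c) c) = (\<Sum>c\<in>B. fscale (?r B w c) c)" by simp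
      thus ?thesis using cfun.sum_representation_eq[OF B(1) that(2) B(2) subset_refl]
          cfun.sum_representation_eq[OF B(1) that(3) B(2) subset_refl] by simp
    qed
    have coord_surj: "\<exists>v\<in>?V. coord v = w" if "w \<in> carrier_vec d" for w
    proof
      let ?v = "\<Sum>i=0..<d. fscale (w $ i) (b i)"
      show V: "?v \<in> ?V" by (intro cfun.span_sum cfun.span_scale BV bB) simp
      have "?r B ?v = (\<lambda>x. \<Sum>i=0..<d. ?r B (fscale (w $ i) (b i)) x)"
        by (rule cfun.representation_sum[OF B(1)]) (intro cfun.span_scale BV bB, simp)
      hence "?r B ?v (b j) = w $ j" if "j < d" for j
      proof -
        have "?r B ?v (b j) = (\<Sum>i=0..<d. w $ i * ?r B (b i) (b j))"
          unfolding \<open>?r B ?v = _\<close> by (intro sum.cong refl) (simp add: cfun.representation_scale B BV bB)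
        also have "\<dots> = (\<Sum>i=0..<d. if i = j then w $ i else 0)"
          by (intro sum.cong refl) (use that in \<open>auto simp: cfun.representation_basis B bB binj\<close>)
        finally show ?thesis using that by simp
      qed
      thus "coord ?v = w" unfolding coord_def by (intro eq_vecI) (use that in auto)
    qed
    have coord_add: "coord (v + w) = coord v + coord w" if "v \<in> ?V" "w \<in> ?V" for v w
      unfolding coord_def by (intro eq_vecI) (auto simp: cfun.representation_add B that)
    have coord_scale: "coord (fscale c v) = c \<cdot>\<^sub>v coord v" if "v \<in> ?V" for v c
      unfolding coord_def by (intro eq_vecI) (auto simp: cfun.representation_scale B that)
    have coord_zero: "coord 0 = 0\<^sub>v d"
      unfolding coord_def by (intro eq_vecI) (auto simp: cfun.representation_zero)
    have coord_T: "coord (T \<pi> v) = \<rho> \<pi> *\<^sub>v coord v" if "\<pi> \<in> ?G" "v \<in> ?V" for \<pi> v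
    proof (rule eq_vecI)
      fix i assume "i < dim_vec (\<rho> \<pi> *\<^sub>v coord v)"
      hence i: "i < d" by (simp add: \<rho>_def)
      show "coord (T \<pi> v) $ i = (\<rho> \<pi> *\<^sub>v coord v) $ i"
        using i expand[OF that, of "b i"] by (simp add: coord_def \<rho>_def scalar_prod_def mult.commute)
    qed (simp add: coord_def \<rho>_def)
    have subV': "cfun.subspace V'"
      unfolding V'_def
      by (rule cfun.subspaceI)
        (use W in \<open>auto simp: coord_zero coord_add coord_scale cfun.span_zero cfun.span_add cfun.span_scale\<close>)
    have TV': "T \<pi> v \<in> V'" if "\<pi> \<in> ?G" "v \<in> V'" for \<pi> v
      using that W(5) T(2) by (auto simp: V'_def coord_T)
    obtain B1 where B1: "B1 \<subseteq> V'" "cfun.independent B1" "V' \<subseteq> cfun.span B1"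
      by (rule cfun.maximal_independent_subset)
    have spB1: "cfun.span B1 = V'" using B1(3) cfun.span_minimal[OF B1(1) subV'] by (rule equalityI[rotated])
    have B1V: "B1 \<subseteq> ?V" using B1(1) by (auto simp: V'_def)
    obtain B2 where B2: "B1 \<subseteq> B2" "B2 \<subseteq> ?V" "cfun.independent B2" "?V \<subseteq> cfun.span B2"
      by (rule cfun.maximal_independent_subset_extend[OF B1V B1(2)])
    have spB2: "cfun.span B2 = ?V"
      using cfun.span_minimal[OF B2(2) cfun.subspace_span] B2(4) by (rule equalityI)
    have finB2: "finite B2" using cfun.independent_span_bound[OF B(2) B2(3,2)] by auto
    have cardB2: "card B2 = d"
      using cfun.dim_eq_card[OF spB2 B2(3)] cfun.dim_eq_card[OF refl B(1)] cardB by simp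
    have finB1: "finite B1" using B2(1) finB2 finite_subset by blast
    have ne1: "B1 \<noteq> {}"
    proof
      assume "B1 = {}"
      hence V'0: "V' = {0}" using spB1 by simp
      have "w = 0\<^sub>v d" if "w \<in> W" for w
      proof -
        obtain v where v: "v \<in> ?V" "coord v = w" using coord_surj W(1) \<open>w \<in> W\<close> by (meson subsetD)
        have "v \<in> V'" using \<open>w \<in> W\<close> v by (simp add: V'_def)
        hence "v = 0" unfolding V'0 by (rule singletonD)
        thus ?thesis using v(2) coord_zero by simp
      qed
      thus False using W(2,6) by blast
    qed
    have ne2: "B1 \<noteq> B2"
    proof
      assume "B1 = B2"
      hence V'V: "V' = ?V" using spB1 spB2 by simp
      have "w \<in> W" if "w \<in> carrier_vec d" for w
        using coord_surj[OF that] V'V unfolding V'_def by blast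
      thus False using W(1,7) by blast
    qed
    let ?C = "B2 - B1"
    have card1: "card B1 < d" using B2(1) ne2 finB2 cardB2 psubset_card_mono[of B2 B1] by auto
    have cardC: "card ?C < d"
      using ne1 finB1 card_Diff_subset[OF finB1 B2(1)] card1 cardB2 card_gt_0_iff[of B1] by linarith
    have indC: "cfun.independent ?C" using B2(3) cfun.independent_mono by blast
    have finC: "finite ?C" using finB2 by auto
    define E where "E = cfun.extend_basis B2"
    have E: "B2 \<subseteq> E" "cfun.independent E" "cfun.span E = UNIV"
      unfolding E_def using cfun.extend_basis_superset cfun.independent_extend_basis
        cfun.span_extend_basis B2(3) by auto
    have repE: "?r E v = ?r B2 v" if "v \<in> ?V" for v
      using cfun.representation_extend[OF E(2) _ E(1)] that spB2 by simp
    \<comment> \<open>The projection onto the complement spanned by the new basis vectors; it carries the action of the quotient.\<close>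
    define Q where "Q = (\<lambda>v. \<Sum>c\<in>?C. fscale (?r E v c) c)"
    have linQ: "flinear Q"
    proof (rule flinearI)
      show "Q (x + y) = Q x + Q y" for x y
        unfolding Q_def by (simp add: cfun.representation_add E cfun.scale_left_distrib sum.distrib)
      show "Q (fscale c x) = fscale c (Q x)" for c x
        unfolding Q_def by (simp add: cfun.representation_scale E cfun.scale_sum_right)
    qed
    interpret Q: Vector_Spaces.linear fscale fscale Q by (rule linQ)
    have QC: "Q v \<in> cfun.span ?C" for v
      unfolding Q_def by (intro cfun.span_sum cfun.span_scale cfun.span_base)
    have CV: "cfun.span ?C \<subseteq> ?V" using cfun.span_mono[of ?C B2] spB2 by auto
    have Q_C: "Q v = v" if "v \<in> cfun.span ?C" for v
    proof -
      have "?r E v = ?r ?C v"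
        using cfun.representation_extend[OF E(2) that] E(1) by auto
      thus ?thesis unfolding Q_def
        using cfun.sum_representation_eq[OF indC that finC subset_refl] by simp
    qed
    have Q_B1: "Q v = 0" if "v \<in> V'" for v
    proof -
      have "?r E v = ?r B1 v"
        using cfun.representation_extend[OF E(2), of v B1] E(1) B2(1) that spB1 by auto
      moreover have "?r B1 v c = 0" if "c \<notin> B1" for c
        using cfun.representation_ne_zero that by blast
      ultimately have "?r E v c = 0" if "c \<in> ?C" for c using that by simp
      thus ?thesis unfolding Q_def by (intro sum.neutral ballI) (simp only: cfun.scale_zero_left)
    qed
    have diffQ: "v - Q v \<in> V'" if "v \<in> ?V" for v
    proof -
      have "v = (\<Sum>c\<in>B2. fscale (?r B2 v c) c)"
        using cfun.sum_representation_eq[OF B2(3) _ finB2 subset_refl] that spB2 by simp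
      also have "\<dots> = (\<Sum>c\<in>B1. fscale (?r B2 v c) c) + (\<Sum>c\<in>?C. fscale (?r B2 v c) c)"
        by (subst sum.subset_diff[OF B2(1) finB2], rule add.commute)
      also have "(\<Sum>c\<in>?C. fscale (?r B2 v c) c) = Q v" unfolding Q_def repE[OF that] ..
      finally have "v - Q v = (\<Sum>c\<in>B1. fscale (?r B2 v c) c)" by (metis add_diff_cancel_right')
      moreover have "\<dots> \<in> cfun.span B1" by (intro cfun.span_sum cfun.span_scale cfun.span_base)
      ultimately show ?thesis using spB1 by simp
    qed
    let ?T' = "\<lambda>\<pi> v. Q (T \<pi> v)"
    have chi1: "character n (\<lambda>\<pi>. \<Sum>b\<in>B1. ?r B1 (T \<pi> b) b)"
    proof (rule less.IH[OF card1 B1(2) finB1 refl])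
      show "flinear (T \<pi>)" if "\<pi> \<in> ?G" for \<pi> by (rule T(1)[OF that])
      show "T \<pi> v \<in> cfun.span B1" if "\<pi> \<in> ?G" "v \<in> cfun.span B1" for \<pi> v
        using TV'[OF that(1)] that(2) unfolding spB1 .
      have "v \<in> ?V" if "v \<in> cfun.span B1" for v using that spB1 unfolding V'_def by blast
      thus "T id v = v" "\<pi> \<in> ?G \<Longrightarrow> \<tau> \<in> ?G \<Longrightarrow> T (\<pi> \<circ> \<tau>) v = T \<pi> (T \<tau> v)"
        if "v \<in> cfun.span B1" for v \<pi> \<tau> using that T(3,4) by blast+
    qed
    have chi2: "character n (\<lambda>\<pi>. \<Sum>b\<in>?C. ?r ?C (?T' \<pi> b) b)"
    proof (rule less.IH[OF cardC indC finC refl])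
      show "flinear (?T' \<pi>)" if "\<pi> \<in> ?G" for \<pi>
        using Vector_Spaces.linear_compose[OF T(1)[OF that] linQ] by (simp add: o_def)
      show "Q (T \<pi> v) \<in> cfun.span ?C" for \<pi> v by (rule QC)
      show "Q (T id v) = v" if "v \<in> cfun.span ?C" for v
        using that T(3)[of v] CV Q_C[of v] by (metis subsetD)
      fix \<pi> \<tau> v assume *: "\<pi> \<in> ?G" "\<tau> \<in> ?G" "v \<in> cfun.span ?C"
      interpret T: Vector_Spaces.linear fscale fscale "T \<pi>" by (rule T(1)) fact
      have vV: "v \<in> ?V" and tV: "T \<tau> v \<in> ?V" using *(3) CV T(2)[OF *(2), of v] by (blast, blast)
      have "Q (T \<pi> (T \<tau> v)) - Q (T \<pi> (Q (T \<tau> v))) = Q (T \<pi> (T \<tau> v - Q (T \<tau> v)))"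
        by (simp only: T.diff Q.diff)
      also have "\<dots> = 0" by (intro Q_B1 TV' diffQ tV *)
      finally show "Q (T (\<pi> \<circ> \<tau>) v) = Q (T \<pi> (Q (T \<tau> v)))"
        unfolding T(4)[OF *(1,2) vV] by (rule eq_iff_diff_eq_0[THEN iffD2])
    qed
    have "(\<Sum>b\<in>B. ?r B (T \<pi> b) b)
        = (\<Sum>b\<in>B1. ?r B1 (T \<pi> b) b) + (\<Sum>b\<in>?C. ?r ?C (?T' \<pi> b) b)" if \<pi>: "\<pi> \<in> ?G" for \<pi>
    proof -
      have "(\<Sum>b\<in>B. ?r B (T \<pi> b) b) = trace_on ?V (T \<pi>)"
        by (rule trace_on_eq[symmetric, OF B refl T(1,2)[OF \<pi>]])
      also have "\<dots> = (\<Sum>b\<in>B2. ?r B2 (T \<pi> b) b)"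
        by (rule trace_on_eq[OF B2(3) finB2 spB2 T(1,2)[OF \<pi>]])
      also have "\<dots> = (\<Sum>b\<in>B1. ?r B2 (T \<pi> b) b) + (\<Sum>b\<in>?C. ?r B2 (T \<pi> b) b)"
        by (subst sum.subset_diff[OF B2(1) finB2], rule add.commute)
      finally have e1: "(\<Sum>b\<in>B. ?r B (T \<pi> b) b) = (\<Sum>b\<in>B1. ?r B2 (T \<pi> b) b) + (\<Sum>b\<in>?C. ?r B2 (T \<pi> b) b)" .
      have e2: "(\<Sum>b\<in>B1. ?r B2 (T \<pi> b) b) = (\<Sum>b\<in>B1. ?r B1 (T \<pi> b) b)"
      proof (intro sum.cong refl)
        fix c assume c: "c \<in> B1"
        have "T \<pi> c \<in> cfun.span B1" using TV'[OF \<pi>] c B1(1) spB1 by auto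
        thus "?r B2 (T \<pi> c) c = ?r B1 (T \<pi> c) c"
          using cfun.representation_extend[OF B2(3) _ B2(1)] by simp
      qed
      have e3: "(\<Sum>b\<in>?C. ?r B2 (T \<pi> b) b) = (\<Sum>b\<in>?C. ?r ?C (?T' \<pi> b) b)"
      proof (intro sum.cong refl)
        fix c assume c: "c \<in> ?C"
        have TV: "T \<pi> c \<in> ?V" using T(2)[OF \<pi>] c B2(2) by auto
        have "?r ?C (Q (T \<pi> c)) = (\<lambda>x. \<Sum>b\<in>?C. ?r ?C (fscale (?r E (T \<pi> c) b) b) x)"
          unfolding Q_def by (rule cfun.representation_sum[OF indC]) (intro cfun.span_scale cfun.span_base)
        hence "?r ?C (Q (T \<pi> c)) c = (\<Sum>b\<in>?C. ?r B2 (T \<pi> c) b * ?r ?C b c)"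
          by (simp add: cfun.representation_scale indC cfun.span_base repE[OF TV])
        also have "\<dots> = (\<Sum>b\<in>?C. if b = c then ?r B2 (T \<pi> c) b else 0)"
          by (intro sum.cong refl) (auto simp: cfun.representation_basis indC)
        also have "\<dots> = ?r B2 (T \<pi> c) c" using c finC by simp
        finally show "?r B2 (T \<pi> c) c = ?r ?C (?T' \<pi> c) c" by simp
      qed
      show ?thesis unfolding e1 e2 e3 ..
    qed
    thus ?thesis by (rule character_cong[OF character_add[OF chi1 chi2]])
  qed
qed

section \<open>Permutation characters\<close>

lemma sum_fun_apply: "(\<Sum>i\<in>I. f i) x = (\<Sum>i\<in>I. f i x :: complex)"
  by (induction I rule: infinite_finite_induct) simp_all

text \<open>
  Evaluation at the points \<open>p\<close> reads off the coefficients of a linear combination. Delta functions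
  and indicators of row words are families of this kind.
\<close>

lemma dual_points:
  fixes e :: "'i \<Rightarrow> 'a \<Rightarrow> complex"
  assumes I: "finite I" and dual: "\<And>i j. i \<in> I \<Longrightarrow> j \<in> I \<Longrightarrow> e i (p j) = (if i = j then 1 else 0)"
  shows dual_points_inj: "inj_on e I"
    and dual_points_independent: "cfun.independent (e ` I)"
    and dual_points_representation:
      "\<And>v i. v \<in> cfun.span (e ` I) \<Longrightarrow> i \<in> I \<Longrightarrow> cfun.representation (e ` I) v (e i) = v (p i)"
proof -
  show inj: "inj_on e I"
  proof (rule inj_onI)
    fix i j assume ij: "i \<in> I" "j \<in> I" "e i = e j"
    have "e j (p i) = 1" using dual[OF ij(1) ij(1)] unfolding ij(3) by simp
    thus "i = j" using dual[OF ij(2) ij(1)] by (simp split: if_splits)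
  qed
  have sum_at: "(\<Sum>w\<in>e ` I. fscale (c w) w) (p i) = c (e i)" if "i \<in> I" for c i
  proof -
    have "(\<Sum>w\<in>e ` I. fscale (c w) w) (p i) = (\<Sum>j\<in>I. c (e j) * e j (p i))"
      by (subst sum.reindex[OF inj]) (simp add: sum_fun_apply fscale_def)
    also have "\<dots> = (\<Sum>j\<in>I. if j = i then c (e j) else 0)"
      by (intro sum.cong refl) (use that in \<open>auto simp: dual\<close>)
    finally show ?thesis using that I by simp
  qed
  show ind: "cfun.independent (e ` I)"
  proof (rule cfun.independent_if_scalars_zero)
    fix c w assume *: "(\<Sum>w\<in>e ` I. fscale (c w) w) = 0" "w \<in> e ` I"
    then obtain i where "i \<in> I" "w = e i" by auto
    thus "c w = 0" using sum_at[of i c] *(1) by simp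
  qed (use I in auto)
  fix v i assume v: "v \<in> cfun.span (e ` I)" "i \<in> I"
  have "v = (\<Sum>w\<in>e ` I. fscale (cfun.representation (e ` I) v w) w)"
    using cfun.sum_representation_eq[OF ind v(1) _ subset_refl] I by simp
  thus "cfun.representation (e ` I) v (e i) = v (p i)" using sum_at[OF v(2), of "cfun.representation (e ` I) v"] by simp
qed

lemma sum_fscale_linear:
  fixes f :: "'i \<Rightarrow> 'a \<Rightarrow> complex"
  shows "flinear (\<lambda>v y. \<Sum>i\<in>I. v (q i) * f i y)"
  by (rule flinearI) (auto simp: fun_eq_iff fscale_def sum.distrib algebra_simps sum_distrib_left)

text \<open>
  The linearization of the action permutes the delta functions of \<open>X\<close>; the diagonal entry at \<open>x\<close> is
  1 if \<open>x\<close> is fixed and 0 otherwise.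
\<close>

lemma permutation_character:
  assumes X: "finite X"
    and act: "\<And>\<pi> x. \<pi> \<in> carrier (sym_group n) \<Longrightarrow> x \<in> X \<Longrightarrow> act \<pi> x \<in> X"
      "\<And>x. x \<in> X \<Longrightarrow> act id x = x"
      "\<And>\<pi> \<tau> x. \<pi> \<in> carrier (sym_group n) \<Longrightarrow> \<tau> \<in> carrier (sym_group n) \<Longrightarrow> x \<in> X \<Longrightarrow>
        act (\<pi> \<circ> \<tau>) x = act \<pi> (act \<tau> x)"
  shows "character n (\<lambda>\<pi>. of_nat (card {x \<in> X. act \<pi> x = x}))"
proof -
  let ?e = "\<lambda>x y. if y = x then 1 else (0 :: complex)"
  let ?G = "carrier (sym_group n)"
  define T where "T = (\<lambda>\<pi> v y. \<Sum>x\<in>X. v x * ?e (act \<pi> x) y)"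
  have dual: "\<And>i j. i \<in> X \<Longrightarrow> j \<in> X \<Longrightarrow> ?e i ((\<lambda>x. x) j) = (if i = j then 1 else 0)" by auto
  have d: "inj_on ?e X" by (rule dual_points_inj[of X ?e "\<lambda>x. x", OF X dual])
  have d2: "cfun.independent (?e ` X)" by (rule dual_points_independent[of X ?e "\<lambda>x. x", OF X dual])
  have d3: "cfun.representation (?e ` X) v (?e x) = v x" if "v \<in> cfun.span (?e ` X)" "x \<in> X" for v x
    by (rule dual_points_representation[of X ?e "\<lambda>x. x", OF X dual that])
  have lin: "flinear (T \<pi>)" for \<pi> unfolding T_def by (rule sum_fscale_linear)
  have Te: "T \<pi> (?e x) = ?e (act \<pi> x)" if "x \<in> X" for \<pi> x
  proof
    fix y
    have "T \<pi> (?e x) y = (\<Sum>z\<in>X. if z = x then ?e (act \<pi> z) y else 0)"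
      unfolding T_def by (intro sum.cong refl) auto
    thus "T \<pi> (?e x) y = ?e (act \<pi> x) y" using that X by simp
  qed
  have span: "(\<Sum>x\<in>X. fscale (c x) (?e x)) \<in> cfun.span (?e ` X)" for c
    by (intro cfun.span_sum cfun.span_scale cfun.span_base) auto
  have Tspan: "T \<pi> v \<in> cfun.span (?e ` X)" if "\<pi> \<in> ?G" for \<pi> v
  proof -
    have "T \<pi> v = (\<Sum>x\<in>X. fscale (v x) (?e (act \<pi> x)))"
      by (simp add: T_def fun_eq_iff sum_fun_apply fscale_def)
    also have "\<dots> \<in> cfun.span (?e ` X)"
      using act(1)[OF that] by (intro cfun.span_sum cfun.span_scale cfun.span_base) auto
    finally show ?thesis .
  qed
  have ext: "S v = S' v" if "flinear S" "flinear S'" "\<And>x. x \<in> X \<Longrightarrow> S (?e x) = S' (?e x)"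
    "v \<in> cfun.span (?e ` X)" for S S' :: "('a \<Rightarrow> complex) \<Rightarrow> 'a \<Rightarrow> complex" and v
  proof -
    interpret S: Vector_Spaces.linear fscale fscale S by fact
    interpret S': Vector_Spaces.linear fscale fscale S' by fact
    show ?thesis using that(4)
    proof (induction rule: cfun.span_induct_alt)
      case base show ?case unfolding S.zero S'.zero ..
    next
      case (step c w y)
      show ?case unfolding S.add S'.add S.scale S'.scale using step that(3) by auto
    qed
  qed
  have "character n (\<lambda>\<pi>. \<Sum>b\<in>?e ` X. cfun.representation (?e ` X) (T \<pi> b) b)"
  proof (rule trace_representation_character_aux[OF d2 _ refl])
    show "finite (?e ` X)" using X by simp
    show "flinear (T \<pi>)" for \<pi> by (rule lin)
    show "T \<pi> v \<in> cfun.span (?e ` X)" if "\<pi> \<in> ?G" for \<pi> v by (rule Tspan[OF that])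
    show "T id v = v" if "v \<in> cfun.span (?e ` X)" for v
      
    proof -
      have linid: "flinear (\<lambda>v :: 'a \<Rightarrow> complex. v)" by (rule flinearI) auto
      have "T id (?e x) = ?e x" if "x \<in> X" for x unfolding Te[OF that] act(2)[OF that] ..
      thus ?thesis by (rule ext[OF lin[of id] linid _ that])
    qed
    show "T (\<pi> \<circ> \<tau>) v = T \<pi> (T \<tau> v)"
      if "\<pi> \<in> ?G" "\<tau> \<in> ?G" "v \<in> cfun.span (?e ` X)" for \<pi> \<tau> v
    proof (rule ext[OF lin _ _ that(3)])
      show "flinear (\<lambda>v. T \<pi> (T \<tau> v))"
        using Vector_Spaces.linear_compose[OF lin[of \<tau>] lin[of \<pi>]] unfolding comp_def .
      show "T (\<pi> \<circ> \<tau>) (?e x) = T \<pi> (T \<tau> (?e x))" if "x \<in> X" for x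
        unfolding Te[OF that] Te[OF act(1)[OF \<open>\<tau> \<in> ?G\<close> that]] act(3)[OF \<open>\<pi> \<in> ?G\<close> \<open>\<tau> \<in> ?G\<close> that] ..
    qed
  qed
  moreover have "of_nat (card {x \<in> X. act \<pi> x = x})
      = (\<Sum>b\<in>?e ` X. cfun.representation (?e ` X) (T \<pi> b) b)" if "\<pi> \<in> ?G" for \<pi>
  proof -
    have "(\<Sum>b\<in>?e ` X. cfun.representation (?e ` X) (T \<pi> b) b)
        = (\<Sum>x\<in>X. cfun.representation (?e ` X) (T \<pi> (?e x)) (?e x))"
      by (rule sum.reindex[OF d, unfolded comp_def])
    also have "\<dots> = (\<Sum>x\<in>X. T \<pi> (?e x) x)"
      by (intro sum.cong refl) (rule d3[OF Tspan[OF that]])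
    also have "\<dots> = (\<Sum>x\<in>X. if act \<pi> x = x then 1 else 0)"
      by (intro sum.cong refl) (auto simp: Te)
    also have "\<dots> = of_nat (card {x \<in> X. act \<pi> x = x})"
      using X by (simp add: sum.If_cases Int_def)
    finally show ?thesis ..
  qed
  ultimately show ?thesis by (rule character_cong)
qed

section \<open>Traces of quasi-idempotent matrices\<close>

lemma trace_similar_mat:
  fixes A :: "complex mat"
  assumes "similar_mat_wit A B P Q" "A \<in> carrier_mat d d"
  shows "(\<Sum>i<d. A $$ (i, i)) = (\<Sum>i<d. B $$ (i, i))"
proof -
  from similar_mat_witD2[OF assms(2,1)] have *: "P * Q = 1\<^sub>m d" "Q * P = 1\<^sub>m d" "A = P * B * Q"
    "B \<in> carrier_mat d d" "P \<in> carrier_mat d d" "Q \<in> carrier_mat d d" by auto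
  have tr: "(\<Sum>i<d. (X * Y) $$ (i, i)) = (\<Sum>i<d. (Y * X) $$ (i, i))"
    if "X \<in> carrier_mat d d" "Y \<in> carrier_mat d d" for X Y :: "complex mat"
  proof -
    have "(\<Sum>i<d. (X * Y) $$ (i, i)) = (\<Sum>i<d. \<Sum>k<d. X $$ (i, k) * Y $$ (k, i))"
      using that by (intro sum.cong refl) (auto simp: scalar_prod_def lessThan_atLeast0)
    also have "\<dots> = (\<Sum>k<d. \<Sum>i<d. Y $$ (k, i) * X $$ (i, k))"
      by (subst sum.swap) (simp add: mult.commute)
    also have "\<dots> = (\<Sum>i<d. (Y * X) $$ (i, i))"
      using that by (intro sum.cong refl) (auto simp: scalar_prod_def lessThan_atLeast0)
    finally show ?thesis .
  qed
  have "(\<Sum>i<d. A $$ (i, i)) = (\<Sum>i<d. (Q * (P * B)) $$ (i, i))"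
    unfolding *(3) by (rule tr) (use * in auto)
  also have "Q * (P * B) = B"
    using *(2,4) assoc_mult_mat[OF *(6,5,4)] left_mult_one_mat[of B d d] by metis
  finally show ?thesis .
qed

text \<open>
  After triangularization by Schur decomposition the diagonal of an idempotent consists of zeros and
  ones.
\<close>

lemma trace_idempotent_nat:
  fixes A :: "complex mat"
  assumes A: "A \<in> carrier_mat d d" and idem: "A * A = A"
  shows "\<exists>m::nat. (\<Sum>i<d. A $$ (i, i)) = of_nat m"
proof -
  obtain es where es: "char_poly A = (\<Prod>a\<leftarrow>es. [:- a, 1:])"
    using char_poly_factorized[OF A] by blast
  obtain B P Q where "schur_decomposition A es = (B, P, Q)" by (cases "schur_decomposition A es") auto
  from schur_decomposition[OF A es this] have wit: "similar_mat_wit A B P Q" and ut: "upper_triangular B"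
    by auto
  from similar_mat_witD2[OF A wit] have *: "P * Q = 1\<^sub>m d" "Q * P = 1\<^sub>m d" "A = P * B * Q"
    "B \<in> carrier_mat d d" "P \<in> carrier_mat d d" "Q \<in> carrier_mat d d" by auto
  have QAP: "Q * A * P = B"
  proof -
    have "Q * A * P = Q * (P * B * Q) * P" by (simp only: *(3)[symmetric])
    also have "\<dots> = (Q * P) * B * (Q * P)" using *(4-6) by (simp add: assoc_mult_mat[of _ d d _ d _ d])
    finally show ?thesis using *(4) by (simp add: *(2))
  qed
  have "B * B = Q * A * P * (Q * A * P)" using QAP by simp
  also have "\<dots> = Q * A * (P * Q) * A * P" using *(4-6) A by (simp add: assoc_mult_mat[of _ d d _ d _ d])
  also have "\<dots> = Q * (A * A) * P" unfolding *(1) using *(4-6) A by (simp add: assoc_mult_mat[of _ d d _ d _ d])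
  finally have BB: "B * B = B" using idem QAP by simp
  have "B $$ (i, i) = 0 \<or> B $$ (i, i) = 1" if i: "i < d" for i
  proof -
    have "B $$ (i, i) = (B * B) $$ (i, i)" using BB by simp
    also have "\<dots> = (\<Sum>k\<in>{0..<d}. B $$ (i, k) * B $$ (k, i))"
      using *(4) i by (auto simp: scalar_prod_def)
    also have "\<dots> = (\<Sum>k\<in>{0..<d}. if k = i then B $$ (i, i) * B $$ (i, i) else 0)"
    proof (intro sum.cong refl)
      fix k assume k: "k \<in> {0..<d}"
      have "B $$ (r, c) = 0" if "c < r" "r < d" for r c using upper_triangularD[OF ut] that *(4) by auto
      thus "B $$ (i, k) * B $$ (k, i) = (if k = i then B $$ (i, i) * B $$ (i, i) else 0)"
        using k i by (cases k i rule: linorder_cases) auto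
    qed
    finally show ?thesis using i by simp
  qed
  hence "(\<Sum>i<d. B $$ (i, i)) = (\<Sum>i<d. of_nat (if B $$ (i, i) = 1 then 1 else 0))"
    by (intro sum.cong refl) auto
  also have "\<dots> = of_nat (\<Sum>i<d. if B $$ (i, i) = 1 then 1 else 0)" by simp
  finally show ?thesis unfolding trace_similar_mat[OF wit A] by (rule exI)
qed

text \<open>
  Scaling by the inverse of \<open>c\<close> makes the matrix idempotent.
\<close>

lemma trace_quasi_idempotent:
  fixes A :: "complex mat"
  assumes A: "A \<in> carrier_mat d d" and idem: "A * A = c \<cdot>\<^sub>m A" and c: "c \<noteq> 0"
  shows "\<exists>m::nat. (\<Sum>i<d. A $$ (i, i)) = c * of_nat m"
proof -
  let ?A = "inverse c \<cdot>\<^sub>m A"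
  have "?A * ?A = inverse c \<cdot>\<^sub>m (A * ?A)" by (rule mult_smult_assoc_mat[OF A]) (use A in auto)
  also have "A * ?A = inverse c \<cdot>\<^sub>m (A * A)" by (rule mult_smult_distrib[OF A A])
  also have "inverse c \<cdot>\<^sub>m (inverse c \<cdot>\<^sub>m (A * A)) = ?A"
    unfolding idem using c A by (intro eq_matI) auto
  finally obtain m :: nat where "(\<Sum>i<d. ?A $$ (i, i)) = of_nat m"
    using trace_idempotent_nat[of ?A d] A by auto
  moreover have "(\<Sum>i<d. ?A $$ (i, i)) = inverse c * (\<Sum>i<d. A $$ (i, i))"
    using A by (simp add: sum_distrib_left)
  ultimately show ?thesis using c by (intro exI[of _ m]) (simp add: field_simps)
qed

section \<open>The square of a hook Young symmetrizer\<close>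

lemma permutes_disjoint_commute:
  assumes "g permutes A" "h permutes B" "A \<inter> B = {}"
  shows "h \<circ> g = g \<circ> h"
proof
  fix x
  have gA: "g y \<in> A" if "y \<in> A" for y using permutes_in_image[OF assms(1)] that by simp
  have hB: "h y \<in> B" if "y \<in> B" for y using permutes_in_image[OF assms(2)] that by simp
  have g0: "g y = y" if "y \<notin> A" for y using permutes_not_in[OF assms(1) that] .
  have h0: "h y = y" if "y \<notin> B" for y using permutes_not_in[OF assms(2) that] .
  consider "x \<in> A" "g x \<notin> B" "x \<notin> B" | "x \<in> B" "h x \<notin> A" "x \<notin> A" | "x \<notin> A" "x \<notin> B"
    using gA[of x] hB[of x] assms(3) by blast
  thus "(h \<circ> g) x = (g \<circ> h) x" by cases (simp_all add: g0 h0)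
qed

lemma permutes_fixed_Diff:
  assumes "p permutes S" "p c = c"
  shows "p permutes (S - {c})"
  using assms by (auto intro!: permutes_superset[where T = "S - {c}"])

lemma permutes_Diff_fixed: "p permutes (S - {c}) \<longleftrightarrow> p permutes S \<and> p c = c"
  using permutes_fixed_Diff[of p S c] permutes_subset[of p "S - {c}" S] permutes_not_in[of p "S - {c}" c]
  by auto

lemma sign_compose_permutes:
  assumes "finite S" "p permutes S" "q permutes S"
  shows "sign (p \<circ> q) = sign p * sign q"
  using assms permutation_permutes by (metis sign_compose)

lemma signed_sum_compose_left:
  fixes f :: "('a \<Rightarrow> 'a) \<Rightarrow> complex"
  assumes S: "finite S" and q: "q permutes S"
  shows "(\<Sum>h | h permutes S. of_int (sign h) * f (q \<circ> h)) = of_int (sign q) * (\<Sum>h | h permutes S. of_int (sign h) * f h)"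
proof -
  have "(\<Sum>h | h permutes S. of_int (sign h) * f h) = (\<Sum>h | h permutes S. of_int (sign (q \<circ> h)) * f (q \<circ> h))"
    by (rule setum_permutations_compose_left[OF q])
  also have "\<dots> = (\<Sum>h | h permutes S. of_int (sign q) * (of_int (sign h) * f (q \<circ> h)))"
    by (intro sum.cong refl) (simp add: sign_compose_permutes[OF S q])
  finally have "(\<Sum>h | h permutes S. of_int (sign h) * f h) = of_int (sign q) * (\<Sum>h | h permutes S. of_int (sign h) * f (q \<circ> h))"
    by (simp only: sum_distrib_left)
  moreover have "of_int (sign q) * of_int (sign q) = (1 :: complex)"
    unfolding of_int_mult[symmetric] sign_idempotent by simp
  ultimately show ?thesis by (simp add: mult.assoc[symmetric])
qed

text \<open>
  Write \<open>a\<close> for the sum over the permutations of \<open>A\<close> and \<open>b\<close> for the signed sum over those of \<open>B\<close>;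
  the statement evaluates the element \<open>a h g' b\<close> of the group algebra, tested against a function
  \<open>\<phi>\<close>. If one of \<open>h\<close> and \<open>g'\<close> fixes the common point \<open>c\<close>, their supports are disjoint, so they
  commute and are absorbed by \<open>b\<close> and \<open>a\<close>. Otherwise a transposition in \<open>A\<close> moved through \<open>h g'\<close>
  becomes a transposition in \<open>B\<close>, so that the element equals its own negative.
\<close>

lemma hook_symmetrizer_sandwich:
  fixes \<phi> :: "('a \<Rightarrow> 'a) \<Rightarrow> complex"
  assumes A: "finite A" and B: "finite B" and AB: "A \<inter> B = {c}"
    and h: "h permutes B" and g': "g' permutes A"
  shows "(\<Sum>g | g permutes A. \<Sum>h' | h' permutes B. of_int (sign h') * \<phi> (g \<circ> (h \<circ> g') \<circ> h'))
    = (if g' c = c \<or> h c = c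
       then of_int (sign h) * (\<Sum>g | g permutes A. \<Sum>h' | h' permutes B. of_int (sign h') * \<phi> (g \<circ> h')) else 0)"
    (is "?K = _")
proof (cases "g' c = c \<or> h c = c")
  case True
  have comm: "h \<circ> g' = g' \<circ> h"
    using True
  proof
    assume "g' c = c"
    hence "g' permutes (A - {c})" using g' permutes_fixed_Diff by metis
    thus ?thesis using permutes_disjoint_commute[OF _ h] AB by auto
  next
    assume "h c = c"
    hence "h permutes (B - {c})" using h permutes_fixed_Diff by metis
    thus ?thesis using permutes_disjoint_commute[OF g'] AB by blast
  qed
  have "?K = (\<Sum>g | g permutes A. \<Sum>h' | h' permutes B. of_int (sign h') * \<phi> ((g \<circ> g') \<circ> (h \<circ> h')))"
    by (simp only: comm o_assoc)
  also have "\<dots> = (\<Sum>g | g permutes A. \<Sum>h' | h' permutes B. of_int (sign h') * \<phi> (g \<circ> (h \<circ> h')))"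
    using sum_permutations_compose_right[OF g', of "\<lambda>g. \<Sum>h' | h' permutes B. of_int (sign h') * \<phi> (g \<circ> (h \<circ> h'))"]
    by simp
  also have "\<dots> = (\<Sum>g | g permutes A. of_int (sign h) * (\<Sum>h' | h' permutes B. of_int (sign h') * \<phi> (g \<circ> h')))"
    by (intro sum.cong refl signed_sum_compose_left[OF B h, of "\<lambda>h'. \<phi> (_ \<circ> h')"])
  finally show ?thesis using True by (simp add: sum_distrib_left)
next
  case False
  have cA: "c \<in> A" "c \<in> B" using AB by auto
  \<comment> \<open>The transposition \<open>(c v)\<close> in \<open>B\<close> is carried by \<open>h g'\<close> to the transposition \<open>(g' c c)\<close> in \<open>A\<close>.\<close>
  define v where "v = inv' h c"
  have hv: "h v = c" using permutes_inverses[OF h] v_def by simp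
  have vB: "v \<in> B" unfolding v_def using permutes_in_image[OF permutes_inv[OF h]] cA by simp
  have vc: "v \<noteq> c" using hv False by auto
  have vA: "v \<notin> A" using vB vc AB by auto
  have g'A: "g' c \<in> A" using permutes_in_image[OF g'] cA by simp
  have g'B: "g' c \<notin> B" using g'A False AB by auto
  have xv: "(h \<circ> g') v = c" using permutes_not_in[OF g' vA] hv by simp
  have xc: "(h \<circ> g') c = g' c" using permutes_not_in[OF h g'B] by simp
  let ?t = "Transposition.transpose c v" and ?t' = "Transposition.transpose (g' c) c"
  have t: "?t permutes B" using cA vB by (simp add: permutes_swap_id)
  have t': "?t' permutes A" using cA g'A by (simp add: permutes_swap_id)
  have inj: "inj (h \<circ> g')" using permutes_inj[OF h] permutes_inj[OF g'] by (rule inj_compose)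
  have conj: "(h \<circ> g') \<circ> ?t = ?t' \<circ> (h \<circ> g')"
  proof
    fix x
    have "(h \<circ> g') x = c \<longleftrightarrow> x = v" "(h \<circ> g') x = g' c \<longleftrightarrow> x = c"
      using inj_eq[OF inj, of x v] inj_eq[OF inj, of x c] unfolding xv xc by blast+
    thus "((h \<circ> g') \<circ> ?t) x = (?t' \<circ> (h \<circ> g')) x"
      using xv xc by (simp add: Transposition.transpose_def)
  qed
  have sgn: "sign ?t = -1" using vc by (simp add: sign_swap_id)
  have "?K = (\<Sum>g | g permutes A. \<Sum>h' | h' permutes B. of_int (sign h') * \<phi> ((g \<circ> ?t') \<circ> (h \<circ> g') \<circ> h'))"
    using sum_permutations_compose_right[OF t', of "\<lambda>g. \<Sum>h' | h' permutes B. of_int (sign h') * \<phi> (g \<circ> (h \<circ> g') \<circ> h')"] .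
  also have "\<dots> = (\<Sum>g | g permutes A. \<Sum>h' | h' permutes B. of_int (sign h') * \<phi> (g \<circ> (h \<circ> g') \<circ> (?t \<circ> h')))"
  proof (intro sum.cong refl)
    fix g h' :: "'a \<Rightarrow> 'a"
    have "(g \<circ> ?t') \<circ> (h \<circ> g') \<circ> h' = g \<circ> (?t' \<circ> (h \<circ> g')) \<circ> h'" by (simp only: comp_assoc)
    also have "\<dots> = g \<circ> (h \<circ> g' \<circ> ?t) \<circ> h'" by (simp only: conj)
    also have "\<dots> = g \<circ> (h \<circ> g') \<circ> (?t \<circ> h')" by (simp only: comp_assoc)
    finally show "of_int (sign h') * \<phi> ((g \<circ> ?t') \<circ> (h \<circ> g') \<circ> h') = of_int (sign h') * \<phi> (g \<circ> (h \<circ> g') \<circ> (?t \<circ> h'))"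
      by simp
  qed
  also have "\<dots> = (\<Sum>g | g permutes A. of_int (sign ?t) * (\<Sum>h' | h' permutes B. of_int (sign h') * \<phi> (g \<circ> (h \<circ> g') \<circ> h')))"
    by (intro sum.cong refl signed_sum_compose_left[OF B t, of "\<lambda>h'. \<phi> (_ \<circ> (h \<circ> g') \<circ> h')"])
  also have "\<dots> = - ?K" unfolding sgn by (simp add: sum_negf)
  finally have "?K = 0" by simp
  thus ?thesis using False by simp
qed

text \<open>
  Inclusion and exclusion over the events \<open>g c = c\<close> and \<open>h c = c\<close>.
\<close>

lemma card_permutes_pairs_fixing:
  assumes A: "finite A" and B: "finite B" and c: "c \<in> A" "c \<in> B"
  shows "card {(h, g). h permutes B \<and> g permutes A \<and> (g c = c \<or> h c = c)}
    = fact (card A - 1) * fact (card B - 1) * (card A + card B - 1)"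
proof -
  let ?S = "\<lambda>X. {p. p permutes X}"
  have perms: "card (?S (X - {c})) = fact (card X - 1)" "card (?S X) = card X * fact (card X - 1)"
    if "finite X" "c \<in> X" for X
  proof -
    have "card X \<noteq> 0" using that by auto
    then obtain k where k: "card X = Suc k" using not0_implies_Suc by blast
    hence k': "card (X - {c}) = k" using that by simp
    show "card (?S (X - {c})) = fact (card X - 1)" using card_permutations[OF k'] that k by simp
    show "card (?S X) = card X * fact (card X - 1)" using card_permutations[OF k] that k by simp
  qed
  note cA = perms[OF A c(1)] and cB = perms[OF B c(2)]
  have fin: "finite (?S X)" if "finite X" for X using finite_permutations[OF that] .
  have "{(h, g). h permutes B \<and> g permutes A \<and> (g c = c \<or> h c = c)}
    = ?S B \<times> ?S (A - {c}) \<union> ?S (B - {c}) \<times> ?S A"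
    by (auto simp: permutes_Diff_fixed)
  hence "card {(h, g). h permutes B \<and> g permutes A \<and> (g c = c \<or> h c = c)}
    + card ((?S B \<times> ?S (A - {c})) \<inter> (?S (B - {c}) \<times> ?S A)) = card (?S B \<times> ?S (A - {c})) + card (?S (B - {c}) \<times> ?S A)"
    using card_Un_Int[OF finite_cartesian_product[OF fin[OF B] fin[OF finite_Diff[OF A]]]
        finite_cartesian_product[OF fin[OF finite_Diff[OF B]] fin[OF A]], of "{c}" "{c}"] by simp
  moreover have "(?S B \<times> ?S (A - {c})) \<inter> (?S (B - {c}) \<times> ?S A) = ?S (B - {c}) \<times> ?S (A - {c})"
    by (auto simp: permutes_Diff_fixed)
  ultimately have "card {(h, g). h permutes B \<and> g permutes A \<and> (g c = c \<or> h c = c)}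
      + fact (card B - 1) * fact (card A - 1)
    = card B * fact (card B - 1) * fact (card A - 1) + fact (card B - 1) * (card A * fact (card A - 1))"
    by (simp add: card_cartesian_product cA cB)
  moreover have "card A > 0" using c A by (auto simp: card_gt_0_iff)
  then obtain a where "card A = Suc a" using gr0_conv_Suc by auto
  ultimately show ?thesis by (simp add: algebra_simps)
qed

text \<open>
  With \<open>a\<close> and \<open>b\<close> as in \<open>hook_symmetrizer_sandwich\<close> this is \<open>(a b)\<^sup>2 = \<gamma> a b\<close>: each of the pairs
  \<open>(h, g')\<close> in \<open>a (h g') b\<close> that contributes gives \<open>a b\<close>, because the two signs of \<open>h\<close> cancel, and
  \<open>\<gamma>\<close> counts these pairs.
\<close>

lemma hook_symmetrizer_square:
  fixes \<phi> :: "('a \<Rightarrow> 'a) \<Rightarrow> complex"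
  assumes A: "finite A" and B: "finite B" and AB: "A \<inter> B = {c}"
  shows "(\<Sum>g | g permutes A. \<Sum>h | h permutes B. \<Sum>g' | g' permutes A. \<Sum>h' | h' permutes B.
      of_int (sign h) * of_int (sign h') * \<phi> (g \<circ> h \<circ> (g' \<circ> h')))
    = of_nat (fact (card A - 1) * fact (card B - 1) * (card A + card B - 1)) *
      (\<Sum>g | g permutes A. \<Sum>h | h permutes B. of_int (sign h) * \<phi> (g \<circ> h))"
proof -
  let ?A = "{p. p permutes A}" and ?B = "{p. p permutes B}"
  let ?E = "\<Sum>g\<in>?A. \<Sum>h\<in>?B. of_int (sign h) * \<phi> (g \<circ> h)"
  have fin: "finite ?A" "finite ?B" using finite_permutations A B by auto
  have "(\<Sum>g\<in>?A. \<Sum>h\<in>?B. \<Sum>g'\<in>?A. \<Sum>h'\<in>?B. of_int (sign h) * of_int (sign h') * \<phi> (g \<circ> h \<circ> (g' \<circ> h')))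
    = (\<Sum>h\<in>?B. \<Sum>g'\<in>?A. of_int (sign h) * (\<Sum>g\<in>?A. \<Sum>h'\<in>?B. of_int (sign h') * \<phi> (g \<circ> (h \<circ> g') \<circ> h')))"
    by (subst sum.swap, rule sum.cong[OF refl], subst sum.swap)
      (simp only: sum_distrib_left mult.assoc o_assoc)
  also have "\<dots> = (\<Sum>h\<in>?B. \<Sum>g'\<in>?A. if g' c = c \<or> h c = c then ?E else 0)"
  proof (intro sum.cong refl)
    fix h g' assume "h \<in> ?B" "g' \<in> ?A"
    hence hg: "h permutes B" "g' permutes A" by auto
    show "of_int (sign h) * (\<Sum>g\<in>?A. \<Sum>h'\<in>?B. of_int (sign h') * \<phi> (g \<circ> (h \<circ> g') \<circ> h'))
      = (if g' c = c \<or> h c = c then ?E else 0)"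
      unfolding hook_symmetrizer_sandwich[OF A B AB hg]
      by (simp add: mult.assoc[symmetric] of_int_mult[symmetric] sign_idempotent del: of_int_mult)
  qed
  also have "\<dots> = (\<Sum>(h, g')\<in>?B \<times> ?A. if g' c = c \<or> h c = c then ?E else 0)"
    by (rule sum.cartesian_product)
  also have "\<dots> = (\<Sum>(h, g')\<in>{(h, g). h permutes B \<and> g permutes A \<and> (g c = c \<or> h c = c)}. ?E)"
    by (rule sum.mono_neutral_cong_right) (use fin in \<open>auto split: if_splits\<close>)
  also have "\<dots> = of_nat (card {(h, g). h permutes B \<and> g permutes A \<and> (g c = c \<or> h c = c)}) * ?E"
    by (simp add: case_prod_unfold)
  also have "card {(h, g). h permutes B \<and> g permutes A \<and> (g c = c \<or> h c = c)}
    = fact (card A - 1) * fact (card B - 1) * (card A + card B - 1)"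
    by (rule card_permutes_pairs_fixing[OF A B]) (use AB in auto)
  finally show ?thesis .
qed

text \<open>
  The image of the symmetrizer under the representation is a matrix \<open>E\<close> with \<open>E\<^sup>2 = \<gamma> E\<close>, so its
  trace is \<open>\<gamma>\<close> times the rank of \<open>E\<close>.
\<close>

lemma hook_symmetrizer_irreducible_nat:
  assumes \<psi>: "irreducible_character n \<psi>"
    and AB: "A \<subseteq> {1..n}" "B \<subseteq> {1..n}" "A \<inter> B = {c}"
  shows "\<exists>m::nat. (\<Sum>g | g permutes A. \<Sum>h | h permutes B. of_int (sign h) * \<psi> (g \<circ> h))
    = of_nat (fact (card A - 1) * fact (card B - 1) * (card A + card B - 1)) * of_nat m"
proof -
  obtain d \<rho> where \<rho>: "irreducible_rep n d \<rho>"
    and \<psi>\<rho>: "\<And>\<pi>. \<pi> \<in> carrier (sym_group n) \<Longrightarrow> \<psi> \<pi> = (\<Sum>i<d. \<rho> \<pi> $$ (i, i))"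
    using \<psi> unfolding irreducible_character_def by blast
  let ?A = "{p. p permutes A}" and ?B = "{p. p permutes B}"
  have finAB: "finite A" "finite B" using finite_subset[OF AB(1)] finite_subset[OF AB(2)] by auto
  have fin: "finite ?A" "finite ?B" using finite_permutations finAB by auto
  have G: "g \<circ> h \<in> carrier (sym_group n)" if "g \<in> ?A" "h \<in> ?B" for g h
    using that AB by (auto simp: sym_group_carrier intro!: permutes_compose intro: permutes_subset)
  have car: "\<rho> \<pi> \<in> carrier_mat d d" if "\<pi> \<in> carrier (sym_group n)" for \<pi>
    using \<rho> that unfolding irreducible_rep_def matrix_rep_def by blast
  have mult: "\<rho> (\<pi> \<circ> \<tau>) = \<rho> \<pi> * \<rho> \<tau>" if "\<pi> \<in> carrier (sym_group n)" "\<tau> \<in> carrier (sym_group n)" for \<pi> \<tau>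
    using \<rho> that unfolding irreducible_rep_def matrix_rep_def by blast
  define P where "P = ?A \<times> ?B"
  define w :: "(nat \<Rightarrow> nat) \<times> (nat \<Rightarrow> nat) \<Rightarrow> complex" where "w = (\<lambda>x. of_int (sign (snd x)))"
  define f :: "(nat \<Rightarrow> nat) \<times> (nat \<Rightarrow> nat) \<Rightarrow> nat \<Rightarrow> nat" where "f = (\<lambda>x. fst x \<circ> snd x)"
  have fG: "f x \<in> carrier (sym_group n)" if "x \<in> P" for x using that G by (auto simp: P_def f_def)
  let ?c = "of_nat (fact (card A - 1) * fact (card B - 1) * (card A + card B - 1)) :: complex"
  have sq: "(\<Sum>x\<in>P. \<Sum>y\<in>P. w x * w y * \<phi> (f x \<circ> f y)) = ?c * (\<Sum>x\<in>P. w x * \<phi> (f x))" for \<phi>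
    unfolding P_def sum.cartesian_product' w_def f_def fst_conv snd_conv
    by (rule hook_symmetrizer_square[OF finAB AB(3)])
  define E where "E = mat d d (\<lambda>(i, j). \<Sum>x\<in>P. w x * \<rho> (f x) $$ (i, j))"
  have "E * E = ?c \<cdot>\<^sub>m E"
  proof (rule eq_matI)
    fix i j assume "i < dim_row (?c \<cdot>\<^sub>m E)" "j < dim_col (?c \<cdot>\<^sub>m E)"
    hence ij: "i < d" "j < d" by (auto simp: E_def)
    have "(E * E) $$ (i, j) = (\<Sum>k=0..<d. (\<Sum>x\<in>P. w x * \<rho> (f x) $$ (i, k)) * (\<Sum>y\<in>P. w y * \<rho> (f y) $$ (k, j)))"
      using ij by (simp add: E_def scalar_prod_def)
    also have "\<dots> = (\<Sum>k=0..<d. \<Sum>x\<in>P. \<Sum>y\<in>P. (w x * \<rho> (f x) $$ (i, k)) * (w y * \<rho> (f y) $$ (k, j)))"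
      by (simp only: sum_product)
    also have "\<dots> = (\<Sum>x\<in>P. \<Sum>k=0..<d. \<Sum>y\<in>P. (w x * \<rho> (f x) $$ (i, k)) * (w y * \<rho> (f y) $$ (k, j)))"
      by (rule sum.swap)
    also have "\<dots> = (\<Sum>x\<in>P. \<Sum>y\<in>P. w x * w y * \<rho> (f x \<circ> f y) $$ (i, j))"
    proof (rule sum.cong[OF refl])
      fix x assume x: "x \<in> P"
      have "(\<Sum>k=0..<d. \<Sum>y\<in>P. (w x * \<rho> (f x) $$ (i, k)) * (w y * \<rho> (f y) $$ (k, j)))
        = (\<Sum>y\<in>P. \<Sum>k=0..<d. (w x * \<rho> (f x) $$ (i, k)) * (w y * \<rho> (f y) $$ (k, j)))"
        by (rule sum.swap)
      also have "\<dots> = (\<Sum>y\<in>P. w x * w y * \<rho> (f x \<circ> f y) $$ (i, j))"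
      proof (rule sum.cong[OF refl])
        fix y assume y: "y \<in> P"
        have "\<rho> (f x \<circ> f y) $$ (i, j) = (\<Sum>k=0..<d. \<rho> (f x) $$ (i, k) * \<rho> (f y) $$ (k, j))"
          unfolding mult[OF fG[OF x] fG[OF y]] using car[OF fG[OF x]] car[OF fG[OF y]] ij
          by (simp add: scalar_prod_def)
        thus "(\<Sum>k=0..<d. (w x * \<rho> (f x) $$ (i, k)) * (w y * \<rho> (f y) $$ (k, j)))
          = w x * w y * \<rho> (f x \<circ> f y) $$ (i, j)"
          by (simp add: sum_distrib_left mult_ac)
      qed
      finally show "(\<Sum>k=0..<d. \<Sum>y\<in>P. (w x * \<rho> (f x) $$ (i, k)) * (w y * \<rho> (f y) $$ (k, j)))
        = (\<Sum>y\<in>P. w x * w y * \<rho> (f x \<circ> f y) $$ (i, j))" .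
    qed
    also have "\<dots> = ?c * (\<Sum>x\<in>P. w x * \<rho> (f x) $$ (i, j))" by (rule sq)
    also have "\<dots> = (?c \<cdot>\<^sub>m E) $$ (i, j)" using ij by (simp add: E_def)
    finally show "(E * E) $$ (i, j) = (?c \<cdot>\<^sub>m E) $$ (i, j)" .
  qed (auto simp: E_def)
  moreover have "?c \<noteq> 0"
  proof -
    have "card A > 0" "card B > 0" using AB(3) finAB by (auto simp: card_gt_0_iff)
    hence "fact (card A - 1) * fact (card B - 1) * (card A + card B - 1) \<noteq> (0 :: nat)" by simp
    thus ?thesis unfolding of_nat_eq_0_iff .
  qed
  ultimately obtain m :: nat where m: "(\<Sum>i<d. E $$ (i, i)) = ?c * of_nat m"
    using trace_quasi_idempotent[of E d ?c] unfolding E_def by (metis mat_carrier)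
  have "(\<Sum>i<d. E $$ (i, i)) = (\<Sum>i<d. \<Sum>x\<in>P. w x * \<rho> (f x) $$ (i, i))"
    by (simp add: E_def)
  also have "\<dots> = (\<Sum>x\<in>P. \<Sum>i<d. w x * \<rho> (f x) $$ (i, i))"
    by (rule sum.swap)
  also have "\<dots> = (\<Sum>x\<in>P. w x * \<psi> (f x))"
    by (intro sum.cong refl) (simp add: \<psi>\<rho>[OF fG] sum_distrib_left)
  also have "\<dots> = (\<Sum>g\<in>?A. \<Sum>h\<in>?B. of_int (sign h) * \<psi> (g \<circ> h))"
    unfolding P_def sum.cartesian_product' w_def f_def fst_conv snd_conv ..
  finally show ?thesis unfolding m by (intro exI[of _ m]) (rule sym)
qed

lemma hook_symmetrizer_character_nat:
  assumes \<chi>: "character n \<chi>"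
    and AB: "A \<subseteq> {1..n}" "B \<subseteq> {1..n}" "A \<inter> B = {c}"
  shows "\<exists>m::nat. (\<Sum>g | g permutes A. \<Sum>h | h permutes B. of_int (sign h) * \<chi> (g \<circ> h))
    = of_nat (fact (card A - 1) * fact (card B - 1) * (card A + card B - 1)) * of_nat m"
proof -
  let ?A = "{p. p permutes A}" and ?B = "{p. p permutes B}"
  let ?c = "of_nat (fact (card A - 1) * fact (card B - 1) * (card A + card B - 1)) :: complex"
  obtain k :: nat and \<psi> and m :: "nat \<Rightarrow> nat" where k: "\<And>j. j < k \<Longrightarrow> irreducible_character n (\<psi> j)"
    "\<And>\<pi>. \<pi> \<in> carrier (sym_group n) \<Longrightarrow> \<chi> \<pi> = (\<Sum>j<k. of_nat (m j) * \<psi> j \<pi>)"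
    using \<chi> unfolding character_def by blast
  have "\<forall>j. \<exists>r::nat. j < k \<longrightarrow> (\<Sum>g\<in>?A. \<Sum>h\<in>?B. of_int (sign h) * \<psi> j (g \<circ> h)) = ?c * of_nat r"
  proof
    fix j
    show "\<exists>r::nat. j < k \<longrightarrow> (\<Sum>g\<in>?A. \<Sum>h\<in>?B. of_int (sign h) * \<psi> j (g \<circ> h)) = ?c * of_nat r"
    proof (cases "j < k")
      case True
      from hook_symmetrizer_irreducible_nat[OF k(1)[OF this] AB] show ?thesis by blast
    qed blast
  qed
  from choice[OF this] obtain r :: "nat \<Rightarrow> nat" where r: "\<forall>j. j < k \<longrightarrow> (\<Sum>g\<in>?A. \<Sum>h\<in>?B. of_int (sign h) * \<psi> j (g \<circ> h)) = ?c * of_nat (r j)" ..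
  have G: "g \<circ> h \<in> carrier (sym_group n)" if "g \<in> ?A" "h \<in> ?B" for g h
    using that AB by (auto simp: sym_group_carrier intro!: permutes_compose intro: permutes_subset)
  let ?P = "?A \<times> ?B"
  have "(\<Sum>g\<in>?A. \<Sum>h\<in>?B. of_int (sign h) * \<chi> (g \<circ> h))
    = (\<Sum>x\<in>?P. \<Sum>j<k. of_nat (m j) * (of_int (sign (snd x)) * \<psi> j (fst x \<circ> snd x)))"
    unfolding sum.cartesian_product' fst_conv snd_conv
    by (intro sum.cong refl) (simp add: k(2)[OF G] sum_distrib_left mult_ac)
  also have "\<dots> = (\<Sum>j<k. \<Sum>x\<in>?P. of_nat (m j) * (of_int (sign (snd x)) * \<psi> j (fst x \<circ> snd x)))"
    by (rule sum.swap)
  also have "\<dots> = (\<Sum>j<k. of_nat (m j) * (\<Sum>g\<in>?A. \<Sum>h\<in>?B. of_int (sign h) * \<psi> j (g \<circ> h)))"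
    unfolding sum.cartesian_product' fst_conv snd_conv sum_distrib_left ..
  also have "\<dots> = (\<Sum>j<k. of_nat (m j) * (?c * of_nat (r j)))" by (simp add: r)
  also have "\<dots> = ?c * of_nat (\<Sum>j<k. m j * r j)" unfolding of_nat_sum sum_distrib_left
    by (intro sum.cong refl) (simp only: of_nat_mult mult.left_commute)
  finally show ?thesis by blast
qed

section \<open>Fixed words and the number of cycles\<close>

definition fixed_words :: "nat \<Rightarrow> nat \<Rightarrow> (nat \<Rightarrow> nat) \<Rightarrow> (nat \<Rightarrow> nat) set" where
  "fixed_words n x q = {f \<in> {1..n} \<rightarrow>\<^sub>E {..<x}. \<forall>y\<in>{1..n}. f (q y) = f y}"

lemma fixed_words_constant_on_orbit:
  assumes f: "\<forall>y\<in>{1..n}. f (q y) = f y" and q: "q permutes {1..n}"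
    and y: "y \<in> {1..n}" and z: "z \<in> orbit q y"
  shows "f z = f y"
  using z
proof (induction rule: orbit.induct)
  case base show ?case using f y by blast
next
  case (step z)
  have "z \<in> {1..n}" using permutes_orbit_subset[OF q y] step by blast
  thus ?case using f step by simp
qed

text \<open>
  A word is fixed exactly if it is constant on every cycle, so it amounts to a choice of one letter
  for each cycle.
\<close>

lemma card_fixed_words:
  assumes q: "q permutes {1..n}"
  shows "card (fixed_words n x q) = x ^ num_cycles n q"
proof -
  let ?O = "orbit q ` {1..n}"
  let ?F = "\<lambda>F. restrict (\<lambda>y. F (orbit q y)) {1..n}"
  have perm: "permutation q" using q by (auto simp: permutation_permutes)
  have self: "y \<in> orbit q y" for y using permutation_self_in_orbit[OF perm] .
  have step: "orbit q (q y) = orbit q y" for y using permutation_orbit_step[OF perm] .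
  have qy: "q y \<in> {1..n} \<longleftrightarrow> y \<in> {1..n}" for y by (rule permutes_in_image[OF q])
  have inj: "inj_on ?F (?O \<rightarrow>\<^sub>E {..<x})"
  proof (rule inj_onI)
    fix F F' assume *: "F \<in> ?O \<rightarrow>\<^sub>E {..<x}" "F' \<in> ?O \<rightarrow>\<^sub>E {..<x}" "?F F = ?F F'"
    show "F = F'"
    proof (rule PiE_ext[OF *(1,2)])
      fix S assume "S \<in> ?O"
      then obtain y where "y \<in> {1..n}" "S = orbit q y" by blast
      thus "F S = F' S" using fun_cong[OF *(3), of y] by simp
    qed
  qed
  have img: "?F ` (?O \<rightarrow>\<^sub>E {..<x}) = fixed_words n x q"
  proof (intro equalityI subsetI)
    fix f assume "f \<in> ?F ` (?O \<rightarrow>\<^sub>E {..<x})"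
    then obtain F where F: "F \<in> ?O \<rightarrow>\<^sub>E {..<x}" "f = ?F F" by blast
    have "F (orbit q y) \<in> {..<x}" if "y \<in> {1..n}" for y using F(1) that by (auto dest: PiE_mem)
    thus "f \<in> fixed_words n x q" unfolding F(2) fixed_words_def by (auto simp: step qy[simplified])
  next
    fix f assume f: "f \<in> fixed_words n x q"
    hence f1: "f \<in> {1..n} \<rightarrow>\<^sub>E {..<x}" and f2: "\<forall>y\<in>{1..n}. f (q y) = f y" by (auto simp: fixed_words_def)
    define s where "s = (\<lambda>S. SOME y. y \<in> {1..n} \<and> orbit q y = S)"
    have s: "s (orbit q y) \<in> {1..n} \<and> orbit q (s (orbit q y)) = orbit q y" if "y \<in> {1..n}" for y
      unfolding s_def by (rule someI[of _ y]) (use that in simp)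
    have fs: "f (s (orbit q y)) = f y" if y: "y \<in> {1..n}" for y
      using fixed_words_constant_on_orbit[OF f2 q y] self[of "s (orbit q y)"] s[OF y] by simp
    let ?G = "restrict (\<lambda>S. f (s S)) ?O"
    have "f y < x" if "y \<in> {1..n}" for y using PiE_mem[OF f1 that] by simp
    hence "f (s S) < x" if "S \<in> ?O" for S using that fs by force
    hence G1: "?G \<in> ?O \<rightarrow>\<^sub>E {..<x}" by (auto intro!: PiE_I)
    have G2: "f = ?F ?G"
    proof
      fix y show "f y = ?F ?G y"
        using fs[of y] PiE_arb[OF f1, of y] by (cases "y \<in> {1..n}") simp_all
    qed
    show "f \<in> ?F ` (?O \<rightarrow>\<^sub>E {..<x})" by (subst G2, rule imageI[OF G1])
  qed
  have "card (fixed_words n x q) = card (?O \<rightarrow>\<^sub>E {..<x})"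
    using card_image[OF inj] img by simp
  also have "\<dots> = x ^ num_cycles n q" by (simp add: card_PiE num_cycles_def)
  finally show ?thesis .
qed

lemma fixed_words_insert_transposition:
  assumes g: "g permutes {1..n}" "g a = a" and h: "h permutes {1..n}" "h a = a"
    and ab: "a \<in> {1..n}" "b \<in> {1..n}" "a \<noteq> b"
  shows "fixed_words n x (g \<circ> Transposition.transpose a b \<circ> h) = {f \<in> fixed_words n x (g \<circ> h). f a = f (g b)}"
proof -
  let ?t = "Transposition.transpose a b"
  have *: "(\<forall>y\<in>{1..n}. f (k (h y)) = f y) \<longleftrightarrow> (\<forall>z\<in>{1..n}. f (k z) = f (inv' h z))" for f :: "nat \<Rightarrow> nat" and k
  proof -
    have "h y \<in> {1..n}" "inv' h y \<in> {1..n}" if "y \<in> {1..n}" for y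
      using that permutes_in_image[OF h(1)] permutes_in_image[OF permutes_inv[OF h(1)]] by auto
    thus ?thesis using permutes_inverses[OF h(1)] by metis
  qed
  have ia: "inv' h a = a" using h permutes_inverses(2)[OF h(1), of a] by simp
  have "(\<forall>y\<in>{1..n}. f (g (?t (h y))) = f y) \<longleftrightarrow> (\<forall>y\<in>{1..n}. f (g (h y)) = f y) \<and> f a = f (g b)" for f :: "nat \<Rightarrow> nat"
  proof -
    have "(\<forall>z\<in>{1..n}. f (g (?t z)) = f (inv' h z)) \<longleftrightarrow> (\<forall>z\<in>{1..n}. f (g z) = f (inv' h z)) \<and> f a = f (g b)"
    proof (intro iffI conjI ballI)
      assume A: "\<forall>z\<in>{1..n}. f (g (?t z)) = f (inv' h z)"
      have fa: "f (g b) = f a" using bspec[OF A ab(1)] ia by simp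
      thus "f a = f (g b)" by simp
      have fb: "f a = f (inv' h b)" using bspec[OF A ab(2)] g by simp
      fix z assume z: "z \<in> {1..n}"
      consider "z = a" | "z = b" | "z \<noteq> a" "z \<noteq> b" by blast
      thus "f (g z) = f (inv' h z)"
      proof cases
        case 3
        thus ?thesis using bspec[OF A z] by (simp add: transpose_apply_other)
      qed (simp_all only: ia g fa fb[symmetric])
    next
      fix z assume A: "(\<forall>z\<in>{1..n}. f (g z) = f (inv' h z)) \<and> f a = f (g b)" and z: "z \<in> {1..n}"
      consider "z = a" | "z = b" | "z \<noteq> a" "z \<noteq> b" by blast
      thus "f (g (?t z)) = f (inv' h z)"
      proof cases
        case 1
        thus ?thesis using A by (simp only: transpose_apply_first ia)
      next
        case 2
        thus ?thesis using A bspec[OF conjunct1[OF A] ab(2)] by (simp only: transpose_apply_second g)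
      next
        case 3
        thus ?thesis using bspec[OF conjunct1[OF A] z] by (simp add: transpose_apply_other)
      qed
    qed
    thus ?thesis using *[of f "\<lambda>z. g (?t z)"] *[of f g] by simp
  qed
  thus ?thesis unfolding fixed_words_def by auto
qed

text \<open>
  If \<open>a\<close> is a fixed point of \<open>g\<close> and \<open>h\<close>, inserting the transposition \<open>(a b)\<close> between them merges
  the singleton cycle of \<open>a\<close> into another one. Counting fixed words avoids handling cycles: the
  insertion imposes the one condition \<open>f a = f (g b)\<close> on words whose letter at \<open>a\<close> was free.
\<close>

lemma num_cycles_transposition:
  fixes x :: nat
  assumes g: "g permutes {1..n}" "g a = a" and h: "h permutes {1..n}" "h a = a"
    and ab: "a \<in> {1..n}" "b \<in> {1..n}" "a \<noteq> b"
  shows "x * x ^ num_cycles n (g \<circ> Transposition.transpose a b \<circ> h) = x ^ num_cycles n (g \<circ> h)"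
proof -
  let ?t = "Transposition.transpose a b"
  let ?W = "fixed_words n x (g \<circ> h)" and ?V = "fixed_words n x (g \<circ> ?t \<circ> h)"
  have gh: "(g \<circ> h) permutes {1..n}" "(g \<circ> ?t \<circ> h) permutes {1..n}"
    using g h ab by (auto intro!: permutes_compose permutes_swap_id)
  have gb: "g b \<noteq> a" "g b \<in> {1..n}" using g ab permutes_inj[OF g(1)] permutes_in_image[OF g(1), of b] by (auto dest: injD)
  have gha: "g (h y) = a \<longleftrightarrow> y = a" for y
    using g h inj_eq[OF permutes_inj[OF g(1)], of "h y" a] inj_eq[OF permutes_inj[OF h(1)], of y a] by simp
  have upd: "f(a := v) \<in> ?W" if "f \<in> ?W" "v < x" for f v
    using that ab(1) gha by (auto simp: fixed_words_def PiE_iff extensional_def)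
  let ?\<Phi> = "\<lambda>(f, v). f(a := v)"
  have V: "?V = {f \<in> ?W. f a = f (g b)}" by (rule fixed_words_insert_transposition[OF g h ab])
  have "bij_betw ?\<Phi> (?V \<times> {..<x}) ?W"
  proof (rule bij_betwI[where g = "\<lambda>f. (f(a := f (g b)), f a)"])
    show "?\<Phi> \<in> ?V \<times> {..<x} \<rightarrow> ?W" using upd by (auto simp: V)
    show "(\<lambda>f. (f(a := f (g b)), f a)) \<in> ?W \<rightarrow> ?V \<times> {..<x}"
    proof
      fix f assume f: "f \<in> ?W"
      have "f y < x" if "y \<in> {1..n}" for y using f that by (auto simp: fixed_words_def PiE_iff)
      thus "(f(a := f (g b)), f a) \<in> ?V \<times> {..<x}" using upd[OF f] gb ab(1) by (auto simp: V)
    qed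
    show "(\<lambda>f. (f(a := f (g b)), f a)) (?\<Phi> p) = p" if "p \<in> ?V \<times> {..<x}" for p
      using that gb by (auto simp: V fun_eq_iff)
    show "?\<Phi> ((\<lambda>f. (f(a := f (g b)), f a)) f) = f" if "f \<in> ?W" for f by (auto simp: fun_eq_iff)
  qed
  hence "card ?W = card ?V * x" by (simp add: bij_betw_same_card[symmetric] card_cartesian_product)
  thus ?thesis using card_fixed_words[OF gh(1)] card_fixed_words[OF gh(2)] by simp
qed

text \<open>
  The trace sum of the product of the symmetrizer of \<open>A\<close> and the antisymmetrizer of \<open>B\<close>, for the
  class function \<open>x ^ \<ell>\<close>.
\<close>

definition hook_power_sum :: "nat \<Rightarrow> nat \<Rightarrow> nat set \<Rightarrow> nat set \<Rightarrow> complex" where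
  "hook_power_sum n x A B = (\<Sum>g | g permutes A. \<Sum>h | h permutes B. of_int (sign h) * of_nat x ^ num_cycles n (g \<circ> h))"

text \<open>
  A permutation of \<open>insert a A\<close> either fixes \<open>a\<close> or is uniquely a permutation of \<open>A\<close> times a
  transposition \<open>(a b)\<close> with \<open>b\<close> in \<open>A\<close>. Each of the \<open>card A\<close> transpositions costs one factor \<open>x\<close>.
\<close>

lemma hook_power_sum_insert_left:
  assumes A: "A \<subseteq> {1..n}" and B: "B \<subseteq> {1..n}" and a: "a \<in> {1..n}" "a \<notin> A" "a \<notin> B"
  shows "of_nat x * hook_power_sum n x (insert a A) B = of_nat (x + card A) * hook_power_sum n x A B"
proof -
  let ?A = "{p. p permutes A}" and ?B = "{p. p permutes B}"
  have finA: "finite A" using A finite_subset by blast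
  let ?L = "\<lambda>q. (of_nat x :: complex) ^ num_cycles n q"
  define F where "F = (\<lambda>g. \<Sum>h\<in>?B. of_int (sign h) * ?L (g \<circ> h))"
  have 1: "of_nat x * F (Transposition.transpose a b \<circ> g) = (if b = a then of_nat x * F g else F g)"
    if b: "b \<in> insert a A" and g: "g \<in> ?A" for b g
  proof (cases "b = a")
    case False
    have gn: "g permutes {1..n}" "g a = a" using permutes_subset[OF _ A, of g] permutes_not_in[OF _ a(2), of g] g by simp_all
    have "of_nat x * (of_int (sign h) * ?L (Transposition.transpose a b \<circ> g \<circ> h)) = of_int (sign h) * ?L (g \<circ> h)"
      if h: "h \<in> ?B" for h
    proof -
      have hn: "h permutes {1..n}" "h a = a" using permutes_subset[OF _ B, of h] permutes_not_in[OF _ a(3), of h] h by simp_all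
      have gh: "g \<circ> h permutes {1..n}" "(g \<circ> h) a = a" using gn hn permutes_compose by auto
      have "x * x ^ num_cycles n (id \<circ> Transposition.transpose a b \<circ> (g \<circ> h)) = x ^ num_cycles n (id \<circ> (g \<circ> h))"
        by (rule num_cycles_transposition[OF permutes_id _ gh a(1)]) (use b A False in auto)
      hence "of_nat x * ?L (Transposition.transpose a b \<circ> g \<circ> h) = ?L (g \<circ> h)"
        unfolding id_o comp_assoc[symmetric] of_nat_mult[symmetric] of_nat_power[symmetric] by simp
      thus ?thesis by (metis mult.left_commute)
    qed
    thus ?thesis unfolding F_def sum_distrib_left if_not_P[OF False] by (intro sum.cong refl)
  qed simp
  have "of_nat x * hook_power_sum n x (insert a A) B
    = (\<Sum>b\<in>insert a A. \<Sum>g\<in>?A. of_nat x * F (Transposition.transpose a b \<circ> g))"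
    unfolding hook_power_sum_def F_def[symmetric] sum_over_permutations_insert[OF finA a(2)] sum_distrib_left ..
  also have "\<dots> = (\<Sum>b\<in>insert a A. \<Sum>g\<in>?A. if b = a then of_nat x * F g else F g)"
    by (intro sum.cong refl 1) auto
  also have "\<dots> = of_nat x * (\<Sum>g\<in>?A. F g) + (\<Sum>b\<in>A. \<Sum>g\<in>?A. if b = a then of_nat x * F g else F g)"
    using finA a(2) by (simp add: sum_distrib_left)
  also have "(\<Sum>b\<in>A. \<Sum>g\<in>?A. if b = a then of_nat x * F g else F g) = (\<Sum>b\<in>A. \<Sum>g\<in>?A. F g)"
    by (intro sum.cong refl) (use a(2) in auto)
  finally show ?thesis unfolding hook_power_sum_def F_def[symmetric] by (simp add: algebra_simps)
qed

text \<open>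
  As in \<open>hook_power_sum_insert_left\<close>, except that each transposition carries the sign -1.
\<close>

lemma hook_power_sum_insert_right:
  assumes A: "A \<subseteq> {1..n}" and B: "B \<subseteq> {1..n}" and a: "a \<in> {1..n}" "a \<notin> A" "a \<notin> B"
  shows "of_nat x * hook_power_sum n x A (insert a B) = (of_nat x - of_nat (card B)) * hook_power_sum n x A B"
proof -
  let ?A = "{p. p permutes A}" and ?B = "{p. p permutes B}"
  have finB: "finite B" using B finite_subset by blast
  let ?L = "\<lambda>q. (of_nat x :: complex) ^ num_cycles n q"
  have 1: "of_nat x * (of_int (sign (Transposition.transpose a b \<circ> h)) * ?L (g \<circ> (Transposition.transpose a b \<circ> h)))
      = (if b = a then of_nat x else -1) * (of_int (sign h) * ?L (g \<circ> h))"
    if b: "b \<in> insert a B" and g: "g \<in> ?A" and h: "h \<in> ?B" for b g h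
  proof (cases "b = a")
    case False
    have gn: "g permutes {1..n}" "g a = a" using permutes_subset[OF _ A, of g] permutes_not_in[OF _ a(2), of g] g by simp_all
    have hn: "h permutes {1..n}" "h a = a" using permutes_subset[OF _ B, of h] permutes_not_in[OF _ a(3), of h] h by simp_all
    have bn: "b \<in> {1..n}" using b B False by auto
    have t: "Transposition.transpose a b permutes {1..n}" using a bn by (simp add: permutes_swap_id)
    have "x * x ^ num_cycles n (g \<circ> Transposition.transpose a b \<circ> h) = x ^ num_cycles n (g \<circ> h)"
      by (rule num_cycles_transposition[OF gn hn a(1)]) (use bn False in auto)
    hence "of_nat x * ?L (g \<circ> (Transposition.transpose a b \<circ> h)) = ?L (g \<circ> h)"
      unfolding comp_assoc of_nat_mult[symmetric] of_nat_power[symmetric] by simp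
    moreover have "sign (Transposition.transpose a b \<circ> h) = - sign h"
      using sign_compose_permutes[OF _ t hn(1)] False by (simp add: sign_swap_id)
    ultimately show ?thesis using False by (simp add: mult.left_commute)
  qed simp
  have "of_nat x * hook_power_sum n x A (insert a B)
    = (\<Sum>g\<in>?A. \<Sum>b\<in>insert a B. \<Sum>h\<in>?B. (if b = a then of_nat x else -1) * (of_int (sign h) * ?L (g \<circ> h)))"
    unfolding hook_power_sum_def sum_over_permutations_insert[OF finB a(3)] sum_distrib_left
    by (intro sum.cong refl 1) auto
  also have "\<dots> = (\<Sum>g\<in>?A. (\<Sum>b\<in>insert a B. if b = a then of_nat x else -1) * (\<Sum>h\<in>?B. of_int (sign h) * ?L (g \<circ> h)))"
    by (simp only: sum_product)
  also have "(\<Sum>b\<in>insert a B. if b = a then of_nat x else -1 :: complex) = of_nat x + (\<Sum>b\<in>B. if b = a then of_nat x else -1)"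
    using finB a(3) by simp
  also have "(\<Sum>b\<in>B. if b = a then of_nat x else -1 :: complex) = (\<Sum>b\<in>B. -1)"
    by (intro sum.cong refl) (use a(3) in auto)
  also have "of_nat x + (\<Sum>b\<in>B. -1 :: complex) = of_nat x - of_nat (card B)" by simp
  finally show ?thesis unfolding hook_power_sum_def sum_distrib_left .
qed

lemma num_cycles_id: "num_cycles n id = n"
proof -
  have "orbit id y = {y}" for y :: nat by (simp add: orbit_eq_singleton_iff)
  hence "orbit id ` {1..n} = (\<lambda>y. {y}) ` {1..n}" by simp
  thus ?thesis unfolding num_cycles_def by (simp add: card_image)
qed

lemma hook_power_sum_base: "hook_power_sum n x {c} {c} = of_nat x ^ n"
proof -
  have "{p. p permutes {c :: nat}} = {id}" using permutes_sing by auto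
  thus ?thesis by (simp add: hook_power_sum_def num_cycles_id)
qed

lemma hook_power_sum_left:
  assumes "finite A'" "A' \<subseteq> {1..n}" "c \<in> {1..n}" "c \<notin> A'"
  shows "of_nat x ^ card A' * hook_power_sum n x (insert c A') {c} = pochhammer (of_nat x + 1) (card A') * of_nat x ^ n"
  using assms
proof (induction A' rule: finite_induct)
  case empty thus ?case by (simp add: hook_power_sum_base)
next
  case (insert a A')
  have "of_nat x * hook_power_sum n x (insert a (insert c A')) {c} = of_nat (x + card (insert c A')) * hook_power_sum n x (insert c A') {c}"
    by (rule hook_power_sum_insert_left) (use insert in auto)
  note 1 = this
  have eq: "insert c (insert a A') = insert a (insert c A')" "card (insert a A') = Suc (card A')"
    using insert by auto
  have "of_nat x ^ card (insert a A') * hook_power_sum n x (insert c (insert a A')) {c}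
    = of_nat x ^ card A' * (of_nat x * hook_power_sum n x (insert a (insert c A')) {c})"
    unfolding eq power_Suc by (simp only: mult_ac)
  also have "\<dots> = of_nat (x + card (insert c A')) * (of_nat x ^ card A' * hook_power_sum n x (insert c A') {c})"
    unfolding 1 by (simp only: mult_ac)
  also have "\<dots> = of_nat (x + card (insert c A')) * (pochhammer (of_nat x + 1) (card A') * of_nat x ^ n)"
    using insert by simp
  finally show ?case using insert by (simp add: pochhammer_Suc algebra_simps)
qed

lemma hook_power_sum_both:
  assumes "finite B'" "B' \<subseteq> {1..n}" "c \<notin> B'" and A': "finite A'" "A' \<subseteq> {1..n}" "c \<in> {1..n}" "c \<notin> A'" and "A' \<inter> B' = {}"
  shows "of_nat x ^ (card A' + card B') * hook_power_sum n x (insert c A') (insert c B')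
    = pochhammer (of_nat x + 1) (card A') * pochhammer (of_nat x - of_nat (card B')) (card B') * of_nat x ^ n"
  using assms(1-3,8)
proof (induction B' rule: finite_induct)
  case empty thus ?case using hook_power_sum_left[OF A'] by simp
next
  case (insert a B')
  have 1: "of_nat x * hook_power_sum n x (insert c A') (insert a (insert c B'))
    = (of_nat x - of_nat (card (insert c B'))) * hook_power_sum n x (insert c A') (insert c B')"
    by (rule hook_power_sum_insert_right) (use insert A' in auto)
  have eq: "insert c (insert a B') = insert a (insert c B')" "card A' + card (insert a B') = Suc (card A' + card B')"
    using insert by auto
  have "of_nat x ^ (card A' + card (insert a B')) * hook_power_sum n x (insert c A') (insert c (insert a B'))
    = of_nat x ^ (card A' + card B') * (of_nat x * hook_power_sum n x (insert c A') (insert a (insert c B')))"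
    unfolding eq power_Suc by (simp only: mult_ac)
  also have "\<dots> = (of_nat x - of_nat (card (insert c B'))) *
      (of_nat x ^ (card A' + card B') * hook_power_sum n x (insert c A') (insert c B'))"
    unfolding 1 by (simp only: mult_ac)
  also have "\<dots> = (of_nat x - of_nat (card (insert c B'))) *
      (pochhammer (of_nat x + 1) (card A') * pochhammer (of_nat x - of_nat (card B')) (card B') * of_nat x ^ n)"
    using insert by simp
  finally show ?case using insert by (simp add: pochhammer_rec algebra_simps)
qed

text \<open>
  Boxes of a hook are identified with their entries: the corner is 1, the leg below it has \<open>k\<close> boxes
  and the rest of the arm has \<open>n - 1 - k\<close> boxes.
\<close>

definition hook_leg :: "nat \<Rightarrow> nat set" where "hook_leg k = insert 1 {2..k + 1}"
definition hook_arm :: "nat \<Rightarrow> nat \<Rightarrow> nat set" where "hook_arm n k = insert 1 {k + 2..n}"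

lemma hook_arm_leg:
  assumes "k < n"
  shows "hook_arm n k \<subseteq> {1..n}" "hook_leg k \<subseteq> {1..n}" "hook_arm n k \<inter> hook_leg k = {1}"
    "card (hook_arm n k) = n - k" "card (hook_leg k) = k + 1"
  using assms by (auto simp: hook_arm_def hook_leg_def)

text \<open>
  Building up the hook from its corner produces the rising factorial of \<open>x + 1\<close> for the arm and the
  falling factorial of \<open>x - 1\<close> for the leg. Together with the factor \<open>x\<close> of the corner these are the
  \<open>n\<close> consecutive factors of the binomial coefficient \<open>C(x + n - 1 - k, n)\<close>.
\<close>

lemma hook_power_sum_value:
  assumes k: "k < n" and x: "x \<ge> 1"
  shows "hook_power_sum n x (hook_arm n k) (hook_leg k)
    = of_nat (fact (n - 1 - k) * fact k * n) * of_nat (((n - 1) choose k) * ((x + (n - 1 - k)) choose n))"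
proof -
  let ?x = "of_nat x :: complex"
  have c: "card {k + 2..n} + card {2..k + 1} = n - 1" using k by simp
  have "?x ^ (card {k + 2..n} + card {2..k + 1}) * hook_power_sum n x (hook_arm n k) (hook_leg k)
    = pochhammer (?x + 1) (card {k + 2..n}) * pochhammer (?x - of_nat (card {2..k + 1})) (card {2..k + 1}) * ?x ^ n"
    unfolding hook_arm_def hook_leg_def by (rule hook_power_sum_both) (use k in auto)
  hence "?x ^ (n - 1) * hook_power_sum n x (hook_arm n k) (hook_leg k)
    = pochhammer (?x + 1) (n - 1 - k) * pochhammer (?x - of_nat k) k * ?x ^ n"
    unfolding c by simp
  also have "?x ^ n = ?x ^ (n - 1) * ?x" using k by (cases n) auto
  finally have "hook_power_sum n x (hook_arm n k) (hook_leg k)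
    = pochhammer (?x - of_nat k) k * (?x * pochhammer (?x + 1) (n - 1 - k))" using x by simp
  also have "?x * pochhammer (?x + 1) (n - 1 - k) = pochhammer ?x (n - k)"
    using k by (simp add: pochhammer_rec[symmetric] Suc_diff_Suc)
  also have "pochhammer (?x - of_nat k) k * pochhammer ?x (n - k) = pochhammer (?x - of_nat k) n"
    using pochhammer_product[of k n "?x - of_nat k"] k by simp
  also have "\<dots> = fact n * (of_nat (x + (n - 1 - k)) gchoose n)"
  proof -
    have "of_nat (x + (n - 1 - k)) - of_nat n + 1 = ?x - of_nat k" using k by (simp add: of_nat_diff algebra_simps)
    thus ?thesis by (simp only: gbinomial_pochhammer') simp
  qed
  also have "\<dots> = of_nat (fact n * ((x + (n - 1 - k)) choose n))" by (simp only: binomial_gbinomial of_nat_mult of_nat_fact)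
  also have "fact n = n * (fact k * fact (n - 1 - k) * ((n - 1) choose k))"
    using binomial_fact_lemma[of k "n - 1"] k by (simp add: fact_reduce)
  finally show ?thesis by (simp only: of_nat_mult mult_ac)
qed

section \<open>Surjective words\<close>

definition words_onto :: "nat \<Rightarrow> nat set \<Rightarrow> (nat \<Rightarrow> nat) \<Rightarrow> (nat \<Rightarrow> nat) set" where
  "words_onto n S q = {f \<in> extensional {1..n}. f ` {1..n} = S \<and> (\<forall>y\<in>{1..n}. f (q y) = f y)}"

lemma words_onto_fixed_words: "S \<subseteq> {..<x} \<Longrightarrow> words_onto n S q = {f \<in> fixed_words n x q. f ` {1..n} = S}"
  unfolding words_onto_def fixed_words_def PiE_def by blast

lemma finite_words_onto: "finite S \<Longrightarrow> finite (words_onto n S q)"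
  by (rule finite_subset[of _ "{1..n} \<rightarrow>\<^sub>E S"]) (auto simp: words_onto_def PiE_def intro: finite_PiE[unfolded PiE_def])

lemma words_onto_relabel:
  assumes q: "q permutes {1..n}" and f: "f \<in> words_onto n S q" and b: "b ` S = S'"
  shows "restrict (b \<circ> f) {1..n} \<in> words_onto n S' q"
proof -
  have qy: "q y \<in> {1..n}" if "y \<in> {1..n}" for y using permutes_in_image[OF q] that by blast
  have 1: "f ` {1..n} = S" "\<And>y. y \<in> {1..n} \<Longrightarrow> f (q y) = f y" using f by (auto simp: words_onto_def)
  have "restrict (b \<circ> f) {1..n} ` {1..n} = (b \<circ> f) ` {1..n}" by (rule image_cong) auto
  also have "\<dots> = S'" using 1 b by (simp only: image_comp[symmetric])
  finally have im: "restrict (b \<circ> f) {1..n} ` {1..n} = S'" .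
  have "restrict (b \<circ> f) {1..n} (q y) = restrict (b \<circ> f) {1..n} y" if "y \<in> {1..n}" for y
    using that qy[OF that] 1(2)[OF that] by simp
  thus ?thesis using im by (simp add: words_onto_def)
qed

text \<open>
  Relabelling the letters along a bijection.
\<close>

lemma card_words_onto_cong:
  assumes q: "q permutes {1..n}" and b: "bij_betw b S S'"
  shows "card (words_onto n S q) = card (words_onto n S' q)"
proof (rule bij_betw_same_card[OF bij_betwI])
  let ?i = "inv_into S b"
  show "(\<lambda>f. restrict (b \<circ> f) {1..n}) \<in> words_onto n S q \<rightarrow> words_onto n S' q"
    using words_onto_relabel[OF q _ bij_betw_imp_surj_on[OF b]] by blast
  show "(\<lambda>f. restrict (?i \<circ> f) {1..n}) \<in> words_onto n S' q \<rightarrow> words_onto n S q"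
    using words_onto_relabel[OF q _ bij_betw_imp_surj_on[OF bij_betw_inv_into[OF b]]] by blast
  show "restrict (?i \<circ> restrict (b \<circ> f) {1..n}) {1..n} = f" if "f \<in> words_onto n S q" for f
  proof (rule extensionalityI)
    fix y assume y: "y \<in> {1..n}"
    have "f y \<in> S" using that y by (auto simp: words_onto_def)
    thus "restrict (?i \<circ> restrict (b \<circ> f) {1..n}) {1..n} y = f y"
      using y bij_betw_inv_into_left[OF b] by simp
  qed (use that in \<open>auto simp: words_onto_def\<close>)
  show "restrict (b \<circ> restrict (?i \<circ> f) {1..n}) {1..n} = f" if "f \<in> words_onto n S' q" for f
  proof (rule extensionalityI)
    fix y assume y: "y \<in> {1..n}"
    have "f y \<in> S'" using that y by (auto simp: words_onto_def)
    thus "restrict (b \<circ> restrict (?i \<circ> f) {1..n}) {1..n} y = f y"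
      using y bij_betw_inv_into_right[OF b] by simp
  qed (use that in \<open>auto simp: words_onto_def\<close>)
qed

definition surj_count :: "nat \<Rightarrow> nat \<Rightarrow> (nat \<Rightarrow> nat) \<Rightarrow> nat" where
  "surj_count n k q = card (words_onto n {..<k} q)"

lemma surj_count_eq_0:
  assumes "n < k"
  shows "surj_count n k q = 0"
proof -
  have "f ` {1..n} \<noteq> {..<k}" for f :: "nat \<Rightarrow> nat"
  proof
    assume "f ` {1..n} = {..<k}"
    hence "card (f ` {1..n}) = k" by simp
    thus False using card_image_le[of "{1..n}" f] assms by simp
  qed
  hence "words_onto n {..<k} q = {}" unfolding words_onto_def by blast
  thus ?thesis by (simp add: surj_count_def)
qed

lemma surj_count_zero_letters:
  assumes "n \<ge> 1"
  shows "surj_count n 0 q = 0"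
proof -
  have "1 \<in> {1..n}" using assms by simp
  hence "f ` {1..n} \<noteq> {}" for f :: "nat \<Rightarrow> nat" by blast
  hence "words_onto n {} q = {}" unfolding words_onto_def by blast
  thus ?thesis by (simp add: surj_count_def)
qed

text \<open>
  Words over \<open>x\<close> letters are classified by their set of letters.
\<close>

lemma power_num_cycles_expansion:
  assumes q: "q permutes {1..n}"
  shows "x ^ num_cycles n q = (\<Sum>k\<le>n. (x choose k) * surj_count n k q)"
proof -
  have "fixed_words n x q = (\<Union>S\<in>Pow {..<x}. words_onto n S q)"
  proof -
    have "(\<Union>S\<in>Pow {..<x}. words_onto n S q) = (\<Union>S\<in>Pow {..<x}. {f \<in> fixed_words n x q. f ` {1..n} = S})"
      by (intro SUP_cong refl words_onto_fixed_words) blast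
    moreover have "f ` {1..n} \<in> Pow {..<x}" if "f \<in> fixed_words n x q" for f
      using that unfolding fixed_words_def PiE_def Pi_def by blast
    ultimately show ?thesis by blast
  qed
  hence "x ^ num_cycles n q = card (\<Union>S\<in>Pow {..<x}. words_onto n S q)"
    by (simp only: card_fixed_words[OF q, symmetric])
  also have "\<dots> = (\<Sum>S\<in>Pow {..<x}. card (words_onto n S q))"
  proof (rule card_UN_disjoint)
    show "\<forall>S\<in>Pow {..<x}. finite (words_onto n S q)"
      using finite_words_onto finite_subset[of _ "{..<x}"] by blast
  qed (auto simp: words_onto_def)
  also have "\<dots> = (\<Sum>S\<in>Pow {..<x}. surj_count n (card S) q)"
  proof (rule sum.cong[OF refl])
    fix S assume "S \<in> Pow {..<x}"
    hence "finite S" using finite_subset by auto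
    then obtain b where "bij_betw b {0..<card S} S" using ex_bij_betw_nat_finite by blast
    hence "bij_betw b {..<card S} S" by (simp add: lessThan_atLeast0)
    thus "card (words_onto n S q) = surj_count n (card S) q"
      unfolding surj_count_def by (rule card_words_onto_cong[OF q, symmetric])
  qed
  also have "\<dots> = (\<Sum>k\<le>x. \<Sum>S | S \<in> Pow {..<x} \<and> card S = k. surj_count n (card S) q)"
  proof (rule sum.group[symmetric])
    show "card ` Pow {..<x} \<subseteq> {..x}" using card_mono[of "{..<x}"] by auto
  qed simp_all
  also have "\<dots> = (\<Sum>k\<le>x. (x choose k) * surj_count n k q)"
    by (intro sum.cong refl) (simp add: n_subsets Pow_def)
  also have "\<dots> = (\<Sum>k\<le>max x n. (x choose k) * surj_count n k q)"
    by (rule sum.mono_neutral_left) (auto simp: binomial_eq_0)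
  also have "\<dots> = (\<Sum>k\<le>n. (x choose k) * surj_count n k q)"
    by (rule sum.mono_neutral_right) (auto simp: surj_count_eq_0)
  finally show ?thesis .
qed

text \<open>
  By induction on \<open>k\<close>, the expansion of \<open>k ^ \<ell>\<close> determines the number of surjective words with \<open>k\<close>
  letters from those with fewer letters.
\<close>

lemma surj_count_cong:
  assumes q: "q permutes {1..n}" and r: "r permutes {1..n}" and eq: "num_cycles n q = num_cycles n r"
  shows "surj_count n k q = surj_count n k r"
proof (induction k rule: less_induct)
  case (less k)
  show ?case
  proof (cases "k \<le> n")
    case True
    have expand: "k ^ num_cycles n p = (\<Sum>j<k. (k choose j) * surj_count n j p) + surj_count n k p"
      if p: "p permutes {1..n}" for p
    proof -
      have "k ^ num_cycles n p = (\<Sum>j\<le>n. (k choose j) * surj_count n j p)"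
        by (rule power_num_cycles_expansion[OF p])
      also have "\<dots> = (\<Sum>j\<le>k. (k choose j) * surj_count n j p)"
        by (rule sum.mono_neutral_right) (use True in \<open>auto simp: binomial_eq_0\<close>)
      also have "{..k} = insert k {..<k}" by auto
      finally show ?thesis by simp
    qed
    have "(\<Sum>j<k. (k choose j) * surj_count n j q) = (\<Sum>j<k. (k choose j) * surj_count n j r)"
      using less by simp
    thus ?thesis using expand[OF q] expand[OF r] eq by simp
  qed (simp add: surj_count_eq_0)
qed

text \<open>
  A fixed word has at most one letter for each cycle; giving distinct letters to all cycles attains
  this bound.
\<close>

lemma surj_count_eq_0_iff_aux:
  assumes q: "q permutes {1..n}"
  shows "num_cycles n q < k \<Longrightarrow> surj_count n k q = 0"
    and "num_cycles n q = k \<Longrightarrow> surj_count n k q \<noteq> 0"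
proof -
  let ?O = "orbit q ` {1..n}"
  have perm: "permutation q" using q by (auto simp: permutation_permutes)
  have self: "y \<in> orbit q y" for y using permutation_self_in_orbit[OF perm] .
  {
    assume lt: "num_cycles n q < k"
    have "f ` {1..n} \<noteq> {..<k}" if "\<forall>y\<in>{1..n}. f (q y) = f y" for f :: "nat \<Rightarrow> nat"
    proof
      assume *: "f ` {1..n} = {..<k}"
      have "f ` {1..n} \<subseteq> (\<lambda>S. the_elem (f ` S)) ` ?O"
      proof
        fix v assume "v \<in> f ` {1..n}"
        then obtain y where y: "y \<in> {1..n}" "v = f y" by blast
        have "f ` orbit q y = {f y}" using fixed_words_constant_on_orbit[OF that q y(1)] self by blast
        thus "v \<in> (\<lambda>S. the_elem (f ` S)) ` ?O" using y by (intro image_eqI[of _ _ "orbit q y"]) auto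
      qed
      hence "card (f ` {1..n}) \<le> card ?O" by (rule surj_card_le[rotated]) simp
      thus False using * lt by (simp add: num_cycles_def)
    qed
    hence "words_onto n {..<k} q = {}" unfolding words_onto_def by blast
    thus "surj_count n k q = 0" by (simp add: surj_count_def)
  next
    assume eq: "num_cycles n q = k"
    obtain e where e: "bij_betw e ?O {0..<k}"
      using ex_bij_betw_finite_nat[of ?O] eq by (auto simp: num_cycles_def)
    let ?f = "restrict (\<lambda>y. e (orbit q y)) {1..n}"
    have "?f ` {1..n} = e ` ?O" unfolding image_comp by (rule image_cong) auto
    also have "\<dots> = {..<k}" using bij_betw_imp_surj_on[OF e] by (simp add: lessThan_atLeast0)
    finally have "?f ` {1..n} = {..<k}" .
    moreover have "?f (q y) = ?f y" if "y \<in> {1..n}" for y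
      using that permutes_in_image[OF q, of y] permutation_orbit_step[OF perm] by simp
    ultimately have "?f \<in> words_onto n {..<k} q" by (simp add: words_onto_def)
    thus "surj_count n k q \<noteq> 0" using finite_words_onto[of "{..<k}" n q] by (auto simp: surj_count_def)
  }
qed

lemma num_cycles_bounds:
  assumes "n \<ge> 1"
  shows "1 \<le> num_cycles n q" "num_cycles n q \<le> n"
  using assms card_image_le[of "{1..n}" "orbit q"] by (auto simp: num_cycles_def Suc_le_eq card_gt_0_iff)

text \<open>
  The matrix of the numbers of fixed surjective words, indexed by the number of cycles and the
  number of letters, is triangular with nonzero diagonal.
\<close>

lemma surj_counts_span:
  assumes n: "n \<ge> 1"
  shows "\<exists>y :: nat \<Rightarrow> complex. \<forall>\<pi>. \<pi> permutes {1..n} \<longrightarrow> num_cycles n \<pi> \<le> m \<longrightarrow>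
    F (num_cycles n \<pi>) = (\<Sum>k=1..m. y k * of_nat (surj_count n k \<pi>))"
proof (induction m)
  case 0
  have "\<not> num_cycles n \<pi> \<le> 0" for \<pi> using num_cycles_bounds(1)[OF n, of \<pi>] by linarith
  thus ?case by blast
next
  case (Suc m)
  then obtain y :: "nat \<Rightarrow> complex" where y: "\<And>\<pi>. \<pi> permutes {1..n} \<Longrightarrow> num_cycles n \<pi> \<le> m \<Longrightarrow>
    F (num_cycles n \<pi>) = (\<Sum>k=1..m. y k * of_nat (surj_count n k \<pi>))" by blast
  show ?case
  proof (cases "\<exists>\<pi>0. \<pi>0 permutes {1..n} \<and> num_cycles n \<pi>0 = Suc m")
    case True
    then obtain \<pi>0 where \<pi>0: "\<pi>0 permutes {1..n}" "num_cycles n \<pi>0 = Suc m" by blast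
    let ?b = "of_nat (surj_count n (Suc m) \<pi>0) :: complex"
    have b: "?b \<noteq> 0" using surj_count_eq_0_iff_aux(2)[OF \<pi>0] by simp
    define y' where "y' = y(Suc m := (F (Suc m) - (\<Sum>k=1..m. y k * of_nat (surj_count n k \<pi>0))) / ?b)"
    have y'm: "(\<Sum>k=1..m. y' k * of_nat (surj_count n k \<pi>)) = (\<Sum>k=1..m. y k * of_nat (surj_count n k \<pi>))" for \<pi>
      by (intro sum.cong refl) (auto simp: y'_def)
    have "F (num_cycles n \<pi>) = (\<Sum>k=1..Suc m. y' k * of_nat (surj_count n k \<pi>))"
      if \<pi>: "\<pi> permutes {1..n}" "num_cycles n \<pi> \<le> Suc m" for \<pi>
    proof (cases "num_cycles n \<pi> = Suc m")
      case True
      have eq: "surj_count n k \<pi> = surj_count n k \<pi>0" for k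
        by (rule surj_count_cong[OF \<pi>(1) \<pi>0(1)]) (simp add: True \<pi>0)
      have "y' (Suc m) * ?b = F (Suc m) - (\<Sum>k=1..m. y k * of_nat (surj_count n k \<pi>0))"
        using b by (simp add: y'_def)
      thus ?thesis unfolding True sum.cl_ivl_Suc y'm eq by simp
    next
      case False
      hence "num_cycles n \<pi> < Suc m" using \<pi> by simp
      hence "surj_count n (Suc m) \<pi> = 0" by (rule surj_count_eq_0_iff_aux(1)[OF \<pi>(1)])
      moreover have "F (num_cycles n \<pi>) = (\<Sum>k=1..m. y k * of_nat (surj_count n k \<pi>))"
        by (rule y[OF \<pi>(1)]) (use \<open>num_cycles n \<pi> < Suc m\<close> in simp)
      ultimately show ?thesis unfolding sum.cl_ivl_Suc y'm by simp
    qed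
    thus ?thesis by blast
  next
    case False
    define y' where "y' = y(Suc m := 0)"
    have y'm: "(\<Sum>k=1..m. y' k * of_nat (surj_count n k \<pi>)) = (\<Sum>k=1..m. y k * of_nat (surj_count n k \<pi>))" for \<pi>
      by (intro sum.cong refl) (auto simp: y'_def)
    have "F (num_cycles n \<pi>) = (\<Sum>k=1..Suc m. y' k * of_nat (surj_count n k \<pi>))"
      if \<pi>: "\<pi> permutes {1..n}" "num_cycles n \<pi> \<le> Suc m" for \<pi>
    proof -
      have "num_cycles n \<pi> \<le> m" using False \<pi> le_Suc_eq by blast
      thus ?thesis unfolding sum.cl_ivl_Suc y'm using y[OF \<pi>(1)] by (simp add: y'_def)
    qed
    thus ?thesis by blast
  qed
qed

section \<open>Surjective words by weight\<close>

text \<open>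
  Rotating the alphabet \<open>{..<k}\<close> adds 1 modulo \<open>k\<close> to each of the \<open>n\<close> letters, hence \<open>n\<close> to the sum;
  only the residue class of the sum is therefore a useful weight.
\<close>

definition weight_words :: "nat \<Rightarrow> nat \<Rightarrow> nat \<Rightarrow> (nat \<Rightarrow> nat) \<Rightarrow> (nat \<Rightarrow> nat) set" where
  "weight_words n k r q = {f \<in> words_onto n {..<k} q. (\<Sum>y=1..n. f y) mod k = r}"

text \<open>
  Rotation of the alphabet is injective on words and commutes with the action on positions.
\<close>

lemma weight_words_rotate:
  assumes q: "q permutes {1..n}" and k: "k > 0"
  shows "card (weight_words n k r q) \<le> card (weight_words n k ((r + n) mod k) q)"
proof (rule card_inj_on_le)
  let ?s = "\<lambda>i. Suc i mod k"
  have inj: "inj_on ?s {..<k}"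
  proof (rule inj_onI)
    fix i j assume "i \<in> {..<k}" "j \<in> {..<k}" "Suc i mod k = Suc j mod k"
    thus "i = j" by (cases "Suc i = k"; cases "Suc j = k") auto
  qed
  have im: "?s ` {..<k} = {..<k}" by (rule endo_inj_surj[OF _ _ inj]) (use k in auto)
  let ?\<Phi> = "\<lambda>f. restrict (?s \<circ> f) {1..n}"
  show "inj_on ?\<Phi> (weight_words n k r q)"
  proof (rule inj_onI)
    fix f g assume *: "f \<in> weight_words n k r q" "g \<in> weight_words n k r q" "?\<Phi> f = ?\<Phi> g"
    show "f = g"
    proof (rule extensionalityI)
      fix y assume y: "y \<in> {1..n}"
      have "f y \<in> {..<k}" "g y \<in> {..<k}" using * y unfolding weight_words_def words_onto_def by blast+
      moreover have "?s (f y) = ?s (g y)" using fun_cong[OF *(3), of y] y by simp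
      ultimately show "f y = g y" using inj_onD[OF inj] by blast
    qed (use * in \<open>auto simp: weight_words_def words_onto_def\<close>)
  qed
  show "?\<Phi> ` weight_words n k r q \<subseteq> weight_words n k ((r + n) mod k) q"
  proof (intro image_subsetI)
    fix f assume f: "f \<in> weight_words n k r q"
    have "?\<Phi> f \<in> words_onto n {..<k} q"
      by (rule words_onto_relabel[OF q _ im]) (use f in \<open>simp add: weight_words_def\<close>)
    moreover have "(\<Sum>y=1..n. ?\<Phi> f y) mod k = (r + n) mod k"
    proof -
      have "(\<Sum>y=1..n. ?\<Phi> f y) = (\<Sum>y=1..n. Suc (f y) mod k)" by (intro sum.cong refl) simp
      also have "\<dots> mod k = (\<Sum>y=1..n. Suc (f y)) mod k" by (rule mod_sum_eq)
      also have "(\<Sum>y=1..n. Suc (f y)) = (\<Sum>y=1..n. f y) + n"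
        unfolding Suc_eq_plus1 sum.distrib by simp
      also have "\<dots> mod k = (r + n) mod k" using f by (auto simp: weight_words_def mod_add_left_eq)
      finally show ?thesis .
    qed
    ultimately show "?\<Phi> f \<in> weight_words n k ((r + n) mod k) q" by (simp add: weight_words_def)
  qed
  show "finite (weight_words n k ((r + n) mod k) q)"
    using finite_words_onto[of "{..<k}" n q] by (simp add: weight_words_def)
qed

text \<open>
  Repeated rotation gives inequalities between the classes \<open>r\<close> and \<open>r + n m\<close>. By Bezout \<open>gcd n k\<close> is
  a multiple of \<open>n\<close> modulo \<open>k\<close>, and so is its negative, so both inequalities between \<open>r\<close> and
  \<open>r + gcd n k\<close> hold.
\<close>

lemma weight_words_period:
  assumes q: "q permutes {1..n}" and k: "k > 0" and r: "r < k"
  shows "card (weight_words n k ((r + gcd n k) mod k) q) = card (weight_words n k r q)"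
proof -
  have le: "card (weight_words n k r q) \<le> card (weight_words n k ((r + n * m) mod k) q)" if "r < k" for r m
  proof (induction m)
    case (Suc m)
    have "((r + n * m) mod k + n) mod k = (r + n * m + n) mod k" by (rule mod_add_left_eq)
    also have "r + n * m + n = r + n * Suc m" by simp
    finally have "((r + n * m) mod k + n) mod k = (r + n * Suc m) mod k" .
    thus ?case using Suc weight_words_rotate[OF q k, of "(r + n * m) mod k"] by simp
  qed (use that in simp)
  have eq: "card (weight_words n k ((r + n * m) mod k) q) = card (weight_words n k r q)" for m
  proof (rule antisym)
    have "m + m * (k - 1) = m * k" using k by (cases k) simp_all
    hence "k dvd m + m * (k - 1)" by simp
    hence "k dvd n * m + n * (m * (k - 1))" unfolding distrib_left[symmetric] by (rule dvd_mult)
    then obtain t where t: "n * m + n * (m * (k - 1)) = k * t" ..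
    have "((r + n * m) mod k + n * (m * (k - 1))) mod k = (r + (n * m + n * (m * (k - 1)))) mod k"
      by (simp only: mod_add_left_eq add.assoc)
    also have "\<dots> = r" unfolding t using r by simp
    finally have "((r + n * m) mod k + n * (m * (k - 1))) mod k = r" .
    thus "card (weight_words n k ((r + n * m) mod k) q) \<le> card (weight_words n k r q)"
      using le[of "(r + n * m) mod k" "m * (k - 1)"] k by simp
  qed (rule le[OF r])
  have "\<exists>m. [n * m = gcd n k] (mod k)" by (rule cong_solve_nat)
  then obtain m where "[n * m = gcd n k] (mod k)" ..
  hence "(r + n * m) mod k = (r + gcd n k) mod k" unfolding cong_def using mod_add_right_eq[of r "n * m" k] mod_add_right_eq[of r "gcd n k" k] by simp
  thus ?thesis using eq[of m] by simp
qed

text \<open>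
  The \<open>k\<close> weight classes split into \<open>k div gcd n k\<close> periods of equal total size. So the sum over one
  period is a character of which the number of surjective words is a multiple.
\<close>

lemma surj_count_weight:
  assumes q: "q permutes {1..n}" and k: "k > 0"
  shows "surj_count n k q = (k div gcd n k) * (\<Sum>r<gcd n k. card (weight_words n k r q))"
proof -
  let ?g = "gcd n k" and ?c = "\<lambda>r. card (weight_words n k r q)"
  have g: "?g > 0" "?g dvd k" using k by auto
  have per: "?c (j * ?g + i) = ?c i" if "i < ?g" "j < k div ?g" for i j
    using that(2)
  proof (induction j)
    case (Suc j)
    have "Suc j * ?g + i < (k div ?g) * ?g"
    proof -
      have "Suc j * ?g + i < Suc (Suc j) * ?g" using that(1) by simp
      also have "\<dots> \<le> (k div ?g) * ?g" by (rule mult_right_mono) (use Suc in auto)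
      finally show ?thesis .
    qed
    hence lt: "Suc j * ?g + i < k" using g by simp
    have "?c ((j * ?g + i + ?g) mod k) = ?c (j * ?g + i)"
      by (rule weight_words_period[OF q k]) (use lt in simp)
    moreover have "(j * ?g + i + ?g) mod k = Suc j * ?g + i" using lt by (simp add: algebra_simps)
    ultimately show ?case using Suc by simp
  qed simp
  have "words_onto n {..<k} q = (\<Union>r<k. weight_words n k r q)"
    using k by (auto simp: weight_words_def)
  hence "surj_count n k q = card (\<Union>r<k. weight_words n k r q)" by (simp add: surj_count_def)
  also have "\<dots> = (\<Sum>r<k. ?c r)"
  proof (rule card_UN_disjoint)
    show "\<forall>r\<in>{..<k}. finite (weight_words n k r q)"
      using finite_words_onto[of "{..<k}" n q] by (simp add: weight_words_def)
  qed (auto simp: weight_words_def)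
  also have "\<dots> = (\<Sum>r<(k div ?g) * ?g. ?c r)" using g by simp
  also have "\<dots> = (\<Sum>j<k div ?g. sum ?c {j * ?g..<j * ?g + ?g})"
    by (rule sum.nat_group[symmetric])
  also have "\<dots> = (\<Sum>j<k div ?g. \<Sum>i<?g. ?c i)"
  proof (rule sum.cong[OF refl])
    fix j assume j: "j \<in> {..<k div ?g}"
    have "sum ?c {j * ?g..<j * ?g + ?g} = (\<Sum>i<?g. ?c (j * ?g + i))"
      using sum.shift_bounds_nat_ivl[of ?c 0 "j * ?g" ?g] by (simp add: lessThan_atLeast0 add.commute)
    also have "\<dots> = (\<Sum>i<?g. ?c i)" using per j by (intro sum.cong refl) auto
    finally show "sum ?c {j * ?g..<j * ?g + ?g} = (\<Sum>i<?g. ?c i)" .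
  qed
  finally show ?thesis by simp
qed

text \<open>
  The weight does not depend on the order of the positions, so the symmetric group permutes the
  surjective words of a given weight.
\<close>

lemma weight_words_character:
  shows "character n (\<lambda>\<pi>. of_nat (card (weight_words n k r \<pi>)))"
proof -
  let ?X = "weight_words n k r id"
  let ?act = "\<lambda>\<pi> f. restrict (f \<circ> inv' \<pi>) {1..n}"
  have X: "f \<in> ?X \<longleftrightarrow> f \<in> extensional {1..n} \<and> f ` {1..n} = {..<k} \<and> (\<Sum>y=1..n. f y) mod k = r" for f
    by (auto simp: weight_words_def words_onto_def)
  have ch: "character n (\<lambda>\<pi>. of_nat (card {f \<in> ?X. ?act \<pi> f = f}))"
  proof (rule permutation_character)
    show "finite ?X" using finite_words_onto[of "{..<k}" n id] by (simp add: weight_words_def)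
    fix f assume f: "f \<in> ?X"
    show "?act id f = f"
    proof (rule extensionalityI)
      show "?act id f \<in> extensional {1..n}" by (rule restrict_extensional)
      show "f \<in> extensional {1..n}" using f unfolding X by blast
      show "?act id f y = f y" if "y \<in> {1..n}" for y
        using that by (simp only: restrict_apply if_True comp_apply inv_id id_apply)
    qed
    fix \<pi> assume \<pi>: "\<pi> \<in> carrier (sym_group n)"
    hence p: "inv' \<pi> permutes {1..n}" by (simp add: sym_group_carrier permutes_inv)
    have "?act \<pi> f ` {1..n} = (f \<circ> inv' \<pi>) ` {1..n}" by (rule image_cong) auto
    also have "\<dots> = f ` {1..n}" unfolding image_comp[symmetric] permutes_image[OF p] ..
    finally have 1: "?act \<pi> f ` {1..n} = f ` {1..n}" .
    have "(\<Sum>y=1..n. ?act \<pi> f y) = sum (f \<circ> inv' \<pi>) {1..n}" by (intro sum.cong refl) simp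
    also have "\<dots> = sum f {1..n}" by (rule sum.permute[OF p, symmetric])
    finally show "?act \<pi> f \<in> ?X" using f 1 by (simp add: X)
    fix \<tau> assume \<tau>: "\<tau> \<in> carrier (sym_group n)"
    have inv: "inv' (\<pi> \<circ> \<tau>) = inv' \<tau> \<circ> inv' \<pi>"
      using \<pi> \<tau> by (intro o_inv_distrib) (auto simp: sym_group_carrier permutes_bij)
    have "inv' \<pi> y \<in> {1..n}" if "y \<in> {1..n}" for y using permutes_in_image[OF p] that by blast
    thus "?act (\<pi> \<circ> \<tau>) f = ?act \<pi> (?act \<tau> f)" unfolding inv by (intro restrict_ext) simp
  qed
  have eq: "{f \<in> ?X. ?act \<pi> f = f} = weight_words n k r \<pi>" if \<pi>: "\<pi> \<in> carrier (sym_group n)" for \<pi>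
  proof -
    have p: "\<pi> permutes {1..n}" using \<pi> by (simp add: sym_group_carrier)
    have iff: "?act \<pi> f = f \<longleftrightarrow> (\<forall>y\<in>{1..n}. f (\<pi> y) = f y)" if f: "f \<in> extensional {1..n}" for f
    proof
      assume *: "?act \<pi> f = f"
      show "\<forall>y\<in>{1..n}. f (\<pi> y) = f y"
      proof
        fix y assume "y \<in> {1..n}"
        hence "\<pi> y \<in> {1..n}" using permutes_in_image[OF p] by blast
        thus "f (\<pi> y) = f y" using fun_cong[OF *, of "\<pi> y"] permutes_inverses(2)[OF p, of y] by simp
      qed
    next
      assume *: "\<forall>y\<in>{1..n}. f (\<pi> y) = f y"
      show "?act \<pi> f = f"
      proof (rule extensionalityI)
        fix y assume y: "y \<in> {1..n}"
        hence "inv' \<pi> y \<in> {1..n}" using permutes_in_image[OF permutes_inv[OF p]] by blast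
        thus "?act \<pi> f y = f y" using y bspec[OF *, of "inv' \<pi> y"] permutes_inverses(1)[OF p, of y] by simp
      qed (use f in auto)
    qed
    have W: "f \<in> weight_words n k r \<pi> \<longleftrightarrow> f \<in> ?X \<and> (\<forall>y\<in>{1..n}. f (\<pi> y) = f y)" for f
      unfolding X unfolding weight_words_def words_onto_def by blast
    show ?thesis
    proof (rule Set.set_eqI)
      fix f
      have "f \<in> extensional {1..n}" if "f \<in> ?X" using that unfolding X by (rule conjunct1)
      thus "f \<in> {f \<in> ?X. ?act \<pi> f = f} \<longleftrightarrow> f \<in> weight_words n k r \<pi>"
        unfolding W mem_Collect_eq by (intro conj_cong refl iff)
    qed
  qed
  show ?thesis by (rule character_cong[OF ch]) (simp only: eq)
qed

section \<open>Functions on permutations attached to a ribbon\<close>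

context
  fixes n :: nat
begin

definition G :: "(nat \<Rightarrow> nat) set" where "G = {p. p permutes {1..n}}"

text \<open>
  A ribbon with \<open>n\<close> boxes is encoded by its set \<open>U\<close> of up-steps: its boxes are numbered \<open>1, \<dots>, n\<close>
  from the bottom left to the top right, and the step from box \<open>j\<close> to box \<open>j + 1\<close> goes up if \<open>j \<in> U\<close>
  and to the right otherwise. The last box lies in row 0 and the first one in column 0. A
  permutation \<open>w\<close> stands for the tableau with entry \<open>w j\<close> in box \<open>j\<close>.
\<close>

definition box_row :: "nat set \<Rightarrow> nat \<Rightarrow> nat" where "box_row U j = card (U \<inter> {j..n})"
definition box_col :: "nat set \<Rightarrow> nat \<Rightarrow> nat" where "box_col U j = card ({1..<j} - U)"

definition row_perms :: "nat set \<Rightarrow> (nat \<Rightarrow> nat) set" where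
  "row_perms U = {\<sigma> \<in> G. \<forall>j\<in>{1..n}. box_row U (\<sigma> j) = box_row U j}"
definition col_perms :: "nat set \<Rightarrow> (nat \<Rightarrow> nat) set" where
  "col_perms U = {\<sigma> \<in> G. \<forall>j\<in>{1..n}. box_col U (\<sigma> j) = box_col U j}"

text \<open>
  The letter at \<open>y\<close> is the row that contains the entry \<open>y\<close>; this is the tabloid of \<open>w\<close>.
\<close>

definition row_word :: "nat set \<Rightarrow> (nat \<Rightarrow> nat) \<Rightarrow> nat \<Rightarrow> nat" where
  "row_word U w = restrict (box_row U \<circ> inv' w) {1..n}"

text \<open>
  The polytabloid of the tableau \<open>w\<close>, as a function on permutations: the value at \<open>v\<close> is the
  coefficient of the tabloid of \<open>v\<close>. Working with functions on permutations puts the polytabloids of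
  all ribbons into one space.
\<close>

definition polytab_fun :: "nat set \<Rightarrow> (nat \<Rightarrow> nat) \<Rightarrow> (nat \<Rightarrow> nat) \<Rightarrow> complex" where
  "polytab_fun U w = (\<lambda>v. \<Sum>\<sigma>\<in>col_perms U. of_int (sign \<sigma>) * (if v \<in> G \<and> row_word U v = row_word U (w \<circ> \<sigma>) then 1 else 0))"

text \<open>
  Functions on permutations whose value depends only on the tabloid. The zero extension outside of
  the symmetric group makes equality of functions meaningful.
\<close>

definition tabloid_funs :: "nat set \<Rightarrow> ((nat \<Rightarrow> nat) \<Rightarrow> complex) set" where
  "tabloid_funs U = {f. (\<forall>v. v \<notin> G \<longrightarrow> f v = 0) \<and> (\<forall>w\<in>G. \<forall>\<rho>\<in>row_perms U. f (w \<circ> \<rho>) = f w)}"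

definition specht_funs :: "nat set \<Rightarrow> ((nat \<Rightarrow> nat) \<Rightarrow> complex) set" where
  "specht_funs U = cfun.span (polytab_fun U ` G)"

text \<open>
  Right multiplication by the column antisymmetrizer.
\<close>

definition col_antisym :: "nat set \<Rightarrow> ((nat \<Rightarrow> nat) \<Rightarrow> complex) \<Rightarrow> (nat \<Rightarrow> nat) \<Rightarrow> complex" where
  "col_antisym U f = (\<lambda>w. \<Sum>\<sigma>\<in>col_perms U. of_int (sign \<sigma>) * f (w \<circ> \<sigma>))"

text \<open>
  For the ribbon with up-steps \<open>descents w\<close> the tableau \<open>w\<close> is standard: entries increase to the right
  and downwards.
\<close>

definition descents :: "(nat \<Rightarrow> nat) \<Rightarrow> nat set" where
  "descents w = {j \<in> {1..<n}. w (Suc j) < w j}"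

lemma G_comp: "p \<in> G \<Longrightarrow> q \<in> G \<Longrightarrow> p \<circ> q \<in> G"
  by (simp add: G_def permutes_compose)
lemma G_inv: "p \<in> G \<Longrightarrow> inv' p \<in> G"
  by (simp add: G_def permutes_inv)
lemma G_id: "id \<in> G"
  by (simp add: G_def permutes_id)
lemma G_finite: "finite G"
  by (simp add: G_def finite_permutations)
lemma G_in: "p \<in> G \<Longrightarrow> p j \<in> {1..n} \<longleftrightarrow> j \<in> {1..n}"
  using permutes_in_image[of p "{1..n}" j] by (simp only: G_def mem_Collect_eq)
lemma G_inv1: "p \<in> G \<Longrightarrow> p (inv' p j) = j"
  using permutes_inverses(1)[of p "{1..n}" j] by (simp only: G_def mem_Collect_eq)
lemma G_inv2: "p \<in> G \<Longrightarrow> inv' p (p j) = j"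
  using permutes_inverses(2)[of p "{1..n}" j] by (simp only: G_def mem_Collect_eq)
lemma G_inv_cancel1: "p \<in> G \<Longrightarrow> p \<circ> (inv' p \<circ> v) = v"
  by (simp add: fun_eq_iff G_inv1)
lemma G_inv_cancel2: "p \<in> G \<Longrightarrow> inv' p \<circ> (p \<circ> v) = v"
  by (simp add: fun_eq_iff G_inv2)
lemma G_inv_comp: "p \<in> G \<Longrightarrow> q \<in> G \<Longrightarrow> inv' (p \<circ> q) = inv' q \<circ> inv' p"
  unfolding G_def by (intro o_inv_distrib) (auto simp: permutes_bij)
lemma G_inj: "p \<in> G \<Longrightarrow> p i = p j \<longleftrightarrow> i = j"
  using inj_eq[OF permutes_inj[of p "{1..n}"]] by (simp add: G_def)
lemma G_eqI: "p \<in> G \<Longrightarrow> q \<in> G \<Longrightarrow> (\<And>j. j \<in> {1..n} \<Longrightarrow> p j = q j) \<Longrightarrow> p = q"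
proof
  fix j assume *: "p \<in> G" "q \<in> G" "\<And>j. j \<in> {1..n} \<Longrightarrow> p j = q j"
  show "p j = q j"
    using *(3)[of j] permutes_not_in[of p "{1..n}" j] permutes_not_in[of q "{1..n}" j] *(1,2)
    by (cases "j \<in> {1..n}") (simp_all add: G_def)
qed

lemma row_perms_G: "\<rho> \<in> row_perms U \<Longrightarrow> \<rho> \<in> G" by (simp add: row_perms_def)
lemma col_perms_G: "\<rho> \<in> col_perms U \<Longrightarrow> \<rho> \<in> G" by (simp add: col_perms_def)
lemma col_perms_finite: "finite (col_perms U)" unfolding col_perms_def using G_finite by simp
lemma col_perms_id: "id \<in> col_perms U" by (simp add: col_perms_def G_id)
lemma col_perms_comp: "\<sigma> \<in> col_perms U \<Longrightarrow> \<tau> \<in> col_perms U \<Longrightarrow> \<sigma> \<circ> \<tau> \<in> col_perms U"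
proof -
  assume *: "\<sigma> \<in> col_perms U" "\<tau> \<in> col_perms U"
  have "box_col U (\<sigma> (\<tau> j)) = box_col U j" if j: "j \<in> {1..n}" for j
  proof -
    have "\<tau> j \<in> {1..n}" using G_in[OF col_perms_G[OF *(2)]] j by blast
    hence "box_col U (\<sigma> (\<tau> j)) = box_col U (\<tau> j)" using *(1) unfolding col_perms_def by blast
    also have "\<dots> = box_col U j" using *(2) j unfolding col_perms_def by blast
    finally show ?thesis .
  qed
  thus ?thesis using * by (simp add: col_perms_def G_comp)
qed

lemma row_eq_iff:
  assumes "i \<le> j" "i \<in> {1..n}" "j \<in> {1..n}"
  shows "box_row U i = box_row U j \<longleftrightarrow> U \<inter> {i..<j} = {}"
proof -
  have "U \<inter> {i..n} = (U \<inter> {i..<j}) \<union> (U \<inter> {j..n})" using assms by auto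
  moreover have "card ((U \<inter> {i..<j}) \<union> (U \<inter> {j..n})) = card (U \<inter> {i..<j}) + card (U \<inter> {j..n})"
    by (rule card_Un_disjoint) auto
  ultimately have "box_row U i = card (U \<inter> {i..<j}) + box_row U j" by (simp add: box_row_def)
  thus ?thesis by simp
qed

lemma col_eq_iff:
  assumes "i \<le> j" "i \<in> {1..n}" "j \<in> {1..n}"
  shows "box_col U i = box_col U j \<longleftrightarrow> {i..<j} \<subseteq> U"
proof -
  have "{1..<j} - U = ({1..<i} - U) \<union> ({i..<j} - U)" using assms by auto
  moreover have "card (({1..<i} - U) \<union> ({i..<j} - U)) = card ({1..<i} - U) + card ({i..<j} - U)"
    by (rule card_Un_disjoint) auto
  ultimately have "box_col U j = box_col U i + card ({i..<j} - U)" by (simp add: box_col_def)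
  thus ?thesis by auto
qed

lemma row_antimono: "i \<le> j \<Longrightarrow> box_row U j \<le> box_row U i"
  unfolding box_row_def by (rule card_mono) auto

lemma row_less_of_col_eq:
  assumes "i < j" "i \<in> {1..n}" "j \<in> {1..n}" "box_col U i = box_col U j"
  shows "box_row U j < box_row U i"
proof -
  have "i \<in> U" using col_eq_iff[of i j U] assms by auto
  hence "box_row U i \<noteq> box_row U j" using row_eq_iff[of i j U] assms by auto
  thus ?thesis using row_antimono[of i j U] assms by simp
qed

text \<open>
  Fewer up-steps make longer rows.
\<close>

lemma row_refine:
  assumes "U' \<subseteq> U" "i \<in> {1..n}" "j \<in> {1..n}" "box_row U i = box_row U j"
  shows "box_row U' i = box_row U' j"
proof (cases "i \<le> j")
  case True
  thus ?thesis using assms row_eq_iff[of i j U] row_eq_iff[of i j U'] by blast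
next
  case False
  thus ?thesis using assms row_eq_iff[of j i U] row_eq_iff[of j i U'] by fastforce
qed

lemma row_perms_antimono: "U' \<subseteq> U \<Longrightarrow> row_perms U \<subseteq> row_perms U'"
  unfolding row_perms_def using row_refine G_in by blast

lemma tabloid_funs_mono: "U' \<subseteq> U \<Longrightarrow> tabloid_funs U' \<subseteq> tabloid_funs U"
  using row_perms_antimono[of U' U] unfolding tabloid_funs_def by blast

text \<open>
  Tabloids are cosets of the row group, acting on the right by permuting boxes.
\<close>

lemma row_word_eq_iff:
  assumes "v \<in> G" "w \<in> G"
  shows "row_word U v = row_word U w \<longleftrightarrow> inv' w \<circ> v \<in> row_perms U"
proof
  assume *: "row_word U v = row_word U w"
  have "box_row U ((inv' w \<circ> v) j) = box_row U j" if "j \<in> {1..n}" for j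
    using fun_cong[OF *, of "v j"] that assms by (simp add: row_word_def G_in[simplified] G_inv2)
  thus "inv' w \<circ> v \<in> row_perms U" using assms by (simp add: row_perms_def G_comp G_inv)
next
  assume *: "inv' w \<circ> v \<in> row_perms U"
  show "row_word U v = row_word U w"
  proof
    fix y
    show "row_word U v y = row_word U w y"
    proof (cases "y \<in> {1..n}")
      case True
      hence "inv' v y \<in> {1..n}" using G_in[OF G_inv[OF assms(1)]] by blast
      hence "box_row U ((inv' w \<circ> v) (inv' v y)) = box_row U (inv' v y)" using * by (simp add: row_perms_def)
      thus ?thesis using True assms by (simp add: row_word_def G_inv1)
    next
      case False
      thus ?thesis by (simp only: row_word_def restrict_apply if_False)
    qed
  qed
qed

lemma row_word_comp_row: "w \<in> G \<Longrightarrow> \<rho> \<in> row_perms U \<Longrightarrow> row_word U (w \<circ> \<rho>) = row_word U w"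
  using row_word_eq_iff[of "w \<circ> \<rho>" w U] by (simp add: G_comp row_perms_G G_inv_cancel2)

lemma row_word_class: "u \<in> G \<Longrightarrow> {v \<in> G. row_word U v = row_word U u} = (\<lambda>\<rho>. u \<circ> \<rho>) ` row_perms U"
proof (intro equalityI subsetI)
  assume u: "u \<in> G"
  fix v assume "v \<in> {v \<in> G. row_word U v = row_word U u}"
  hence v: "v \<in> G" "inv' u \<circ> v \<in> row_perms U" using row_word_eq_iff u by auto
  have "v = u \<circ> (inv' u \<circ> v)" by (simp only: G_inv_cancel1[OF u])
  thus "v \<in> (\<lambda>\<rho>. u \<circ> \<rho>) ` row_perms U" using v(2) by (rule image_eqI)
next
  assume u: "u \<in> G"
  fix v assume "v \<in> (\<lambda>\<rho>. u \<circ> \<rho>) ` row_perms U"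
  thus "v \<in> {v \<in> G. row_word U v = row_word U u}" using u by (auto simp: G_comp row_perms_G row_word_comp_row)
qed

lemma tabloid_funs_row_word_cong: "f \<in> tabloid_funs U \<Longrightarrow> v \<in> G \<Longrightarrow> w \<in> G \<Longrightarrow> row_word U v = row_word U w \<Longrightarrow> f v = f w"
proof -
  assume *: "f \<in> tabloid_funs U" "v \<in> G" "w \<in> G" "row_word U v = row_word U w"
  have "v \<in> {v \<in> G. row_word U v = row_word U w}" using * by simp
  then obtain \<rho> where "\<rho> \<in> row_perms U" "v = w \<circ> \<rho>" unfolding row_word_class[OF *(3)] by blast
  thus "f v = f w" using * by (simp add: tabloid_funs_def)
qed

lemma subspace_tabloid_funs: "cfun.subspace (tabloid_funs U)"
  by (rule cfun.subspaceI) (auto simp: tabloid_funs_def fscale_def)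

lemma polytab_fun_tabloid_funs: "w \<in> G \<Longrightarrow> polytab_fun U w \<in> tabloid_funs U"
  by (auto simp: tabloid_funs_def polytab_fun_def row_word_comp_row G_comp row_perms_G)

lemma specht_funs_subset_tabloid_funs: "specht_funs U \<subseteq> tabloid_funs U"
  unfolding specht_funs_def by (rule cfun.span_minimal[OF _ subspace_tabloid_funs]) (use polytab_fun_tabloid_funs in auto)

text \<open>
  Adjacent boxes share a row or a column, according to the step between them.
\<close>

lemma transpose_row_perms_col_perms:
  assumes j: "j \<in> {1..<n}"
  shows "j \<notin> U \<Longrightarrow> Transposition.transpose j (Suc j) \<in> row_perms U"
    and "j \<in> U \<Longrightarrow> Transposition.transpose j (Suc j) \<in> col_perms U"
proof -
  have t: "Transposition.transpose j (Suc j) \<in> G" using j by (auto simp: G_def intro: permutes_swap_id)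
  have "box_row U j = box_row U (Suc j)" if "j \<notin> U" using row_eq_iff[of j "Suc j" U] j that by auto
  thus "j \<notin> U \<Longrightarrow> Transposition.transpose j (Suc j) \<in> row_perms U"
    using t by (auto simp: row_perms_def Transposition.transpose_def)
  have "box_col U j = box_col U (Suc j)" if "j \<in> U" using col_eq_iff[of j "Suc j" U] j that by auto
  thus "j \<in> U \<Longrightarrow> Transposition.transpose j (Suc j) \<in> col_perms U"
    using t by (auto simp: col_perms_def Transposition.transpose_def)
qed

lemma sign_G: "p \<in> G \<Longrightarrow> q \<in> G \<Longrightarrow> sign (p \<circ> q) = sign p * sign q"
proof -
  assume "p \<in> G" "q \<in> G"
  hence "permutation p" "permutation q" by (auto simp: G_def permutation_permutes)
  thus ?thesis by (rule sign_compose)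
qed

text \<open>
  For \<open>j\<close> in \<open>U\<close> and not in \<open>U'\<close>, the transposition \<open>(j j+1)\<close> is a column permutation of the ribbon
  \<open>U\<close> and a row permutation of \<open>U'\<close>. So it preserves \<open>f\<close> and reverses the sign of the
  antisymmetrizer.
\<close>

lemma col_antisym_kills:
  assumes f: "f \<in> tabloid_funs U'" and U: "U \<subseteq> {1..<n}" "\<not> U \<subseteq> U'" and w: "w \<in> G"
  shows "col_antisym U f w = 0"
proof -
  obtain j where j: "j \<in> U" "j \<notin> U'" using U by blast
  let ?s = "Transposition.transpose j (Suc j)"
  have s: "?s \<in> row_perms U'" "?s \<in> col_perms U" using transpose_row_perms_col_perms[of j] j U by auto
  have ss: "?s \<circ> ?s = id" by (rule transpose_comp_involutory)
  have bij: "bij_betw (\<lambda>\<sigma>. \<sigma> \<circ> ?s) (col_perms U) (col_perms U)"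
    by (rule bij_betwI[where g = "\<lambda>\<sigma>. \<sigma> \<circ> ?s"]) (use s col_perms_comp ss in \<open>auto simp: comp_assoc\<close>)
  have "col_antisym U f w = (\<Sum>\<sigma>\<in>col_perms U. of_int (sign (\<sigma> \<circ> ?s)) * f (w \<circ> (\<sigma> \<circ> ?s)))"
    unfolding col_antisym_def by (rule sum.reindex_bij_betw[OF bij, symmetric])
  also have "\<dots> = (\<Sum>\<sigma>\<in>col_perms U. - (of_int (sign \<sigma>) * f (w \<circ> \<sigma>)))"
  proof (rule sum.cong[OF refl])
    fix \<sigma> assume \<sigma>: "\<sigma> \<in> col_perms U"
    have "f (w \<circ> \<sigma> \<circ> ?s) = f (w \<circ> \<sigma>)" using f s(1) w \<sigma> G_comp col_perms_G unfolding tabloid_funs_def by blast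
    moreover have "sign (\<sigma> \<circ> ?s) = - sign \<sigma>"
      using sign_G[OF col_perms_G[OF \<sigma>] col_perms_G[OF s(2)]] by (simp add: sign_swap_id)
    ultimately show "of_int (sign (\<sigma> \<circ> ?s)) * f (w \<circ> (\<sigma> \<circ> ?s)) = - (of_int (sign \<sigma>) * f (w \<circ> \<sigma>))"
      by (simp add: comp_assoc[symmetric])
  qed
  also have "\<dots> = - col_antisym U f w" by (simp add: col_antisym_def sum_negf)
  finally show ?thesis by simp
qed

text \<open>
  The inner product of \<open>f\<close> with the polytabloid of \<open>w\<close> is a multiple of the conjugate of \<open>col_antisym U f w\<close>.
  So \<open>f\<close> is orthogonal to all polytabloids, in particular to itself.
\<close>

lemma specht_funs_col_antisym_eq_0:
  assumes f: "f \<in> specht_funs U" and b: "\<And>w. w \<in> G \<Longrightarrow> col_antisym U f w = 0"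
  shows "f = 0"
proof -
  have fM: "f \<in> tabloid_funs U" using f specht_funs_subset_tabloid_funs by blast
  have pair_e: "(\<Sum>v\<in>G. cnj (f v) * polytab_fun U w v) = 0" if w: "w \<in> G" for w
  proof -
    have "(\<Sum>v\<in>G. cnj (f v) * polytab_fun U w v)
      = (\<Sum>\<sigma>\<in>col_perms U. \<Sum>v\<in>G. of_int (sign \<sigma>) * (if row_word U v = row_word U (w \<circ> \<sigma>) then cnj (f v) else 0))"
      unfolding polytab_fun_def sum_distrib_left by (subst sum.swap) (intro sum.cong refl, simp)
    also have "\<dots> = (\<Sum>\<sigma>\<in>col_perms U. of_nat (card (row_perms U)) * cnj (of_int (sign \<sigma>) * f (w \<circ> \<sigma>)))"
    proof (rule sum.cong[OF refl])
      fix \<sigma> assume "\<sigma> \<in> col_perms U"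
      hence u: "w \<circ> \<sigma> \<in> G" using w G_comp col_perms_G by blast
      have "(\<Sum>v\<in>G. if row_word U v = row_word U (w \<circ> \<sigma>) then cnj (f v) else 0)
        = (\<Sum>v\<in>{v \<in> G. row_word U v = row_word U (w \<circ> \<sigma>)}. cnj (f v))"
        by (rule sum.inter_filter[OF G_finite, symmetric])
      also have "\<dots> = (\<Sum>v\<in>{v \<in> G. row_word U v = row_word U (w \<circ> \<sigma>)}. cnj (f (w \<circ> \<sigma>)))"
        by (intro sum.cong refl) (use tabloid_funs_row_word_cong[OF fM _ u] in auto)
      also have "\<dots> = of_nat (card {v \<in> G. row_word U v = row_word U (w \<circ> \<sigma>)}) * cnj (f (w \<circ> \<sigma>))"
        by simp
      also have "card {v \<in> G. row_word U v = row_word U (w \<circ> \<sigma>)} = card (row_perms U)"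
        unfolding row_word_class[OF u]
      proof (rule card_image, rule inj_onI)
        fix x y assume "(w \<circ> \<sigma>) \<circ> x = (w \<circ> \<sigma>) \<circ> y"
        thus "x = y" using G_inj[OF u] by (auto simp: fun_eq_iff)
      qed
      finally have key: "(\<Sum>v\<in>G. if row_word U v = row_word U (w \<circ> \<sigma>) then cnj (f v) else 0)
        = of_nat (card (row_perms U)) * cnj (f (w \<circ> \<sigma>))" .
      show "(\<Sum>v\<in>G. of_int (sign \<sigma>) * (if row_word U v = row_word U (w \<circ> \<sigma>) then cnj (f v) else 0))
        = of_nat (card (row_perms U)) * cnj (of_int (sign \<sigma>) * f (w \<circ> \<sigma>))"
        unfolding sum_distrib_left[symmetric] key by (simp only: complex_cnj_mult complex_cnj_of_int mult_ac)
    qed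
    also have "\<dots> = of_nat (card (row_perms U)) * cnj (col_antisym U f w)"
      by (simp add: col_antisym_def sum_distrib_left)
    finally show ?thesis using b[OF w] by simp
  qed
  have pair: "(\<Sum>v\<in>G. cnj (f v) * g v) = 0" if "g \<in> specht_funs U" for g
    using that unfolding specht_funs_def
  proof (induction rule: cfun.span_induct_alt)
    case base show ?case by simp
  next
    case (step c x y)
    then obtain w where "w \<in> G" "x = polytab_fun U w" by blast
    moreover have "(\<Sum>v\<in>G. cnj (f v) * (fscale c x + y) v) = c * (\<Sum>v\<in>G. cnj (f v) * x v) + (\<Sum>v\<in>G. cnj (f v) * y v)"
      by (simp add: fscale_def algebra_simps sum.distrib sum_distrib_left)
    ultimately show ?case using step pair_e by simp
  qed
  have "(\<Sum>v\<in>G. of_real ((cmod (f v))\<^sup>2)) = (0 :: complex)"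
    using pair[OF f] by (simp only: complex_norm_square mult.commute)
  hence "(\<Sum>v\<in>G. (cmod (f v))\<^sup>2) = 0" unfolding of_real_sum[symmetric] of_real_eq_0_iff .
  hence "f v = 0" if "v \<in> G" for v using that sum_nonneg_eq_0_iff[OF G_finite, of "\<lambda>v. (cmod (f v))\<^sup>2"] by simp
  moreover have "f v = 0" if "v \<notin> G" for v using fM that by (simp add: tabloid_funs_def)
  ultimately show ?thesis by (auto simp: fun_eq_iff)
qed

lemma col_antisym_sum: "col_antisym U (\<lambda>v. \<Sum>i\<in>I. f i v) w = (\<Sum>i\<in>I. col_antisym U (f i) w)"
  unfolding col_antisym_def sum_distrib_left by (rule sum.swap)

text \<open>
  Specht modules of different ribbons are independent, in the form that is used later: if \<open>P\<close> is an
  upward closed family of sets whose antisymmetrizers kill the sum of the \<open>x U\<close>, then the components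
  in this family vanish. By descending induction on the size of \<open>U\<close>, the antisymmetrizer of \<open>U\<close>
  kills all other components: those of proper supersets are zero already, and the others are killed
  by \<open>col_antisym_kills\<close>.
\<close>

lemma specht_funs_components_vanish:
  assumes x: "\<And>U. U \<subseteq> {1..<n} \<Longrightarrow> x U \<in> specht_funs U"
    and s: "\<And>U w. U \<subseteq> {1..<n} \<Longrightarrow> P U \<Longrightarrow> w \<in> G \<Longrightarrow> col_antisym U (\<lambda>v. \<Sum>U'\<in>Pow {1..<n}. x U' v) w = 0"
    and up: "\<And>U U'. P U \<Longrightarrow> U \<subseteq> U' \<Longrightarrow> P U'"
    and U: "U \<subseteq> {1..<n}" "P U"
  shows "x U = 0"
  using U
proof (induction "n - card U" arbitrary: U rule: less_induct)
  case less
  have "col_antisym U (x U) w = 0" if w: "w \<in> G" for w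
  proof -
    have z: "col_antisym U (x U') w = 0" if U': "U' \<subseteq> {1..<n}" "U' \<noteq> U" for U'
    proof (cases "U \<subseteq> U'")
      case True
      have "finite U'" using finite_subset[OF U'(1)] by simp
      hence "card U < card U'" by (rule psubset_card_mono) (use True U'(2) in blast)
      moreover have "card U' \<le> n - 1" using card_mono[OF _ U'(1)] by simp
      moreover have "1 \<le> n \<or> U' = {}" using U'(1) by fastforce
      ultimately have "n - card U' < n - card U" by auto
      hence "x U' = 0" by (rule less.hyps[OF _ U'(1) up[OF less.prems(2) True]])
      thus ?thesis by (simp add: col_antisym_def)
    next
      case False
      thus ?thesis using col_antisym_kills[of "x U'" U' U w] x[OF U'(1)] specht_funs_subset_tabloid_funs less.prems w by blast
    qed
    have "0 = (\<Sum>U'\<in>Pow {1..<n}. col_antisym U (x U') w)"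
      using s[OF less.prems w] by (simp add: col_antisym_sum)
    also have "\<dots> = (\<Sum>U'\<in>{U}. col_antisym U (x U') w)"
      by (rule sum.mono_neutral_right) (use less.prems z in auto)
    finally show ?thesis by simp
  qed
  thus ?case using specht_funs_col_antisym_eq_0 x[OF less.prems(1)] by blast
qed

end

section \<open>Standard polytabloids as a basis\<close>

lemma positional_sum_less:
  fixes u :: "nat \<Rightarrow> nat"
  assumes "\<And>y. u y < B"
  shows "(\<Sum>y<m. u y * B ^ y) < B ^ m"
proof (induction m)
  case (Suc m)
  have "(\<Sum>y<Suc m. u y * B ^ y) < B ^ m + u m * B ^ m" using Suc by simp
  also have "\<dots> = Suc (u m) * B ^ m" by simp
  also have "\<dots> \<le> B * B ^ m" using assms[of m] by (intro mult_right_mono) auto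
  finally show ?case by simp
qed simp

text \<open>
  Numbers in base \<open>B\<close> are compared at the most significant digit where they differ.
\<close>

lemma positional_sum_mono:
  fixes u v :: "nat \<Rightarrow> nat"
  assumes B: "\<And>y. u y < B" and y0: "y0 \<le> m" "u y0 < v y0" and eq: "\<And>y. y0 < y \<Longrightarrow> y \<le> m \<Longrightarrow> u y = v y"
  shows "(\<Sum>y\<le>m. u y * B ^ y) < (\<Sum>y\<le>m. v y * B ^ y)"
proof -
  have split: "(\<Sum>y\<le>m. w y * B ^ y) = (\<Sum>y<y0. w y * B ^ y) + w y0 * B ^ y0 + (\<Sum>y\<in>{y0<..m}. w y * B ^ y)"
    for w :: "nat \<Rightarrow> nat"
  proof -
    have "{..m} = insert y0 {..<y0} \<union> {y0<..m}" using y0 by auto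
    hence "(\<Sum>y\<le>m. w y * B ^ y) = (\<Sum>y\<in>insert y0 {..<y0}. w y * B ^ y) + (\<Sum>y\<in>{y0<..m}. w y * B ^ y)"
      by (simp only:) (rule sum.union_disjoint, auto)
    thus ?thesis by simp
  qed
  have "(\<Sum>y<y0. u y * B ^ y) + u y0 * B ^ y0 < B ^ y0 + u y0 * B ^ y0"
    using positional_sum_less[of u B y0, OF B] by simp
  also have "\<dots> = Suc (u y0) * B ^ y0" by simp
  also have "\<dots> \<le> v y0 * B ^ y0" using y0 by (intro mult_right_mono) auto
  finally have "(\<Sum>y<y0. u y * B ^ y) + u y0 * B ^ y0 < (\<Sum>y<y0. v y * B ^ y) + v y0 * B ^ y0" by simp
  moreover have "(\<Sum>y\<in>{y0<..m}. u y * B ^ y) = (\<Sum>y\<in>{y0<..m}. v y * B ^ y)"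
    by (intro sum.cong refl) (use eq in auto)
  ultimately show ?thesis unfolding split by simp
qed

lemma strict_mono_on_interval:
  fixes f :: "nat \<Rightarrow> nat"
  assumes "a < b" "\<And>j. a \<le> j \<Longrightarrow> j < b \<Longrightarrow> f j < f (Suc j)"
  shows "f a < f b"
  using assms
proof (induction b)
  case (Suc b)
  show ?case
  proof (cases "a = b")
    case False
    hence "f a < f b" using Suc by simp
    also have "f b < f (Suc b)" using Suc.prems by simp
    finally show ?thesis .
  qed (use Suc.prems in simp)
qed simp

lemma strict_antimono_on_interval:
  fixes f :: "nat \<Rightarrow> nat"
  assumes "a < b" "\<And>j. a \<le> j \<Longrightarrow> j < b \<Longrightarrow> f (Suc j) < f j"
  shows "f b < f a"
  using assms
proof (induction b)
  case (Suc b)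
  show ?case
  proof (cases "a = b")
    case False
    hence "f b < f a" using Suc by simp
    moreover have "f (Suc b) < f b" using Suc.prems by simp
    ultimately show ?thesis by simp
  qed (use Suc.prems in simp)
qed simp

context
  fixes n :: nat
begin

abbreviation "GG \<equiv> G n"
text \<open>
  The row word read as a number in base \<open>n + 1\<close>, the row of the largest entry being the most
  significant digit. A column permutation of a standard tableau moves its largest displaced entry
  up, which lowers the number.
\<close>

definition word_potential :: "(nat \<Rightarrow> nat) \<Rightarrow> nat" where
  "word_potential u = (\<Sum>y\<le>n. (if y \<in> {1..n} then u y else 0) * (n + 1) ^ y)"

lemma descents_subset: "descents n w \<subseteq> {1..<n}" by (auto simp: descents_def)

lemma descents_column_decreasing:
  assumes "p < p'" "p \<in> {1..n}" "p' \<in> {1..n}" "box_col (descents n w) p = box_col (descents n w) p'"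
  shows "w p' < w p"
proof (rule strict_antimono_on_interval[OF assms(1)])
  fix j assume "p \<le> j" "j < p'"
  hence "j \<in> descents n w" using col_eq_iff[of p p' n "descents n w"] assms by auto
  thus "w (Suc j) < w j" by (simp add: descents_def)
qed

lemma descents_row_increasing:
  assumes w: "w \<in> GG" and "p < p'" "p \<in> {1..n}" "p' \<in> {1..n}" "box_row n (descents n w) p = box_row n (descents n w) p'"
  shows "w p < w p'"
proof (rule strict_mono_on_interval[OF assms(2)])
  fix j assume j: "p \<le> j" "j < p'"
  hence "j \<notin> descents n w" using row_eq_iff[of p p' n "descents n w"] assms by auto
  hence "\<not> w (Suc j) < w j" using j assms by (simp add: descents_def)
  moreover have "w (Suc j) \<noteq> w j" using G_inj[OF w, of "Suc j" j] by simp
  ultimately show "w j < w (Suc j)" by simp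
qed

lemma box_row_le: "U \<subseteq> {1..<n} \<Longrightarrow> box_row n U j < n + 1"
proof -
  have "card (U \<inter> {j..n}) \<le> card {1..n}" if "U \<subseteq> {1..<n}" using that by (intro card_mono) auto
  thus "U \<subseteq> {1..<n} \<Longrightarrow> box_row n U j < n + 1" by (simp add: box_row_def)
qed

text \<open>
  Within each column the entries decrease from bottom to top. The largest displaced entry has only
  smaller or fixed entries to change places with, so it moves up, to a smaller row number.
\<close>

lemma word_potential_column_perm_less:
  assumes w: "w \<in> GG" and \<sigma>: "\<sigma> \<in> col_perms n (descents n w)" and ne: "\<sigma> \<noteq> id"
  shows "word_potential (row_word n (descents n w) (w \<circ> \<sigma>)) < word_potential (row_word n (descents n w) w)"
proof -
  let ?U = "descents n w"
  let ?\<tau> = "inv' \<sigma>"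
  have \<sigma>G: "\<sigma> \<in> GG" using col_perms_G[OF \<sigma>] .
  have \<tau>G: "?\<tau> \<in> GG" using G_inv[OF \<sigma>G] .
  have \<tau>n: "?\<tau> p \<in> {1..n}" if "p \<in> {1..n}" for p using G_in[OF \<tau>G] that by blast
  have \<tau>col: "box_col ?U (?\<tau> p) = box_col ?U p" if p: "p \<in> {1..n}" for p
  proof -
    have "box_col ?U (\<sigma> (?\<tau> p)) = box_col ?U (?\<tau> p)" using \<sigma> \<tau>n[OF p] unfolding col_perms_def by blast
    thus ?thesis by (simp add: G_inv1[OF \<sigma>G])
  qed
  let ?Y = "{y \<in> {1..n}. ?\<tau> (inv' w y) \<noteq> inv' w y}"
  have "?Y \<noteq> {}"
  proof
    assume Y: "?Y = {}"
    have "\<sigma> p = p" if p: "p \<in> {1..n}" for p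
    proof -
      have "w p \<in> {1..n}" using G_in[OF w] p by blast
      hence "?\<tau> (inv' w (w p)) = inv' w (w p)" using Y by blast
      hence "?\<tau> p = p" by (simp add: G_inv2[OF w])
      thus ?thesis using G_inv1[OF \<sigma>G, of p] by simp
    qed
    thus False using ne G_eqI[OF \<sigma>G G_id] by simp
  qed
  \<comment> \<open>The largest entry that changes its box.\<close>
  define y0 where "y0 = Max ?Y"
  have fin: "finite ?Y" by simp
  have y0: "y0 \<in> {1..n}" "?\<tau> (inv' w y0) \<noteq> inv' w y0" using Max_in[OF fin \<open>?Y \<noteq> {}\<close>] unfolding y0_def by blast+
  have above: "?\<tau> (inv' w y) = inv' w y" if "y0 < y" "y \<in> {1..n}" for y
  proof (rule ccontr)
    assume "\<not> ?thesis"
    hence "y \<in> ?Y" using that by blast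
    hence "y \<le> y0" unfolding y0_def by (rule Max_ge[OF fin])
    thus False using that(1) by simp
  qed
  define p where "p = inv' w y0"
  have p: "p \<in> {1..n}" "w p = y0"
    using G_in[OF G_inv[OF w], of y0] y0(1) G_inv1[OF w, of y0] unfolding p_def by blast+
  have \<tau>p: "?\<tau> p \<noteq> p" using y0 p_def by simp
  have lt: "p < ?\<tau> p"
  proof (rule ccontr)
    assume "\<not> p < ?\<tau> p"
    hence "?\<tau> p < p" using \<tau>p by simp
    hence gt: "y0 < w (?\<tau> p)"
      using descents_column_decreasing[OF _ \<tau>n[OF p(1)] p(1) \<tau>col[OF p(1)]] p(2) by simp
    have "w (?\<tau> p) \<in> {1..n}" using G_in[OF w] \<tau>n[OF p(1)] by blast
    hence "?\<tau> (inv' w (w (?\<tau> p))) = inv' w (w (?\<tau> p))" using above[OF gt] by blast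
    hence "?\<tau> (?\<tau> p) = ?\<tau> p" by (simp add: G_inv2[OF w])
    thus False using G_inj[OF \<tau>G] \<tau>p by simp
  qed
  have inv: "inv' (w \<circ> \<sigma>) y = ?\<tau> (inv' w y)" for y using G_inv_comp[OF w \<sigma>G] by simp
  show ?thesis
    unfolding word_potential_def
  proof (rule positional_sum_mono[of _ _ y0])
    show "(if y \<in> {1..n} then row_word n ?U (w \<circ> \<sigma>) y else 0) < n + 1" for y
      using box_row_le[OF descents_subset[of w]] by (simp add: row_word_def)
    show "y0 \<le> n" using y0 by simp
    have "box_row n ?U (?\<tau> p) < box_row n ?U p"
      by (rule row_less_of_col_eq[OF lt p(1) \<tau>n[OF p(1)] \<tau>col[OF p(1), symmetric]])
    thus "(if y0 \<in> {1..n} then row_word n ?U (w \<circ> \<sigma>) y0 else 0) < (if y0 \<in> {1..n} then row_word n ?U w y0 else 0)"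
      using y0(1) by (simp only: row_word_def restrict_apply if_True comp_apply inv p_def)
    fix y assume "y0 < y" "y \<le> n"
    hence y: "y \<in> {1..n}" by simp
    show "(if y \<in> {1..n} then row_word n ?U (w \<circ> \<sigma>) y else 0) = (if y \<in> {1..n} then row_word n ?U w y else 0)"
      using y above[OF \<open>y0 < y\<close> y] by (simp only: row_word_def restrict_apply if_True comp_apply inv)
  qed
qed

text \<open>
  Entries increase along rows in both tableaux, so a tabloid is filled in only one way.
\<close>

lemma row_standard_unique:
  assumes w: "w \<in> GG" and w': "w' \<in> GG" and D: "descents n w = U" "descents n w' = U"
    and eq: "row_word n U w' = row_word n U w"
  shows "w' = w"
proof -
  define \<rho> where "\<rho> = inv' w \<circ> w'"
  have \<rho>: "\<rho> \<in> row_perms n U" using row_word_eq_iff[OF w' w] eq by (simp add: \<rho>_def)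
  have \<rho>G: "\<rho> \<in> GG" using row_perms_G[OF \<rho>] .
  have w\<rho>: "w' p = w (\<rho> p)" for p by (simp add: \<rho>_def G_inv1[OF w])
  have \<rho>n: "\<rho> p \<in> {1..n}" if "p \<in> {1..n}" for p using G_in[OF \<rho>G] that by blast
  have \<rho>row: "box_row n U (\<rho> p) = box_row n U p" if "p \<in> {1..n}" for p using \<rho> that unfolding row_perms_def by blast
  have mono: "\<rho> p < \<rho> p'" if "p < p'" "p \<in> {1..n}" "p' \<in> {1..n}" "box_row n U p = box_row n U p'" for p p'
  proof (rule ccontr)
    assume "\<not> \<rho> p < \<rho> p'"
    hence "\<rho> p' < \<rho> p" using G_inj[OF \<rho>G, of p p'] that(1) by simp
    hence "w (\<rho> p') < w (\<rho> p)"
      using descents_row_increasing[OF w, of "\<rho> p'" "\<rho> p"] D(1) \<rho>n that \<rho>row by simp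
    moreover have "w' p < w' p'" using descents_row_increasing[OF w', of p p'] D(2) that by simp
    ultimately show False by (simp add: w\<rho>)
  qed
  have "\<rho> p = p" if p: "p \<in> {1..n}" for p
    using p
  proof (induction p rule: less_induct)
    case (less p)
    have fixed: "\<rho> q = q" if "q < p" "q \<in> {1..n}" for q using less that by simp
    show ?case
    proof (rule ccontr)
      assume ne: "\<rho> p \<noteq> p"
      have gt: "p < \<rho> p"
      proof (rule ccontr)
        assume "\<not> p < \<rho> p"
        hence "\<rho> (\<rho> p) = \<rho> p" using fixed[of "\<rho> p"] ne \<rho>n[OF less.prems] by simp
        thus False using G_inj[OF \<rho>G] ne by simp
      qed
      define p'' where "p'' = inv' \<rho> p"
      have p'': "\<rho> p'' = p" "p'' \<in> {1..n}"
        using G_inv1[OF \<rho>G] G_in[OF G_inv[OF \<rho>G]] less.prems by (auto simp: p''_def)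
      have "p'' \<noteq> p" using p'' ne by auto
      moreover have "\<not> p'' < p" using fixed[of p''] p'' by auto
      ultimately have "p < p''" by simp
      hence "\<rho> p < \<rho> p''"
        by (rule mono[OF _ less.prems p''(2)]) (use \<rho>row[OF p''(2)] p''(1) in simp)
      thus False using p'' gt by simp
    qed
  qed
  hence "\<rho> = id" using G_eqI[OF \<rho>G G_id] by simp
  thus ?thesis using w\<rho> by (simp add: fun_eq_iff)
qed

text \<open>
  The tabloid of a standard tableau has the largest potential in its polytabloid, with coefficient
  1.
\<close>

lemma polytab_fun_standard_value:
  assumes w: "w \<in> GG" and v: "v \<in> GG" and D: "descents n v = descents n w"
    and word_potential: "word_potential (row_word n (descents n w) w) \<le> word_potential (row_word n (descents n w) v)"
  shows "polytab_fun n (descents n w) w v = (if v = w then 1 else 0)"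
proof -
  let ?U = "descents n w"
  have "polytab_fun n ?U w v = (\<Sum>\<sigma>\<in>col_perms n ?U. if \<sigma> = id then (if v = w then 1 else 0) else 0)"
    unfolding polytab_fun_def
  proof (rule sum.cong[OF refl])
    fix \<sigma> assume \<sigma>: "\<sigma> \<in> col_perms n ?U"
    show "of_int (sign \<sigma>) * (if v \<in> GG \<and> row_word n ?U v = row_word n ?U (w \<circ> \<sigma>) then 1 else 0)
      = (if \<sigma> = id then (if v = w then 1 else 0) else (0 :: complex))"
    proof (cases "\<sigma> = id")
      case True
      have "row_word n ?U v = row_word n ?U w \<longleftrightarrow> v = w" using row_standard_unique[OF w v refl D] by blast
      thus ?thesis using True v by simp
    next
      case False
      have "row_word n ?U v \<noteq> row_word n ?U (w \<circ> \<sigma>)" using word_potential_column_perm_less[OF w \<sigma> False] word_potential by auto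
      thus ?thesis using False by simp
    qed
  qed
  also have "\<dots> = (if v = w then 1 else 0)" using col_perms_id col_perms_finite by simp
  finally show ?thesis .
qed

text \<open>
  Evaluate a relation at the tableau of largest potential among those with a nonzero coefficient.
\<close>

lemma polytab_fun_standard_independent:
  assumes s: "(\<Sum>w\<in>{w \<in> GG. descents n w = U}. fscale (a w) (polytab_fun n U w)) = 0" and w: "w \<in> GG" "descents n w = U"
  shows "a w = 0"
proof (rule ccontr)
  assume "a w \<noteq> 0"
  let ?D = "{w \<in> GG. descents n w = U}"
  let ?A = "{w \<in> ?D. a w \<noteq> 0}"
  have fin: "finite ?A" using G_finite by simp
  have "?A \<noteq> {}" using w \<open>a w \<noteq> 0\<close> by auto
  hence "Max ((\<lambda>w. word_potential (row_word n U w)) ` ?A) \<in> (\<lambda>w. word_potential (row_word n U w)) ` ?A" using fin by (intro Max_in) auto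
  then obtain w0 where w0: "w0 \<in> ?A" "word_potential (row_word n U w0) = Max ((\<lambda>w. word_potential (row_word n U w)) ` ?A)" by auto
  have max: "word_potential (row_word n U v) \<le> word_potential (row_word n U w0)" if "v \<in> ?A" for v
    unfolding w0(2) using fin that by (intro Max_ge) auto
  have "0 = (\<Sum>w\<in>?D. fscale (a w) (polytab_fun n U w)) w0" using s by simp
  also have "\<dots> = (\<Sum>w\<in>?D. a w * polytab_fun n U w w0)" by (simp add: sum_fun_apply fscale_def)
  also have "\<dots> = (\<Sum>w\<in>?D. if w = w0 then a w else 0)"
  proof (rule sum.cong[OF refl])
    fix v assume v: "v \<in> ?D"
    show "a v * polytab_fun n U v w0 = (if v = w0 then a v else 0)"
    proof (cases "a v = 0")
      case False
      hence "word_potential (row_word n U v) \<le> word_potential (row_word n U w0)" using v max by blast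
      thus ?thesis using polytab_fun_standard_value[of v w0] v w0(1) by auto
    next
      case True
      thus ?thesis by auto
    qed
  qed
  also have "\<dots> = a w0" using w0(1) G_finite by simp
  finally show False using w0(1) by simp
qed

abbreviation "std_polytab w \<equiv> polytab_fun n (descents n w) w"

lemma specht_funs_span_sum: "(\<Sum>w\<in>{w \<in> GG. descents n w = U}. fscale (a w) (std_polytab w)) \<in> specht_funs n U"
  unfolding specht_funs_def by (intro cfun.span_sum cfun.span_scale cfun.span_base) auto

lemma sum_by_descents:
  fixes g :: "(nat \<Rightarrow> nat) \<Rightarrow> (nat \<Rightarrow> nat) \<Rightarrow> complex"
  shows "(\<Sum>U\<in>Pow {1..<n}. \<Sum>w\<in>{w \<in> GG. descents n w = U}. g w) = (\<Sum>w\<in>GG. g w)"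
  by (rule sum.group) (use G_finite descents_subset in auto)

text \<open>
  A combination of standard polytabloids of all ribbons is split into its components in the several
  Specht modules.
\<close>

lemma std_polytab_components:
  assumes s: "(\<Sum>w\<in>GG. fscale (a w) (std_polytab w)) = x"
    and P: "\<And>U w. U \<subseteq> {1..<n} \<Longrightarrow> P U \<Longrightarrow> w \<in> GG \<Longrightarrow> col_antisym n U x w = 0"
    and up: "\<And>U U'. P U \<Longrightarrow> U \<subseteq> U' \<Longrightarrow> P U'"
    and w: "w \<in> GG" "P (descents n w)"
  shows "a w = 0"
proof -
  define y where "y = (\<lambda>U. \<Sum>w\<in>{w \<in> GG. descents n w = U}. fscale (a w) (std_polytab w))"
  have "(\<lambda>v. \<Sum>U\<in>Pow {1..<n}. y U v) = x"
    unfolding s[symmetric] sum_by_descents[symmetric] y_def by (rule ext) (simp add: sum_fun_apply)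
  note yx = this
  have yE: "y U \<in> specht_funs n U" for U unfolding y_def by (rule specht_funs_span_sum)
  have "y (descents n w) = 0"
  proof (rule specht_funs_components_vanish[where x = y and P = P])
    show "col_antisym n U (\<lambda>v. \<Sum>U'\<in>Pow {1..<n}. y U' v) v = 0" if "U \<subseteq> {1..<n}" "P U" "v \<in> GG" for U v
      unfolding yx by (rule P[OF that])
    show "P U'" if "P U" "U \<subseteq> U'" for U U' by (rule up[OF that])
  qed (rule yE descents_subset w(2))+
  moreover have "(\<Sum>v\<in>{v \<in> GG. descents n v = descents n w}. fscale (a v) (polytab_fun n (descents n w) v)) = y (descents n w)"
    unfolding y_def by (intro sum.cong refl) auto
  ultimately have "(\<Sum>v\<in>{v \<in> GG. descents n v = descents n w}. fscale (a v) (polytab_fun n (descents n w) v)) = 0" by simp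
  thus ?thesis by (rule polytab_fun_standard_independent) (use w in auto)
qed

lemma col_antisym_zero: "col_antisym n U 0 w = 0" by (simp add: col_antisym_def)

lemma std_polytab_independent_aux:
  assumes "(\<Sum>w\<in>GG. fscale (a w) (std_polytab w)) = 0" "w \<in> GG"
  shows "a w = 0"
  by (rule std_polytab_components[where P = "\<lambda>_. True", OF assms(1) col_antisym_zero TrueI assms(2) TrueI])

lemma std_polytab_inj: "inj_on std_polytab GG"
proof (rule inj_onI, rule ccontr)
  fix w w' assume *: "w \<in> GG" "w' \<in> GG" "std_polytab w = std_polytab w'" "w \<noteq> w'"
  let ?a = "\<lambda>v. (if v = w then 1 else 0) - (if v = w' then 1 else (0::complex))"
  have "(\<Sum>v\<in>GG. fscale (?a v) (std_polytab v)) = (\<Sum>v\<in>GG. (if v = w then std_polytab v else 0)) - (\<Sum>v\<in>GG. (if v = w' then std_polytab v else 0))"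
    unfolding sum_subtractf[symmetric] by (intro sum.cong refl) (auto simp: fscale_def fun_eq_iff)
  also have "\<dots> = 0" using * G_finite by simp
  finally have "?a w = 0" by (rule std_polytab_independent_aux[OF _ *(1)])
  thus False using *(4) by simp
qed

lemma std_polytab_independent: "cfun.independent (std_polytab ` GG)"
proof (rule cfun.independent_if_scalars_zero)
  fix c x assume *: "(\<Sum>x\<in>std_polytab ` GG. fscale (c x) x) = 0" "x \<in> std_polytab ` GG"
  then obtain w where w: "w \<in> GG" "x = std_polytab w" by auto
  have "(\<Sum>w\<in>GG. fscale (c (std_polytab w)) (std_polytab w)) = 0"
    using *(1) unfolding sum.reindex[OF std_polytab_inj] comp_def .
  from std_polytab_independent_aux[OF this w(1)] show "c x = 0" unfolding w(2) .
qed (use G_finite in simp)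

lemma specht_funs_support: "x \<in> tabloid_funs n U \<Longrightarrow> v \<notin> GG \<Longrightarrow> x v = 0" by (simp add: tabloid_funs_def)

text \<open>
  There are \<open>n!\<close> standard polytabloids, one for each permutation, and they are independent, so they
  are a basis of the space of functions on the symmetric group by dimension.
\<close>

lemma std_polytab_spans:
  assumes x: "\<And>v. v \<notin> GG \<Longrightarrow> x v = (0 :: complex)"
  shows "x \<in> cfun.span (std_polytab ` GG)"
proof (rule ccontr)
  assume nx: "x \<notin> cfun.span (std_polytab ` GG)"
  let ?e = "\<lambda>w v. if v = w then 1 else (0 :: complex)"
  let ?B = "insert x (std_polytab ` GG)"
  have ind: "cfun.independent ?B" using cfun.independent_insertI[OF nx std_polytab_independent] .
  have sp: "f \<in> cfun.span (?e ` GG)" if "\<And>v. v \<notin> GG \<Longrightarrow> f v = 0" for f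
  proof -
    have "f = (\<Sum>w\<in>GG. fscale (f w) (?e w))"
    proof
      fix v
      have "(\<Sum>w\<in>GG. fscale (f w) (?e w)) v = (\<Sum>w\<in>GG. if w = v then f w else 0)"
        unfolding sum_fun_apply fscale_def by (intro sum.cong refl) auto
      thus "f v = (\<Sum>w\<in>GG. fscale (f w) (?e w)) v" using that G_finite by auto
    qed
    also have "\<dots> \<in> cfun.span (?e ` GG)" by (intro cfun.span_sum cfun.span_scale cfun.span_base) auto
    finally show ?thesis .
  qed
  have e1: "std_polytab w \<in> cfun.span (?e ` GG)" if w: "w \<in> GG" for w
  proof (rule sp)
    show "std_polytab w v = 0" if "v \<notin> GG" for v by (rule specht_funs_support[OF polytab_fun_tabloid_funs[OF w] that])
  qed
  have "?B \<subseteq> cfun.span (?e ` GG)"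
    unfolding insert_subset image_subset_iff by (rule conjI[OF sp[OF x] ballI[OF e1]])
  hence "card ?B \<le> card (?e ` GG)" using cfun.independent_span_bound[OF finite_imageI[OF G_finite] ind] by blast
  also have "\<dots> \<le> card GG" by (rule card_image_le[OF G_finite])
  also have "\<dots> = card (std_polytab ` GG)" by (rule card_image[OF std_polytab_inj, symmetric])
  finally have "card ?B \<le> card (std_polytab ` GG)" .
  moreover have "x \<notin> std_polytab ` GG" using nx cfun.span_base[of x "std_polytab ` GG"] by blast
  hence "card ?B = Suc (card (std_polytab ` GG))" by (rule card_insert_disjoint[OF finite_imageI[OF G_finite]])
  ultimately show False by simp
qed

lemma std_polytab_expansion:
  assumes "\<And>v. v \<notin> GG \<Longrightarrow> x v = (0 :: complex)"
  obtains a where "(\<Sum>w\<in>GG. fscale (a w) (std_polytab w)) = x"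
proof -
  have "x = (\<Sum>b\<in>std_polytab ` GG. fscale (cfun.representation (std_polytab ` GG) x b) b)"
    using cfun.sum_representation_eq[OF std_polytab_independent std_polytab_spans[OF assms] _ subset_refl] G_finite by simp
  also have "\<dots> = (\<Sum>w\<in>GG. fscale (cfun.representation (std_polytab ` GG) x (std_polytab w)) (std_polytab w))"
    unfolding sum.reindex[OF std_polytab_inj] comp_def ..
  finally show ?thesis by (rule that[OF sym])
qed

text \<open>
  Expand an element of the Specht module in the basis of all standard polytabloids. Subtracting it
  from its component at \<open>U\<close> gives components with sum zero, so all of them vanish.
\<close>

lemma specht_funs_eq_span: "specht_funs n U = cfun.span (std_polytab ` {w \<in> GG. descents n w = U})" if U: "U \<subseteq> {1..<n}"
proof
  show "cfun.span (std_polytab ` {w \<in> GG. descents n w = U}) \<subseteq> specht_funs n U"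
    unfolding specht_funs_def by (rule cfun.span_mono) auto
  show "specht_funs n U \<subseteq> cfun.span (std_polytab ` {w \<in> GG. descents n w = U})"
  proof
    fix x assume x: "x \<in> specht_funs n U"
    have "x v = 0" if "v \<notin> GG" for v using specht_funs_support[OF _ that] x specht_funs_subset_tabloid_funs by (meson subsetD)
    then obtain a where a: "(\<Sum>w\<in>GG. fscale (a w) (std_polytab w)) = x" by (rule std_polytab_expansion)
    define y where "y = (\<lambda>V. \<Sum>w\<in>{w \<in> GG. descents n w = V}. fscale (a w) (std_polytab w))"
    \<comment> \<open>The components of \<open>x - x\<close>: the basis expansion of \<open>x\<close> minus \<open>x\<close> itself, placed at \<open>U\<close>.\<close>
    define z where "z = (\<lambda>V. if V = U then y V - x else y V)"
    have zE: "z V \<in> specht_funs n V" for V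
      using specht_funs_span_sum[of a V] x cfun.span_diff unfolding z_def y_def specht_funs_def by auto
    have "(\<Sum>V\<in>Pow {1..<n}. z V) = (\<Sum>V\<in>Pow {1..<n}. y V) - (\<Sum>V\<in>Pow {1..<n}. if V = U then x else 0)"
      unfolding sum_subtractf[symmetric] z_def by (intro sum.cong refl) auto
    also have "\<dots> = 0" using U a unfolding y_def sum_by_descents by simp
    finally have "(\<lambda>v. \<Sum>V\<in>Pow {1..<n}. z V v) = 0" by (simp add: fun_eq_iff sum_fun_apply[symmetric])
    hence "z U = 0"
      using specht_funs_components_vanish[of n z "\<lambda>_. True" U] zE U col_antisym_zero[of _] by simp
    hence "x = y U" by (simp add: z_def)
    also have "\<dots> \<in> cfun.span (std_polytab ` {w \<in> GG. descents n w = U})"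
      unfolding y_def by (intro cfun.span_sum cfun.span_scale cfun.span_base) auto
    finally show "x \<in> cfun.span (std_polytab ` {w \<in> GG. descents n w = U})" .
  qed
qed

text \<open>
  The antisymmetrizers of the ribbons \<open>V\<close> that are not contained in \<open>U\<close> kill the space, so only
  standard polytabloids with \<open>descents w \<subseteq> U\<close> occur in the expansion of its elements.
\<close>

lemma tabloid_funs_eq_span: "tabloid_funs n U = cfun.span (std_polytab ` {w \<in> GG. descents n w \<subseteq> U})"
proof
  show "cfun.span (std_polytab ` {w \<in> GG. descents n w \<subseteq> U}) \<subseteq> tabloid_funs n U"
    by (rule cfun.span_minimal[OF _ subspace_tabloid_funs]) (use polytab_fun_tabloid_funs tabloid_funs_mono in blast)
  show "tabloid_funs n U \<subseteq> cfun.span (std_polytab ` {w \<in> GG. descents n w \<subseteq> U})"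
  proof
    fix x assume x: "x \<in> tabloid_funs n U"
    obtain a where a: "(\<Sum>w\<in>GG. fscale (a w) (std_polytab w)) = x" by (rule std_polytab_expansion[OF specht_funs_support[OF x]])
    have "a w = 0" if "w \<in> GG" "\<not> descents n w \<subseteq> U" for w
      by (rule std_polytab_components[OF a, where P = "\<lambda>V. \<not> V \<subseteq> U"]) (use that col_antisym_kills[OF x] in auto)
    hence "x = (\<Sum>w\<in>{w \<in> GG. descents n w \<subseteq> U}. fscale (a w) (std_polytab w))"
      unfolding a[symmetric] by (intro sum.mono_neutral_right) (use G_finite in \<open>auto simp: fscale_def\<close>)
    also have "\<dots> \<in> cfun.span (std_polytab ` {w \<in> GG. descents n w \<subseteq> U})"
      by (intro cfun.span_sum cfun.span_scale cfun.span_base) auto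
    finally show "x \<in> cfun.span (std_polytab ` {w \<in> GG. descents n w \<subseteq> U})" .
  qed
qed

text \<open>
  The group acts on the entries, that is, from the left; it commutes with row and column
  permutations.
\<close>

definition left_act :: "(nat \<Rightarrow> nat) \<Rightarrow> ((nat \<Rightarrow> nat) \<Rightarrow> complex) \<Rightarrow> (nat \<Rightarrow> nat) \<Rightarrow> complex" where
  "left_act \<pi> f = (\<lambda>v. f (inv' \<pi> \<circ> v))"

lemma left_act_linear: "flinear (left_act \<pi>)"
  by (rule flinearI) (auto simp: left_act_def fscale_def fun_eq_iff)

lemma left_act_polytab_fun:
  assumes \<pi>: "\<pi> \<in> GG" and w: "w \<in> GG"
  shows "left_act \<pi> (polytab_fun n U w) = polytab_fun n U (\<pi> \<circ> w)"
proof
  fix v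
  have iff: "inv' \<pi> \<circ> v \<in> GG \<longleftrightarrow> v \<in> GG"
    using G_comp[OF G_inv[OF \<pi>], of v] G_comp[OF \<pi>, of "inv' \<pi> \<circ> v"] by (auto simp: G_inv_cancel1[OF \<pi>])
  have "row_word n U (inv' \<pi> \<circ> v) = row_word n U (w \<circ> \<sigma>) \<longleftrightarrow> row_word n U v = row_word n U (\<pi> \<circ> w \<circ> \<sigma>)"
    if v: "v \<in> GG" and \<sigma>: "\<sigma> \<in> GG" for \<sigma>
  proof -
    have ws: "w \<circ> \<sigma> \<in> GG" and pws: "\<pi> \<circ> (w \<circ> \<sigma>) \<in> GG" using w \<sigma> \<pi> by (auto intro!: G_comp)
    have "inv' (\<pi> \<circ> (w \<circ> \<sigma>)) \<circ> v = inv' (w \<circ> \<sigma>) \<circ> (inv' \<pi> \<circ> v)"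
      unfolding G_inv_comp[OF \<pi> ws] by (simp only: comp_assoc)
    thus ?thesis
      using row_word_eq_iff[of "inv' \<pi> \<circ> v" n "w \<circ> \<sigma>" U] row_word_eq_iff[OF v pws, of U] ws v iff
      by (simp only: comp_assoc)
  qed
  thus "left_act \<pi> (polytab_fun n U w) v = polytab_fun n U (\<pi> \<circ> w) v"
    unfolding left_act_def polytab_fun_def by (intro sum.cong refl) (use iff col_perms_G in auto)
qed

lemma left_act_specht_funs:
  assumes \<pi>: "\<pi> \<in> GG" and x: "x \<in> specht_funs n U"
  shows "left_act \<pi> x \<in> specht_funs n U"
proof -
  interpret L: Vector_Spaces.linear fscale fscale "left_act \<pi>" by (rule left_act_linear)
  have "left_act \<pi> ` specht_funs n U = cfun.span (left_act \<pi> ` polytab_fun n U ` GG)" unfolding specht_funs_def L.span_image ..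
  also have "\<dots> \<subseteq> specht_funs n U" unfolding specht_funs_def
  proof (rule cfun.span_mono, intro image_subsetI)
    fix x assume "x \<in> polytab_fun n U ` GG"
    then obtain w where w: "w \<in> GG" "x = polytab_fun n U w" by blast
    show "left_act \<pi> x \<in> polytab_fun n U ` GG"
      unfolding w(2) left_act_polytab_fun[OF \<pi> w(1)] using G_comp[OF \<pi> w(1)] by (rule imageI)
  qed
  finally show ?thesis using x by blast
qed

text \<open>
  The standard polytabloids with \<open>descents w \<subseteq> U\<close> are grouped by their descent set.
\<close>

lemma trace_tabloid_funs_sum_specht_funs:
  assumes \<pi>: "\<pi> \<in> GG" and U: "U \<subseteq> {1..<n}"
  shows "trace_on (tabloid_funs n U) (left_act \<pi>) = (\<Sum>V\<in>Pow U. trace_on (specht_funs n V) (left_act \<pi>))"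
proof -
  let ?B = "\<lambda>V. std_polytab ` {w \<in> GG. descents n w = V}"
  have un: "(\<Union>V\<in>Pow U. ?B V) = std_polytab ` {w \<in> GG. descents n w \<subseteq> U}" by auto
  have sp: "specht_funs n V = cfun.span (?B V)" if "V \<in> Pow U" for V by (rule specht_funs_eq_span) (use that U in auto)
  have "trace_on (cfun.span (\<Union>V\<in>Pow U. ?B V)) (left_act \<pi>) = (\<Sum>V\<in>Pow U. trace_on (cfun.span (?B V)) (left_act \<pi>))"
  proof (rule trace_on_direct_sum)
    show "finite (Pow U)" using U finite_subset by auto
    show "finite (?B V)" for V using G_finite by simp
    show "disjoint_family_on ?B (Pow U)"
      unfolding disjoint_family_on_def using inj_onD[OF std_polytab_inj] by auto
    show "cfun.independent (\<Union>V\<in>Pow U. ?B V)"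
      unfolding un by (rule cfun.independent_mono[OF std_polytab_independent]) auto
    show "flinear (left_act \<pi>)" by (rule left_act_linear)
    show "left_act \<pi> v \<in> cfun.span (?B V)" if "V \<in> Pow U" "v \<in> cfun.span (?B V)" for V v
      using left_act_specht_funs[OF \<pi>, of v V] that sp[OF that(1)] by simp
  qed
  also have "\<dots> = (\<Sum>V\<in>Pow U. trace_on (specht_funs n V) (left_act \<pi>))" by (intro sum.cong refl) (simp only: sp)
  finally show ?thesis unfolding un tabloid_funs_eq_span .
qed

text \<open>
  The indicator functions of the tabloids are a basis that the group permutes as it permutes row
  words.
\<close>

lemma trace_tabloid_funs:
  assumes \<pi>: "\<pi> \<in> GG"
  shows "trace_on (tabloid_funs n U) (left_act \<pi>) = of_nat (card {f \<in> row_word n U ` GG. \<forall>y\<in>{1..n}. f (\<pi> y) = f y})"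
proof -
  let ?W = "row_word n U ` GG"
  let ?e = "\<lambda>i v. if v \<in> GG \<and> row_word n U v = i then 1 else (0 :: complex)"
  define p where "p = (\<lambda>i. SOME v. v \<in> GG \<and> row_word n U v = i)"
  have p: "p i \<in> GG" "row_word n U (p i) = i" if iW: "i \<in> ?W" for i
  proof -
    obtain v where v: "v \<in> GG" "row_word n U v = i" using iW by blast
    have "p i \<in> GG \<and> row_word n U (p i) = i" unfolding p_def by (rule someI[of _ v]) (use v in blast)
    thus "p i \<in> GG" "row_word n U (p i) = i" by auto
  qed
  have finW: "finite ?W" using G_finite by simp
  have dual: "?e i (p j) = (if i = j then 1 else 0)" if "i \<in> ?W" "j \<in> ?W" for i j
    using p[OF that(2)] by auto
  have eM: "?e i \<in> tabloid_funs n U" if "i \<in> ?W" for i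
    by (auto simp: tabloid_funs_def row_word_comp_row G_comp row_perms_G)
  have span: "cfun.span (?e ` ?W) = tabloid_funs n U"
  proof
    show "cfun.span (?e ` ?W) \<subseteq> tabloid_funs n U" by (rule cfun.span_minimal[OF _ subspace_tabloid_funs]) (use eM in blast)
    show "tabloid_funs n U \<subseteq> cfun.span (?e ` ?W)"
    proof
      fix f assume f: "f \<in> tabloid_funs n U"
      have "f = (\<Sum>i\<in>?W. fscale (f (p i)) (?e i))"
      proof
        fix v
        show "f v = (\<Sum>i\<in>?W. fscale (f (p i)) (?e i)) v"
        proof (cases "v \<in> GG")
          case True
          have "(\<Sum>i\<in>?W. fscale (f (p i)) (?e i)) v = (\<Sum>i\<in>?W. if i = row_word n U v then f (p i) else 0)"
            unfolding sum_fun_apply fscale_def by (intro sum.cong refl) (use True in auto)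
          also have "\<dots> = f (p (row_word n U v))" using True finW by simp
          also have "\<dots> = f v" by (rule tabloid_funs_row_word_cong[OF f p(1) True p(2)]) (use True in auto)
          finally show ?thesis ..
        next
          case False
          thus ?thesis using f by (simp add: tabloid_funs_def sum_fun_apply fscale_def)
        qed
      qed
      also have "\<dots> \<in> cfun.span (?e ` ?W)" by (intro cfun.span_sum cfun.span_scale cfun.span_base) auto
      finally show "f \<in> cfun.span (?e ` ?W)" .
    qed
  qed
  have le: "left_act \<pi> v \<in> tabloid_funs n U" if "v \<in> tabloid_funs n U" for v
  proof -
    have "left_act \<pi> v w = 0" if w: "w \<notin> GG" for w
    proof -
      have "inv' \<pi> \<circ> w \<notin> GG" using G_comp[OF \<pi>, of "inv' \<pi> \<circ> w"] w by (auto simp: G_inv_cancel1[OF \<pi>])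
      thus ?thesis using \<open>v \<in> tabloid_funs n U\<close> by (simp add: left_act_def tabloid_funs_def)
    qed
    moreover have "left_act \<pi> v (w \<circ> \<rho>) = left_act \<pi> v w" if "w \<in> GG" "\<rho> \<in> row_perms n U" for w \<rho>
      using \<open>v \<in> tabloid_funs n U\<close> that G_comp[OF G_inv[OF \<pi>] that(1)] unfolding left_act_def tabloid_funs_def comp_assoc[symmetric] by blast
    ultimately show ?thesis unfolding tabloid_funs_def by blast
  qed
  have inj: "inj_on ?e ?W" by (rule dual_points_inj[of ?W ?e p, OF finW dual])
  have ind: "cfun.independent (?e ` ?W)" by (rule dual_points_independent[of ?W ?e p, OF finW dual])
  have "trace_on (tabloid_funs n U) (left_act \<pi>) = (\<Sum>b\<in>?e ` ?W. cfun.representation (?e ` ?W) (left_act \<pi> b) b)"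
    by (rule trace_on_eq[OF ind _ span left_act_linear le]) (use finW in auto)
  also have "\<dots> = (\<Sum>i\<in>?W. cfun.representation (?e ` ?W) (left_act \<pi> (?e i)) (?e i))"
    unfolding sum.reindex[OF inj] comp_def ..
  also have "\<dots> = (\<Sum>i\<in>?W. left_act \<pi> (?e i) (p i))"
  proof (rule sum.cong[OF refl])
    fix i assume i: "i \<in> ?W"
    show "cfun.representation (?e ` ?W) (left_act \<pi> (?e i)) (?e i) = left_act \<pi> (?e i) (p i)"
      by (rule dual_points_representation[of ?W ?e p, OF finW dual _ i]) (use le[OF eM[OF i]] span in auto)
  qed
  also have "\<dots> = (\<Sum>i\<in>?W. if \<forall>y\<in>{1..n}. i (\<pi> y) = i y then 1 else 0)"
  proof (rule sum.cong[OF refl])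
    fix i assume i: "i \<in> ?W"
    have q: "inv' \<pi> \<circ> p i \<in> GG" using p[OF i] \<pi> by (intro G_comp G_inv) auto
    have "row_word n U (inv' \<pi> \<circ> p i) y = i (\<pi> y)" if y: "y \<in> {1..n}" for y
    proof -
      have "inv' (inv' \<pi> \<circ> p i) = inv' (p i) \<circ> inv' (inv' \<pi>)" by (rule G_inv_comp[OF G_inv[OF \<pi>] p(1)[OF i]])
      also have "inv' (inv' \<pi>) = \<pi>" using \<pi> by (simp add: G_def permutes_inv_inv)
      finally have inv: "inv' (inv' \<pi> \<circ> p i) = inv' (p i) \<circ> \<pi>" .
      have "row_word n U (inv' \<pi> \<circ> p i) y = box_row n U (inv' (p i) (\<pi> y))"
        unfolding row_word_def inv restrict_apply comp_apply using y by (simp only: if_True)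
      also have "\<dots> = row_word n U (p i) (\<pi> y)"
        using G_in[OF \<pi>, of y] y by (simp only: row_word_def restrict_apply if_True comp_apply)
      finally show ?thesis unfolding p(2)[OF i] .
    qed
    moreover have "row_word n U (inv' \<pi> \<circ> p i) = i \<longleftrightarrow> (\<forall>y\<in>{1..n}. row_word n U (inv' \<pi> \<circ> p i) y = i y)"
    proof
      assume E: "row_word n U (inv' \<pi> \<circ> p i) = i"
      show "\<forall>y\<in>{1..n}. row_word n U (inv' \<pi> \<circ> p i) y = i y" by (rule ballI, rule fun_cong[OF E])
    next
      assume A: "\<forall>y\<in>{1..n}. row_word n U (inv' \<pi> \<circ> p i) y = i y"
      have ext: "row_word n U v \<in> extensional {1..n}" for v by (simp add: row_word_def)
      obtain v where "i = row_word n U v" using i by (rule imageE)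
      hence "i \<in> extensional {1..n}" using ext[of v] by (simp only:)
      with ext show "row_word n U (inv' \<pi> \<circ> p i) = i" by (rule extensionalityI) (rule bspec[OF A])
    qed
    ultimately show "left_act \<pi> (?e i) (p i) = (if \<forall>y\<in>{1..n}. i (\<pi> y) = i y then 1 else 0)"
      using q by (simp add: left_act_def)
  qed
  also have "\<dots> = of_nat (card {f \<in> ?W. \<forall>y\<in>{1..n}. f (\<pi> y) = f y})"
    using finW by (simp add: sum.If_cases Int_def)
  finally show ?thesis .
qed

end

section \<open>Surjective words as row words of ribbons\<close>

lemma box_row_Suc: "j \<in> {1..<n} \<Longrightarrow> box_row n U j = box_row n U (Suc j) + (if j \<in> U then 1 else 0)"
proof -
  assume j: "j \<in> {1..<n}"
  have "U \<inter> {j..n} = (if j \<in> U then insert j (U \<inter> {Suc j..n}) else U \<inter> {Suc j..n})"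
    using j by (auto simp: not_less_eq_eq Suc_le_eq le_less)
  thus ?thesis by (simp add: box_row_def)
qed

lemma box_row_last: "U \<subseteq> {1..<n} \<Longrightarrow> box_row n U n = 0"
proof -
  assume "U \<subseteq> {1..<n}"
  hence "U \<inter> {n..n} = {}" by auto
  thus ?thesis by (simp add: box_row_def)
qed

lemma box_row_first: "U \<subseteq> {1..<n} \<Longrightarrow> box_row n U 1 = card U"
proof -
  assume "U \<subseteq> {1..<n}"
  hence "U \<inter> {1..n} = U" by auto
  thus ?thesis by (simp add: box_row_def)
qed

lemma down_induct [consumes 1, case_names last step]:
  fixes n :: nat
  assumes j: "j \<in> {1..n}" and l: "P n" and s: "\<And>j. j \<in> {1..<n} \<Longrightarrow> P (Suc j) \<Longrightarrow> P j"
  shows "P j"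
proof -
  have "j \<in> {1..n} \<longrightarrow> P j"
  proof (induction "n - j" arbitrary: j)
    case 0
    thus ?case using l by auto
  next
    case (Suc d)
    show ?case
    proof
      assume "j \<in> {1..n}"
      hence "j \<in> {1..<n}" "d = n - Suc j" "Suc j \<in> {1..n}" using Suc.hyps(2) by auto
      thus "P j" using Suc.hyps(1)[of "Suc j"] s by blast
    qed
  qed
  thus ?thesis using j by blast
qed

lemma box_row_image:
  assumes U: "U \<subseteq> {1..<n}" and n: "n \<ge> 1"
  shows "box_row n U ` {1..n} = {..<card U + 1}"
proof
  show "box_row n U ` {1..n} \<subseteq> {..<card U + 1}"
  proof (rule image_subsetI)
    fix j assume "j \<in> {1..n}"
    hence "box_row n U j \<le> box_row n U 1" by (intro row_antimono) simp
    thus "box_row n U j \<in> {..<card U + 1}" using box_row_first[OF U] by simp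
  qed
  have "{..box_row n U j} \<subseteq> box_row n U ` {j..n}" if "j \<in> {1..n}" for j
    using that
  proof (induction rule: down_induct)
    case last
    thus ?case using box_row_last[OF U] by simp
  next
    case (step j)
    have "{..box_row n U j} \<subseteq> insert (box_row n U j) {..box_row n U (Suc j)}"
      using box_row_Suc[OF step(1), of U] by (auto split: if_splits)
    also have "\<dots> \<subseteq> insert (box_row n U j) (box_row n U ` {Suc j..n})" using step(2) by blast
    also have "\<dots> = box_row n U ` insert j {Suc j..n}" by simp
    also have "insert j {Suc j..n} = {j..n}" using step(1) by auto
    finally show ?case .
  qed
  from this[of 1] show "{..<card U + 1} \<subseteq> box_row n U ` {1..n}"
    using box_row_first[OF U] n by (simp add: lessThan_Suc_atMost)
qed

lemma row_word_extensional: "row_word n U w \<in> extensional {1..n}"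
  by (simp add: row_word_def)

lemma row_word_image:
  assumes U: "U \<subseteq> {1..<n}" and n: "n \<ge> 1" and w: "w \<in> G n"
  shows "row_word n U w ` {1..n} = {..<card U + 1}"
proof -
  have "row_word n U w ` {1..n} = (box_row n U \<circ> inv' w) ` {1..n}" unfolding row_word_def by (rule image_cong) auto
  also have "\<dots> = box_row n U ` {1..n}"
    unfolding image_comp[symmetric] permutes_image[OF permutes_inv[OF w[unfolded G_def mem_Collect_eq]]] ..
  finally show ?thesis using box_row_image[OF U n] by simp
qed

lemma box_row_determines:
  assumes U: "U \<subseteq> {1..<n}" and U': "U' \<subseteq> {1..<n}" and eq: "\<And>j. j \<in> {1..n} \<Longrightarrow> box_row n U j = box_row n U' j"
  shows "U = U'"
proof -
  have "j \<in> U \<longleftrightarrow> j \<in> U'" if j: "j \<in> {1..<n}" for j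
  proof -
    have 1: "box_row n U j = box_row n U' j" by (rule eq) (use j in simp)
    have 2: "box_row n U (Suc j) = box_row n U' (Suc j)" by (rule eq) (use j in simp)
    show ?thesis using box_row_Suc[OF j, of U] box_row_Suc[OF j, of U'] unfolding 1 2 by (simp split: if_splits)
  qed
  thus ?thesis using U U' by blast
qed

text \<open>
  The multiset of letters gives the length of each row, hence the ribbon.
\<close>

lemma row_word_determines:
  assumes U: "U \<subseteq> {1..<n}" and U': "U' \<subseteq> {1..<n}" and w: "w \<in> G n" and w': "w' \<in> G n"
    and eq: "row_word n U w = row_word n U' w'"
  shows "U = U'"
proof (rule box_row_determines[OF U U'])
  fix j assume j: "j \<in> {1..n}"
  \<comment> \<open>Boxes in row \<open>r\<close> or below form an initial segment, so their number determines them.\<close>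
  let ?S = "\<lambda>U r. {j \<in> {1..n}. r \<le> box_row n U j}"
  have card: "card (?S V r) = card {y \<in> {1..n}. r \<le> row_word n V v y}" if v: "v \<in> G n" for V v r
  proof -
    have img: "v ` ?S V r = {y \<in> {1..n}. r \<le> row_word n V v y}"
    proof (intro equalityI subsetI)
      fix y assume "y \<in> v ` ?S V r"
      then obtain i where i: "i \<in> {1..n}" "r \<le> box_row n V i" "y = v i" by blast
      have "v i \<in> {1..n}" using G_in[OF v] i(1) by blast
      thus "y \<in> {y \<in> {1..n}. r \<le> row_word n V v y}" using i by (simp add: row_word_def G_inv2[OF v])
    next
      fix y assume y: "y \<in> {y \<in> {1..n}. r \<le> row_word n V v y}"
      hence y1: "y \<in> {1..n}" and "r \<le> row_word n V v y" by simp_all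
      moreover have "row_word n V v y = box_row n V (inv' v y)" using y1 by (simp only: row_word_def restrict_apply if_True comp_apply)
      moreover have "inv' v y \<in> {1..n}" using G_in[OF G_inv[OF v], of y] y1 by blast
      ultimately have "inv' v y \<in> ?S V r" by simp
      moreover have "y = v (inv' v y)" using G_inv1[OF v] by simp
      ultimately show "y \<in> v ` ?S V r" by blast
    qed
    have "inj_on v (?S V r)" using G_inj[OF v] by (auto simp: inj_on_def)
    from card_image[OF this] show ?thesis unfolding img by (rule sym)
  qed
  have cardeq: "card (?S U r) = card (?S U' r)" for r
    unfolding card[OF w, where V = U] card[OF w', where V = U'] eq ..
  have down: "?S U r \<subseteq> ?S U' r \<or> ?S U' r \<subseteq> ?S U r" for r
  proof (rule ccontr)
    assume "\<not> (?S U r \<subseteq> ?S U' r \<or> ?S U' r \<subseteq> ?S U r)"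
    then obtain a b where a: "a \<in> ?S U r" "a \<notin> ?S U' r" and b: "b \<in> ?S U' r" "b \<notin> ?S U r" by blast
    show False
      using a b row_antimono[of a b n U'] row_antimono[of b a n U] by (cases "a \<le> b") auto
  qed
  have "?S U r = ?S U' r" for r
    using down[of r]
  proof
    assume "?S U r \<subseteq> ?S U' r"
    from card_subset_eq[OF _ this cardeq] show ?thesis by simp
  next
    assume "?S U' r \<subseteq> ?S U r"
    from card_subset_eq[OF _ this cardeq[symmetric]] show ?thesis by simp
  qed
  hence iff: "r \<le> box_row n U j \<longleftrightarrow> r \<le> box_row n U' j" for r using j by blast
  show "box_row n U j = box_row n U' j" using iff[of "box_row n U j"] iff[of "box_row n U' j"] by simp
qed

text \<open>
  Sorting a list of keys, expressed by a permutation of the positions.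
\<close>

lemma ex_sorting_permutation:
  fixes key :: "nat \<Rightarrow> nat"
  obtains w where "w \<in> G n" "\<And>i j. i \<in> {1..n} \<Longrightarrow> j \<in> {1..n} \<Longrightarrow> i \<le> j \<Longrightarrow> key (w i) \<le> key (w j)"
proof -
  define xs where "xs = sort_key key [1..<Suc n]"
  have xs: "distinct xs" "set xs = {1..n}" "length xs = n" "sorted (map key xs)"
    unfolding xs_def by auto
  define w where "w = (\<lambda>j. if j \<in> {1..n} then xs ! (j - 1) else j)"
  have nth: "bij_betw ((!) xs) {..<n} {1..n}" using bij_betw_nth[OF xs(1) refl xs(2)[symmetric]] xs(3) by simp
  have pred: "bij_betw (\<lambda>j. j - 1) {1..n} {..<n}"
    by (rule bij_betwI[where g = Suc]) auto
  have "bij_betw ((!) xs \<circ> (\<lambda>j. j - 1)) {1..n} {1..n}" by (rule bij_betw_trans[OF pred nth])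
  moreover have "bij_betw w {1..n} {1..n} = bij_betw ((!) xs \<circ> (\<lambda>j. j - 1)) {1..n} {1..n}"
    by (rule bij_betw_cong) (simp add: w_def)
  ultimately have "w permutes {1..n}" by (intro bij_imp_permutes) (auto simp: w_def)
  moreover have "key (w i) \<le> key (w j)" if "i \<in> {1..n}" "j \<in> {1..n}" "i \<le> j" for i j
    using sorted_nth_mono[OF xs(4), of "i - 1" "j - 1"] that xs(3) by (simp add: w_def)
  ultimately show ?thesis using that by (simp add: G_def)
qed

text \<open>
  Fill the ribbon with the positions of the letters, largest letter first: it has an up-step where
  the letter drops.
\<close>

lemma surjection_is_row_word:
  assumes f: "f \<in> extensional {1..n}" "f ` {1..n} = {..<k}" and n: "n \<ge> 1"
  obtains U w where "U \<subseteq> {1..<n}" "card U + 1 = k" "w \<in> G n" "f = row_word n U w"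
proof -
  obtain w where w: "w \<in> G n" and mono: "\<And>i j. i \<in> {1..n} \<Longrightarrow> j \<in> {1..n} \<Longrightarrow> i \<le> j \<Longrightarrow> k - f (w i) \<le> k - f (w j)"
    using ex_sorting_permutation[of n "\<lambda>x. k - f x"] by blast
  have wn: "w i \<in> {1..n}" if "i \<in> {1..n}" for i using G_in[OF w] that by blast
  have fk: "f (w i) < k" if "i \<in> {1..n}" for i using f(2) wn[OF that] by blast
  have anti: "f (w j) \<le> f (w i)" if "i \<in> {1..n}" "j \<in> {1..n}" "i \<le> j" for i j
    using mono[OF that] fk[OF that(1)] fk[OF that(2)] by simp
  have surj: "\<exists>i\<in>{1..n}. f (w i) = v" if "v < k" for v
  proof -
    obtain y where y: "y \<in> {1..n}" "f y = v" using f(2) \<open>v < k\<close> by (metis imageE lessThan_iff)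
    have "inv' w y \<in> {1..n}" using G_in[OF G_inv[OF w]] y(1) by blast
    thus ?thesis using y(2) G_inv1[OF w, of y] by metis
  qed
  define U where "U = {j \<in> {1..<n}. f (w j) \<noteq> f (w (Suc j))}"
  have U: "U \<subseteq> {1..<n}" by (auto simp: U_def)
  have row: "f (w j) = box_row n U j" if "j \<in> {1..n}" for j
    using that
  proof (induction rule: down_induct)
    case last
    have "0 < k" using fk[of 1] n by simp
    then obtain i where "i \<in> {1..n}" "f (w i) = 0" using surj by blast
    hence "f (w n) = 0" using anti[of i n] n by simp
    thus ?case using box_row_last[OF U] by simp
  next
    case (step j)
    have j: "j \<in> {1..n}" "Suc j \<in> {1..n}" using step(1) by auto
    have ge: "f (w (Suc j)) \<le> f (w j)" using anti[OF j] by simp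
    have le: "f (w j) \<le> Suc (f (w (Suc j)))"
    proof (rule ccontr)
      assume *: "\<not> ?thesis"
      hence "Suc (f (w (Suc j))) < k" using fk[OF j(1)] by simp
      then obtain i where i: "i \<in> {1..n}" "f (w i) = Suc (f (w (Suc j)))" using surj by blast
      show False
      proof (cases "i \<le> j")
        case True
        thus False using anti[OF i(1) j(1)] i(2) * by simp
      next
        case False
        thus False using anti[OF j(2) i(1)] i(2) by simp
      qed
    qed
    have "j \<in> U \<longleftrightarrow> f (w j) \<noteq> f (w (Suc j))" using step(1) by (simp add: U_def)
    thus ?case using box_row_Suc[OF step(1), of U] step(2) ge le by auto
  qed
  have eq: "f = row_word n U w"
  proof (rule extensionalityI[OF f(1) row_word_extensional])
    fix y assume y: "y \<in> {1..n}"
    hence "inv' w y \<in> {1..n}" using G_in[OF G_inv[OF w]] by blast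
    hence "f (w (inv' w y)) = box_row n U (inv' w y)" by (rule row)
    thus "f y = row_word n U w y" using y by (simp add: row_word_def G_inv1[OF w])
  qed
  have "{..<k} = {..<card U + 1}" using row_word_image[OF U n w] f(2) eq by simp
  hence "card U + 1 = k" by (metis lessThan_eq_iff)
  thus ?thesis using that U w eq by blast
qed

lemma surj_count_trace:
  assumes n: "n \<ge> 1" and k: "k \<ge> 1" and \<pi>: "\<pi> \<in> G n"
  shows "of_nat (surj_count n k \<pi>) = (\<Sum>U | U \<subseteq> {1..<n} \<and> card U = k - 1. trace_on (tabloid_funs n U) (left_act \<pi>))"
proof -
  let ?N = "{U. U \<subseteq> {1..<n} \<and> card U = k - 1}"
  let ?F = "\<lambda>U. {f \<in> row_word n U ` G n. \<forall>y\<in>{1..n}. f (\<pi> y) = f y}"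
  have finN: "finite ?N" by (rule finite_subset[of _ "Pow {1..<n}"]) auto
  have "words_onto n {..<k} \<pi> = (\<Union>U\<in>?N. ?F U)"
  proof (intro equalityI subsetI)
    fix f assume f: "f \<in> words_onto n {..<k} \<pi>"
    hence "f \<in> extensional {1..n}" "f ` {1..n} = {..<k}" by (auto simp: words_onto_def)
    then obtain U w where "U \<subseteq> {1..<n}" "card U + 1 = k" "w \<in> G n" "f = row_word n U w"
      using surjection_is_row_word[OF _ _ n] by blast
    moreover have "\<forall>y\<in>{1..n}. f (\<pi> y) = f y" using f by (auto simp: words_onto_def)
    ultimately show "f \<in> (\<Union>U\<in>?N. ?F U)" by auto
  next
    fix f assume "f \<in> (\<Union>U\<in>?N. ?F U)"
    then obtain U w where U: "U \<subseteq> {1..<n}" "card U = k - 1" "w \<in> G n" "f = row_word n U w"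
      "\<forall>y\<in>{1..n}. f (\<pi> y) = f y" by blast
    have "f ` {1..n} = {..<k}" using row_word_image[OF U(1) n U(3)] U(2,4) k by simp
    thus "f \<in> words_onto n {..<k} \<pi>" using U row_word_extensional by (simp add: words_onto_def)
  qed
  hence "surj_count n k \<pi> = card (\<Union>U\<in>?N. ?F U)" by (simp add: surj_count_def)
  also have "\<dots> = (\<Sum>U\<in>?N. card (?F U))"
  proof (rule card_UN_disjoint[OF finN])
    show "\<forall>U\<in>?N. finite (?F U)" using G_finite by simp
    show "\<forall>U\<in>?N. \<forall>V\<in>?N. U \<noteq> V \<longrightarrow> ?F U \<inter> ?F V = {}"
    proof (intro ballI impI)
      fix U V assume *: "U \<in> ?N" "V \<in> ?N" "U \<noteq> V"
      show "?F U \<inter> ?F V = {}"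
      proof (rule ccontr)
        assume "?F U \<inter> ?F V \<noteq> {}"
        then obtain w w' where "w \<in> G n" "w' \<in> G n" "row_word n U w = row_word n V w'" by auto
        thus False using row_word_determines[of U n V w w'] * by simp
      qed
    qed
  qed
  finally show ?thesis using trace_tabloid_funs[OF \<pi>] by simp
qed

text \<open>
  A ribbon \<open>V\<close> occurs in the tabloid functions of each \<open>U\<close> that contains it, and the number of such
  \<open>U\<close> with \<open>k - 1\<close> elements is a binomial coefficient.
\<close>

lemma surj_count_ribbon_traces:
  assumes n: "n \<ge> 1" and k: "k \<ge> 1" "k \<le> n" and \<pi>: "\<pi> \<in> G n"
  shows "of_nat (surj_count n k \<pi>) = (\<Sum>i<n. of_nat (if i < k then (n - 1 - i) choose (k - 1 - i) else 0) *
    (\<Sum>V | V \<subseteq> {1..<n} \<and> card V = i. trace_on (specht_funs n V) (left_act \<pi>)))"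
proof -
  let ?A = "{U. U \<subseteq> {1..<n} \<and> card U = k - 1}" and ?P = "Pow {1..<n}"
  let ?t = "\<lambda>V. trace_on (specht_funs n V) (left_act \<pi>)"
  let ?c = "\<lambda>i. if i < k then (n - 1 - i) choose (k - 1 - i) else 0"
  have finA: "finite ?A" by (rule finite_subset[of _ ?P]) auto
  have count: "card {U \<in> ?A. V \<subseteq> U} = ?c (card V)" if V: "V \<in> ?P" for V
  proof -
    have finV: "finite V" using V finite_subset by auto
    have cV: "card V \<le> n - 1" using card_mono[of "{1..<n}" V] V by simp
    show ?thesis
    proof (cases "card V < k")
      case True
      let ?B = "{W. W \<subseteq> {1..<n} - V \<and> card W = k - 1 - card V}"
      have "bij_betw (\<lambda>W. V \<union> W) ?B {U \<in> ?A. V \<subseteq> U}"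
      proof (rule bij_betwI[where g = "\<lambda>U. U - V"])
        show "(\<lambda>W. V \<union> W) \<in> ?B \<rightarrow> {U \<in> ?A. V \<subseteq> U}"
        proof
          fix W assume W: "W \<in> ?B"
          hence "finite W" using finite_subset[of W "{1..<n} - V"] by auto
          hence "card (V \<union> W) = card V + card W" using finV W by (intro card_Un_disjoint) auto
          thus "V \<union> W \<in> {U \<in> ?A. V \<subseteq> U}" using W V True by auto
        qed
        show "(\<lambda>U. U - V) \<in> {U \<in> ?A. V \<subseteq> U} \<rightarrow> ?B"
          using finV by (auto simp: card_Diff_subset)
      qed auto
      hence "card {U \<in> ?A. V \<subseteq> U} = card ?B" by (simp add: bij_betw_same_card)
      also have "\<dots> = card ({1..<n} - V) choose (k - 1 - card V)" by (rule n_subsets) simp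
      also have "card ({1..<n} - V) = n - 1 - card V" using V finV by (simp add: card_Diff_subset)
      finally show ?thesis using True by simp
    next
      case False
      have "\<not> V \<subseteq> U" if "U \<in> ?A" for U
      proof
        assume "V \<subseteq> U"
        moreover have "finite U" using that finite_subset by auto
        ultimately have "card V \<le> k - 1" using card_mono[of U V] that by simp
        thus False using False k by simp
      qed
      hence "{U \<in> ?A. V \<subseteq> U} = {}" by blast
      thus ?thesis using False by simp
    qed
  qed
  have "of_nat (surj_count n k \<pi>) = (\<Sum>U\<in>?A. \<Sum>V\<in>Pow U. ?t V)"
    unfolding surj_count_trace[OF n k(1) \<pi>] by (intro sum.cong refl trace_tabloid_funs_sum_specht_funs[OF \<pi>]) auto
  also have "\<dots> = (\<Sum>U\<in>?A. \<Sum>V\<in>?P. if V \<subseteq> U then ?t V else 0)"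
  proof (rule sum.cong[OF refl])
    fix U assume "U \<in> ?A"
    hence eq: "Pow U = {V \<in> ?P. V \<subseteq> U}" by auto
    show "(\<Sum>V\<in>Pow U. ?t V) = (\<Sum>V\<in>?P. if V \<subseteq> U then ?t V else 0)"
      unfolding eq by (rule sum.inter_filter) simp
  qed
  also have "\<dots> = (\<Sum>V\<in>?P. \<Sum>U\<in>?A. if V \<subseteq> U then ?t V else 0)" by (rule sum.swap)
  also have "\<dots> = (\<Sum>V\<in>?P. of_nat (?c (card V)) * ?t V)"
  proof (rule sum.cong[OF refl])
    fix V assume V: "V \<in> ?P"
    have "(\<Sum>U\<in>?A. if V \<subseteq> U then ?t V else 0) = (\<Sum>U\<in>{U \<in> ?A. V \<subseteq> U}. ?t V)"
      by (rule sum.inter_filter[OF finA, symmetric])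
    also have "\<dots> = of_nat (card {U \<in> ?A. V \<subseteq> U}) * ?t V" by simp
    finally show "(\<Sum>U\<in>?A. if V \<subseteq> U then ?t V else 0) = of_nat (?c (card V)) * ?t V" unfolding count[OF V] .
  qed
  also have "\<dots> = (\<Sum>i<n. \<Sum>V\<in>{V \<in> ?P. card V = i}. of_nat (?c (card V)) * ?t V)"
  proof (rule sum.group[symmetric])
    have "card V < n" if "V \<in> ?P" for V
    proof -
      have "card V \<le> card {1..<n}" using that by (intro card_mono) auto
      thus ?thesis using n by simp
    qed
    thus "card ` ?P \<subseteq> {..<n}" by blast
  qed simp_all
  also have "\<dots> = (\<Sum>i<n. of_nat (?c i) * (\<Sum>V\<in>{V \<in> ?P. card V = i}. ?t V))"
    unfolding sum_distrib_left by (intro sum.cong refl) simp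
  finally show ?thesis by (simp only: Pow_iff)
qed

section \<open>Border shapes\<close>

text \<open>
  The \<open>j - 1\<close> steps before box \<open>j\<close> are up-steps or steps to the right.
\<close>

lemma row_col_identity:
  assumes U: "U \<subseteq> {1..<n}" and j: "j \<in> {1..n}"
  shows "box_row n U j + j = card U + 1 + box_col U j"
proof -
  have finU: "finite U" using U finite_subset by auto
  have "{1..<j} = ({1..<j} \<inter> U) \<union> ({1..<j} - U)" by auto
  moreover have "card (({1..<j} \<inter> U) \<union> ({1..<j} - U)) = card ({1..<j} \<inter> U) + card ({1..<j} - U)"
    by (rule card_Un_disjoint) auto
  ultimately have 1: "card {1..<j} = card ({1..<j} \<inter> U) + box_col U j" by (simp add: box_col_def)
  have "U = ({1..<j} \<inter> U) \<union> (U \<inter> {j..n})" using U by auto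
  moreover have "card (({1..<j} \<inter> U) \<union> (U \<inter> {j..n})) = card ({1..<j} \<inter> U) + card (U \<inter> {j..n})"
    by (rule card_Un_disjoint) auto
  ultimately have "card U = card ({1..<j} \<inter> U) + box_row n U j" by (simp add: box_row_def)
  moreover have "card {1..<j} + 1 = j" using j by simp
  ultimately show ?thesis using 1 by linarith
qed

lemma box_col_mono: "i \<le> j \<Longrightarrow> box_col U i \<le> box_col U j"
  unfolding box_col_def by (rule card_mono) auto

definition ribbon_box :: "nat \<Rightarrow> nat set \<Rightarrow> nat \<Rightarrow> box" where
  "ribbon_box n U j = (box_row n U j, box_col U j)"

definition ribbon :: "nat \<Rightarrow> nat set \<Rightarrow> box set" where
  "ribbon n U = ribbon_box n U ` {1..n}"

lemma ribbon_box_inj: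
  assumes U: "U \<subseteq> {1..<n}"
  shows "inj_on (ribbon_box n U) {1..n}"
proof (rule inj_onI)
  fix i j assume "i \<in> {1..n}" "j \<in> {1..n}" "ribbon_box n U i = ribbon_box n U j"
  thus "i = j" using row_col_identity[OF U, of i] row_col_identity[OF U, of j] by (simp add: ribbon_box_def)
qed

text \<open>
  If one box of the ribbon lies weakly northwest of another one, both lie in one row or in one
  column, and the ribbon contains the boxes between them.
\<close>

lemma ribbon_convex:
  assumes U: "U \<subseteq> {1..<n}" and i: "i \<in> {1..n}" and j: "j \<in> {1..n}"
    and r: "box_row n U i \<le> r" "r \<le> box_row n U j" and c: "box_col U i \<le> c" "c \<le> box_col U j"
  shows "(r, c) \<in> ribbon n U"
proof -
  note id = row_col_identity[OF U]
  show ?thesis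
  proof (cases "i \<le> j")
    case True
    hence row: "box_row n U j = box_row n U i" "r = box_row n U i" using row_antimono[OF True, of n U] r by auto
    define m where "m = i + (c - box_col U i)"
    have m: "i \<le> m" "m \<le> j" "m \<in> {1..n}"
      using id[OF i] id[OF j] row(1) c i j by (auto simp: m_def)
    have "box_row n U m = r" using row_antimono[OF m(1), of n U] row_antimono[OF m(2), of n U] row by simp
    moreover have "box_col U m = c" using id[OF m(3)] id[OF i] calculation row(2) c(1) by (simp add: m_def)
    ultimately show ?thesis using m(3) by (force simp: ribbon_def ribbon_box_def)
  next
    case False
    hence le: "j \<le> i" by simp
    hence col: "box_col U j = box_col U i" "c = box_col U i" using box_col_mono[OF le, of U] c by auto
    define m where "m = i - (r - box_row n U i)"
    have m: "j \<le> m" "m \<le> i" "m \<in> {1..n}"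
      using id[OF i] id[OF j] col(1) r i j by (auto simp: m_def)
    have cm: "box_col U m = c" using box_col_mono[OF m(1), of U] box_col_mono[OF m(2), of U] col by simp
    have "m + (r - box_row n U i) = i" using id[OF i] id[OF j] col(1) r i j by (simp add: m_def)
    hence "box_row n U m = r" using id[OF m(3)] id[OF i] cm col(2) r(1) by simp
    thus ?thesis using m(3) cm by (force simp: ribbon_def ribbon_box_def)
  qed
qed

text \<open>
  The shape is the set of boxes weakly above and to the left of some box of the ribbon, without
  those that are not in the ribbon.
\<close>

lemma ribbon_skew_shape:
  assumes U: "U \<subseteq> {1..<n}"
  shows "skew_shape (ribbon n U)"
proof -
  let ?\<beta> = "ribbon n U"
  define L where "L = {(r, c). \<exists>j\<in>{1..n}. r \<le> box_row n U j \<and> c \<le> box_col U j}"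
  have sub: "?\<beta> \<subseteq> L" by (auto simp: ribbon_def ribbon_box_def L_def)
  have "L \<subseteq> (\<Union>j\<in>{1..n}. {..box_row n U j} \<times> {..box_col U j})" by (auto simp: L_def)
  hence finL: "finite L" by (rule finite_subset) auto
  have L: "young_diagram L"
    unfolding young_diagram_def
  proof (intro conjI allI impI finL)
    fix r c r' c' assume "(r, c) \<in> L \<and> r' \<le> r \<and> c' \<le> c"
    thus "(r', c') \<in> L" unfolding L_def by (auto intro: le_trans)
  qed
  have M: "young_diagram (L - ?\<beta>)"
    unfolding young_diagram_def
  proof (intro conjI allI impI)
    show "finite (L - ?\<beta>)" using finL by simp
    fix r c r' c' assume *: "(r, c) \<in> L - ?\<beta> \<and> r' \<le> r \<and> c' \<le> c"
    then obtain j where j: "j \<in> {1..n}" "r \<le> box_row n U j" "c \<le> box_col U j" by (auto simp: L_def)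
    have "(r', c') \<notin> ?\<beta>"
    proof
      assume "(r', c') \<in> ?\<beta>"
      then obtain i where i: "i \<in> {1..n}" "r' = box_row n U i" "c' = box_col U i" by (auto simp: ribbon_def ribbon_box_def)
      have "(r, c) \<in> ?\<beta>" by (rule ribbon_convex[OF U i(1) j(1)]) (use * i j in auto)
      thus False using * by blast
    qed
    moreover have "(r', c') \<in> L" using L * unfolding young_diagram_def by blast
    ultimately show "(r', c') \<in> L - ?\<beta>" by blast
  qed
  have "?\<beta> = L - (L - ?\<beta>)" using sub by blast
  thus ?thesis unfolding skew_shape_def using L M by blast
qed

lemma ribbon_connected:
  assumes U: "U \<subseteq> {1..<n}"
  shows "connected_shape (ribbon n U)"
proof -
  let ?\<beta> = "ribbon n U" and ?b = "ribbon_box n U"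
  let ?E = "{(x, y). x \<in> ?\<beta> \<and> y \<in> ?\<beta> \<and> adjacent x y}"
  have symE: "sym ?E" by (auto simp: sym_def adjacent_def)
  have reach: "(?b n, ?b j) \<in> ?E\<^sup>*" if "j \<in> {1..n}" for j
    using that
  proof (induction rule: down_induct)
    case last
    show ?case by simp
  next
    case (step j)
    have j: "j \<in> {1..n}" "Suc j \<in> {1..n}" using step(1) by auto
    have "adjacent (?b (Suc j)) (?b j)"
      using box_row_Suc[OF step(1), of U] row_col_identity[OF U j(1)] row_col_identity[OF U j(2)]
      by (auto simp: adjacent_def ribbon_box_def split: if_splits)
    hence "(?b (Suc j), ?b j) \<in> ?E" using j by (auto simp: ribbon_def)
    with step(2) show ?case by (rule rtrancl_into_rtrancl)
  qed
  show ?thesis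
    unfolding connected_shape_def
  proof (intro ballI)
    fix a b assume "a \<in> ?\<beta>" "b \<in> ?\<beta>"
    then obtain i j where "i \<in> {1..n}" "a = ?b i" "j \<in> {1..n}" "b = ?b j" by (auto simp: ribbon_def)
    hence "(?b n, a) \<in> ?E\<^sup>*" "(?b n, b) \<in> ?E\<^sup>*" using reach by auto
    moreover have "sym (?E\<^sup>*)" by (rule sym_rtrancl[OF symE])
    ultimately show "(a, b) \<in> ?E\<^sup>*" by (meson rtrancl_trans symD)
  qed
qed

lemma ribbon_fst_image:
  assumes U: "U \<subseteq> {1..<n}" and n: "n \<ge> 1"
  shows "fst ` ribbon n U = {..<card U + 1}"
  using box_row_image[OF U n] by (simp add: ribbon_def image_image ribbon_box_def)

lemma ribbon_border_shapes:
  assumes U: "U \<subseteq> {1..<n}" and n: "n \<ge> 1"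
  shows "ribbon n U \<in> border_shapes n (card U + 1)"
proof -
  let ?\<beta> = "ribbon n U"
  have "\<not> {(r, c), (r, Suc c), (Suc r, c), (Suc r, Suc c)} \<subseteq> ?\<beta>" for r c
  proof
    assume "{(r, c), (r, Suc c), (Suc r, c), (Suc r, Suc c)} \<subseteq> ?\<beta>"
    hence "(r, c) \<in> ?\<beta>" "(Suc r, Suc c) \<in> ?\<beta>" by auto
    then obtain i j where i: "i \<in> {1..n}" "box_row n U i = r" "box_col U i = c"
      and j: "j \<in> {1..n}" "box_row n U j = Suc r" "box_col U j = Suc c"
      by (auto simp: ribbon_def ribbon_box_def)
    hence "i = j" using row_col_identity[OF U i(1)] row_col_identity[OF U j(1)] by simp
    thus False using i j by simp
  qed
  moreover have "0 \<in> fst ` ?\<beta>" using ribbon_fst_image[OF U n] by simp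
  moreover have "0 \<in> snd ` ?\<beta>"
  proof -
    have "snd (ribbon_box n U 1) = 0" by (simp add: ribbon_box_def box_col_def)
    moreover have "ribbon_box n U 1 \<in> ?\<beta>" unfolding ribbon_def using n by simp
    ultimately show ?thesis by (metis image_eqI)
  qed
  moreover have "card ?\<beta> = n" using card_image[OF ribbon_box_inj[OF U]] by (simp add: ribbon_def)
  ultimately show ?thesis
    unfolding border_shapes_def border_shape_def
    using ribbon_skew_shape[OF U] ribbon_connected[OF U] ribbon_fst_image[OF U n] by simp
qed

lemma ribbon_inj:
  assumes U: "U \<subseteq> {1..<n}" and U': "U' \<subseteq> {1..<n}" and n: "n \<ge> 1" and eq: "ribbon n U = ribbon n U'"
  shows "U = U'"
proof (rule box_row_determines[OF U U'])
  fix j assume j: "j \<in> {1..n}"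
  have "{..<card U + 1} = {..<card U' + 1}" using ribbon_fst_image[OF U n] ribbon_fst_image[OF U' n] eq by simp
  hence c: "card U = card U'" by simp
  have "ribbon_box n U j \<in> ribbon n U'" using j eq[symmetric] by (simp add: ribbon_def)
  then obtain i where i: "i \<in> {1..n}" "box_row n U j = box_row n U' i" "box_col U j = box_col U' i"
    by (auto simp: ribbon_def ribbon_box_def)
  have "i = j" using row_col_identity[OF U j] row_col_identity[OF U' i(1)] i c by simp
  thus "box_row n U j = box_row n U' j" using i by simp
qed

text \<open>
  The diagonal of a box. Contents increase by 1 along each step of a ribbon.
\<close>

definition content :: "box \<Rightarrow> int" where "content b = int (snd b) - int (fst b)"

text \<open>
  In a skew shape a strictly southeast box spans a full rectangle, which contains a 2 by 2 square.
\<close>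

lemma border_shape_comparable:
  assumes \<beta>: "border_shape \<beta>" and ab: "a \<in> \<beta>" "b \<in> \<beta>" and le: "content a \<le> content b"
  shows "snd a \<le> snd b \<and> fst b \<le> fst a"
proof -
  obtain L M where LM: "young_diagram L" "young_diagram M" "\<beta> = L - M"
    using \<beta> unfolding border_shape_def skew_shape_def by blast
  have Ld: "(r', c') \<in> L" if "(r, c) \<in> L" "r' \<le> r" "c' \<le> c" for r c r' c'
    using LM(1) that unfolding young_diagram_def by blast
  have Md: "(r', c') \<in> M" if "(r, c) \<in> M" "r' \<le> r" "c' \<le> c" for r c r' c'
    using LM(2) that unfolding young_diagram_def by blast
  have no: False if "(r, c) \<in> \<beta>" "(r', c') \<in> \<beta>" "r < r'" "c < c'" for r c r' c'
  proof -
    have "(x, y) \<in> \<beta>" if "r \<le> x" "x \<le> r'" "c \<le> y" "y \<le> c'" for x y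
      using Ld[of r' c' x y] Md[of x y r c] that \<open>(r, c) \<in> \<beta>\<close> \<open>(r', c') \<in> \<beta>\<close> LM(3) by blast
    hence "{(r, c), (r, Suc c), (Suc r, c), (Suc r, Suc c)} \<subseteq> \<beta>" using that(3,4) by simp
    thus False using \<beta> unfolding border_shape_def by blast
  qed
  have no1: "\<not> (fst a < fst b \<and> snd a < snd b)" using no[of "fst a" "snd a" "fst b" "snd b"] ab by auto
  have no2: "\<not> (fst b < fst a \<and> snd b < snd a)" using no[of "fst b" "snd b" "fst a" "snd a"] ab by auto
  show ?thesis using le no1 no2 unfolding content_def by linarith
qed

lemma border_shape_content_inj:
  assumes \<beta>: "border_shape \<beta>"
  shows "inj_on content \<beta>"
proof (rule inj_onI)
  fix a b assume "a \<in> \<beta>" "b \<in> \<beta>" "content a = content b"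
  hence "snd a = snd b" "fst a = fst b"
    using border_shape_comparable[OF \<beta>, of a b] border_shape_comparable[OF \<beta>, of b a] by auto
  thus "a = b" by (simp add: prod_eq_iff)
qed

text \<open>
  A path of adjacent boxes changes the content by one in each step.
\<close>

lemma border_shape_content_interval:
  assumes \<beta>: "border_shape \<beta>" and ab: "a \<in> \<beta>" "b \<in> \<beta>" and m: "content a \<le> m" "m \<le> content b"
  shows "m \<in> content ` \<beta>"
proof -
  have "(a, b) \<in> {(x, y). x \<in> \<beta> \<and> y \<in> \<beta> \<and> adjacent x y}\<^sup>*"
    using \<beta> ab unfolding border_shape_def connected_shape_def by blast
  hence "\<forall>m. content a \<le> m \<and> m \<le> content b \<longrightarrow> m \<in> content ` \<beta>"
  proof (induction rule: rtrancl_induct)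
    case base
    show ?case using ab(1) by (metis antisym image_eqI)
  next
    case (step y z)
    have "y \<in> \<beta>" "z \<in> \<beta>" and adj: "adjacent y z" using step(2) by auto
    have "content z \<le> content y + 1" using adj unfolding adjacent_def content_def by auto
    show ?case
    proof (intro allI impI)
      fix m assume m: "content a \<le> m \<and> m \<le> content z"
      show "m \<in> content ` \<beta>"
      proof (cases "m = content z")
        case True
        thus ?thesis using \<open>z \<in> \<beta>\<close> by blast
      next
        case False
        hence "m \<le> content y" using m \<open>content z \<le> content y + 1\<close> by linarith
        thus ?thesis using step.IH m by blast
      qed
    qed
  qed
  thus ?thesis using m by blast
qed

text \<open>
  By the preceding lemmas the contents enumerate the boxes; successive boxes are adjacent, and \<open>U\<close>
  collects the steps that go up.
\<close>

lemma border_shape_is_ribbon: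
  assumes \<beta>: "\<beta> \<in> border_shapes n k" and n: "n \<ge> 1"
  obtains U where "U \<subseteq> {1..<n}" "\<beta> = ribbon n U"
proof -
  have b: "border_shape \<beta>" and card: "card \<beta> = n" using \<beta> by (auto simp: border_shapes_def)
  note cmp = border_shape_comparable[OF b] and inj = border_shape_content_inj[OF b]
  have fin: "finite \<beta>" using card n card.infinite by fastforce
  have ne: "content ` \<beta> \<noteq> {}" using card n by auto
  have finc: "finite (content ` \<beta>)" using fin by simp
  obtain lo where lo: "lo \<in> \<beta>" "content lo = Min (content ` \<beta>)" using Min_in[OF finc ne] by (metis imageE)
  obtain hi where hi: "hi \<in> \<beta>" "content hi = Max (content ` \<beta>)" using Max_in[OF finc ne] by (metis imageE)
  have lo_le: "content lo \<le> content x" if "x \<in> \<beta>" for x unfolding lo(2) using Min_le[OF finc] that by blast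
  have hi_ge: "content x \<le> content hi" if "x \<in> \<beta>" for x unfolding hi(2) using Max_ge[OF finc] that by blast
  obtain x0 where x0: "x0 \<in> \<beta>" "snd x0 = 0" using b unfolding border_shape_def by force
  obtain y0 where y0: "y0 \<in> \<beta>" "fst y0 = 0" using b unfolding border_shape_def by force
  have lo0: "snd lo = 0" using cmp[OF lo(1) x0(1) lo_le[OF x0(1)]] x0(2) by simp
  have hi0: "fst hi = 0" using cmp[OF y0(1) hi(1) hi_ge[OF y0(1)]] y0(2) by simp
  have im: "content ` \<beta> = {content lo..content hi}"
    using lo_le hi_ge border_shape_content_interval[OF b lo(1) hi(1)] by auto
  have "n = card (content ` \<beta>)" using card_image[OF inj] card by simp
  hence nc: "int n = content hi - content lo + 1" using im n by simp
  define p where "p = (\<lambda>j::nat. inv_into \<beta> content (content lo + int j - 1))"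
  have cj: "content lo + int j - 1 \<in> content ` \<beta>" if "j \<in> {1..n}" for j
    unfolding im using that nc by auto
  have p: "p j \<in> \<beta>" "content (p j) = content lo + int j - 1" if "j \<in> {1..n}" for j
    unfolding p_def using inv_into_into[OF cj[OF that]] f_inv_into_f[OF cj[OF that]] by auto
  have p_onto: "\<beta> = p ` {1..n}"
  proof (intro equalityI subsetI)
    fix x assume x: "x \<in> \<beta>"
    define j where "j = nat (content x - content lo + 1)"
    have j: "int j = content x - content lo + 1" using lo_le[OF x] by (simp add: j_def)
    have jn: "j \<in> {1..n}" using j lo_le[OF x] hi_ge[OF x] nc by auto
    have "content (p j) = content x" using p(2)[OF jn] j by simp
    hence "p j = x" using inj_onD[OF inj _ p(1)[OF jn] x] by simp
    thus "x \<in> p ` {1..n}" using jn by blast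
  qed (use p in auto)
  have plo: "p 1 = lo" using inj_onD[OF inj _ p(1)[of 1] lo(1)] p(2)[of 1] n by simp
  have phi: "p n = hi" using inj_onD[OF inj _ p(1)[of n] hi(1)] p(2)[of n] n nc by simp
  define U where "U = {j \<in> {1..<n}. fst (p (Suc j)) \<noteq> fst (p j)}"
  have U: "U \<subseteq> {1..<n}" by (auto simp: U_def)
  have row: "fst (p j) = box_row n U j" if "j \<in> {1..n}" for j
    using that
  proof (induction rule: down_induct)
    case last
    show ?case using phi hi0 box_row_last[OF U] by simp
  next
    case (step j)
    have j: "j \<in> {1..n}" "Suc j \<in> {1..n}" using step(1) by auto
    have c: "content (p (Suc j)) = content (p j) + 1" using p(2)[OF j(1)] p(2)[OF j(2)] by simp
    have "snd (p j) \<le> snd (p (Suc j)) \<and> fst (p (Suc j)) \<le> fst (p j)"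
      by (rule cmp[OF p(1)[OF j(1)] p(1)[OF j(2)]]) (simp add: c)
    hence "fst (p j) = fst (p (Suc j)) \<or> fst (p j) = fst (p (Suc j)) + 1" using c unfolding content_def by linarith
    moreover have "j \<in> U \<longleftrightarrow> fst (p (Suc j)) \<noteq> fst (p j)" using step(1) by (simp add: U_def)
    ultimately show ?case using box_row_Suc[OF step(1), of U] step(2) by auto
  qed
  have "fst lo = card U" using row[of 1] box_row_first[OF U] plo n by simp
  hence clo: "content lo = - int (card U)" using lo0 by (simp add: content_def)
  have "p j = ribbon_box n U j" if j: "j \<in> {1..n}" for j
  proof -
    have "int (snd (p j)) = int (box_col U j)"
      using p(2)[OF j] row[OF j] clo row_col_identity[OF U j] unfolding content_def by linarith
    thus ?thesis using row[OF j] by (simp add: ribbon_box_def prod_eq_iff)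
  qed
  hence "\<beta> = ribbon n U" unfolding p_onto ribbon_def by (intro image_cong) auto
  thus ?thesis using that U by blast
qed

lemma sum_border_shapes:
  fixes F :: "box set \<Rightarrow> complex"
  assumes n: "n \<ge> 1"
  shows "(\<Sum>\<beta>\<in>border_shapes n (i + 1). F \<beta>) = (\<Sum>U | U \<subseteq> {1..<n} \<and> card U = i. F (ribbon n U))"
proof (rule sum.reindex_bij_betw[symmetric], rule bij_betw_imageI)
  show "inj_on (ribbon n) {U. U \<subseteq> {1..<n} \<and> card U = i}"
    by (rule inj_onI) (use ribbon_inj[OF _ _ n] in blast)
  show "ribbon n ` {U. U \<subseteq> {1..<n} \<and> card U = i} = border_shapes n (i + 1)"
  proof (intro equalityI subsetI)
    fix \<beta> assume "\<beta> \<in> ribbon n ` {U. U \<subseteq> {1..<n} \<and> card U = i}"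
    thus "\<beta> \<in> border_shapes n (i + 1)" using ribbon_border_shapes[OF _ n] by auto
  next
    fix \<beta> assume \<beta>: "\<beta> \<in> border_shapes n (i + 1)"
    then obtain U where U: "U \<subseteq> {1..<n}" "\<beta> = ribbon n U" using border_shape_is_ribbon[OF _ n] by blast
    have "card U = i" using \<beta> ribbon_fst_image[OF U(1) n] U(2) by (simp add: border_shapes_def)
    thus "\<beta> \<in> ribbon n ` {U. U \<subseteq> {1..<n} \<and> card U = i}" using U by blast
  qed
qed

section \<open>Skew Specht modules of ribbons\<close>

definition tab_word :: "nat \<Rightarrow> nat set \<Rightarrow> (nat \<Rightarrow> nat) \<Rightarrow> tabloid" where
  "tab_word n U w = (\<lambda>r. w ` {j \<in> {1..n}. box_row n U j = r})"

lemma tab_word_row_word: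
  assumes w: "w \<in> G n"
  shows "tab_word n U w r = {y \<in> {1..n}. row_word n U w y = r}"
proof (intro equalityI subsetI)
  fix y assume "y \<in> tab_word n U w r"
  then obtain j where j: "j \<in> {1..n}" "box_row n U j = r" "y = w j" by (auto simp: tab_word_def)
  have "w j \<in> {1..n}" using G_in[OF w] j(1) by blast
  thus "y \<in> {y \<in> {1..n}. row_word n U w y = r}" using j by (simp add: row_word_def G_inv2[OF w])
next
  fix y assume y: "y \<in> {y \<in> {1..n}. row_word n U w y = r}"
  hence y1: "y \<in> {1..n}" and "row_word n U w y = r" by simp_all
  moreover have "row_word n U w y = box_row n U (inv' w y)" using y1 by (simp only: row_word_def restrict_apply if_True comp_apply)
  moreover have "inv' w y \<in> {1..n}" using G_in[OF G_inv[OF w], of y] y1 by blast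
  ultimately have "inv' w y \<in> {j \<in> {1..n}. box_row n U j = r}" by simp
  moreover have "y = w (inv' w y)" using G_inv1[OF w] by simp
  ultimately show "y \<in> tab_word n U w r" unfolding tab_word_def by blast
qed

lemma tab_word_eq_iff:
  assumes v: "v \<in> G n" and w: "w \<in> G n"
  shows "tab_word n U v = tab_word n U w \<longleftrightarrow> row_word n U v = row_word n U w"
proof
  assume eq: "tab_word n U v = tab_word n U w"
  show "row_word n U v = row_word n U w"
  proof (rule extensionalityI[OF row_word_extensional row_word_extensional])
    fix y assume "y \<in> {1..n}"
    hence "y \<in> tab_word n U v (row_word n U v y)" unfolding tab_word_row_word[OF v] by blast
    hence "y \<in> tab_word n U w (row_word n U v y)" unfolding eq .
    thus "row_word n U v y = row_word n U w y" unfolding tab_word_row_word[OF w] by simp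
  qed
next
  assume "row_word n U v = row_word n U w"
  thus "tab_word n U v = tab_word n U w" by (simp add: fun_eq_iff tab_word_row_word v w)
qed

definition poly_word :: "nat \<Rightarrow> nat set \<Rightarrow> (nat \<Rightarrow> nat) \<Rightarrow> tabloid \<Rightarrow> complex" where
  "poly_word n U w = (\<lambda>X. \<Sum>\<sigma>\<in>col_perms n U. of_int (sign \<sigma>) * (if X = tab_word n U (w \<circ> \<sigma>) then 1 else 0))"

lemma col_perms_column_image:
  assumes \<sigma>: "\<sigma> \<in> col_perms n U"
  shows "\<sigma> ` {j \<in> {1..n}. box_col U j = c} = {j \<in> {1..n}. box_col U j = c}"
proof (rule endo_inj_surj)
  have G: "\<sigma> \<in> G n" using col_perms_G[OF \<sigma>] .
  show "\<sigma> ` {j \<in> {1..n}. box_col U j = c} \<subseteq> {j \<in> {1..n}. box_col U j = c}"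
  proof (rule image_subsetI)
    fix j assume j: "j \<in> {j \<in> {1..n}. box_col U j = c}"
    hence "\<sigma> j \<in> {1..n}" using G_in[OF G] by blast
    moreover have "box_col U (\<sigma> j) = box_col U j" using \<sigma> j unfolding col_perms_def by blast
    ultimately show "\<sigma> j \<in> {j \<in> {1..n}. box_col U j = c}" using j by simp
  qed
  show "inj_on \<sigma> {j \<in> {1..n}. box_col U j = c}" using G_inj[OF G] by (auto simp: inj_on_def)
qed simp

text \<open>
  The column stabilizer of a tableau permutes entries; conjugation by \<open>w\<close> turns it into the group of
  column permutations of the boxes, and preserves signs.
\<close>

lemma ribbon_polytabloid:
  assumes w: "w \<in> G n" and t: "\<And>j. j \<in> {1..n} \<Longrightarrow> t (ribbon_box n U j) = w j"
  shows "polytabloid n (ribbon n U) t = poly_word n U w"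
proof
  fix X
  let ?\<beta> = "ribbon n U"
  have rows: "s ` {b \<in> ?\<beta>. fst b = r} = (\<lambda>j. s (ribbon_box n U j)) ` {j \<in> {1..n}. box_row n U j = r}" for s :: "box \<Rightarrow> nat" and r
  proof -
    have "{b \<in> ?\<beta>. fst b = r} = ribbon_box n U ` {j \<in> {1..n}. box_row n U j = r}" by (auto simp: ribbon_def ribbon_box_def)
    thus ?thesis by (simp only: image_image)
  qed
  have cols: "s ` {b \<in> ?\<beta>. snd b = c} = (\<lambda>j. s (ribbon_box n U j)) ` {j \<in> {1..n}. box_col U j = c}" for s :: "box \<Rightarrow> nat" and c
  proof -
    have "{b \<in> ?\<beta>. snd b = c} = ribbon_box n U ` {j \<in> {1..n}. box_col U j = c}" by (auto simp: ribbon_def ribbon_box_def)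
    thus ?thesis by (simp only: image_image)
  qed
  let ?C = "\<lambda>c. {j \<in> {1..n}. box_col U j = c}"
  have tc: "t ` {b \<in> ?\<beta>. snd b = c} = w ` ?C c" for c unfolding cols by (rule image_cong) (auto simp: t)
  let ?conj = "\<lambda>\<sigma>. w \<circ> \<sigma> \<circ> inv' w"
  have cw: "?conj \<sigma> \<circ> w = w \<circ> \<sigma>" for \<sigma> using G_inv2[OF w] by (simp add: fun_eq_iff)
  have stab: "column_stabilizer n ?\<beta> t = ?conj ` col_perms n U"
  proof (intro equalityI subsetI)
    fix \<tau> assume "\<tau> \<in> column_stabilizer n ?\<beta> t"
    hence \<tau>: "\<tau> \<in> G n" "\<And>c. \<tau> ` w ` ?C c = w ` ?C c"
      by (auto simp: column_stabilizer_def sym_group_carrier G_def tc)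
    define \<sigma> where "\<sigma> = inv' w \<circ> \<tau> \<circ> w"
    have \<sigma>G: "\<sigma> \<in> G n" unfolding \<sigma>_def by (intro G_comp G_inv w \<tau>(1))
    have "box_col U (\<sigma> j) = box_col U j" if j: "j \<in> {1..n}" for j
    proof -
      have "\<tau> (w j) \<in> w ` ?C (box_col U j)" using \<tau>(2)[of "box_col U j"] j by blast
      then obtain i where "i \<in> ?C (box_col U j)" "\<tau> (w j) = w i" by blast
      thus ?thesis by (simp add: \<sigma>_def G_inv2[OF w])
    qed
    hence \<sigma>C: "\<sigma> \<in> col_perms n U" using \<sigma>G by (simp add: col_perms_def)
    have \<tau>eq: "\<tau> = ?conj \<sigma>" by (simp add: fun_eq_iff \<sigma>_def G_inv1[OF w])
    show "\<tau> \<in> ?conj ` col_perms n U" by (subst \<tau>eq, rule imageI[OF \<sigma>C])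
  next
    fix \<tau> assume "\<tau> \<in> ?conj ` col_perms n U"
    then obtain \<sigma> where \<sigma>: "\<sigma> \<in> col_perms n U" "\<tau> = ?conj \<sigma>" by blast
    have "\<tau> \<in> G n" unfolding \<sigma>(2) by (intro G_comp G_inv w col_perms_G[OF \<sigma>(1)])
    moreover have "\<tau> ` w ` ?C c = w ` ?C c" for c
    proof -
      have "\<tau> ` w ` ?C c = (\<tau> \<circ> w) ` ?C c" by (rule image_comp)
      also have "\<dots> = w ` \<sigma> ` ?C c" unfolding \<sigma>(2) cw by (rule image_comp[symmetric])
      finally show ?thesis unfolding col_perms_column_image[OF \<sigma>(1)] .
    qed
    ultimately show "\<tau> \<in> column_stabilizer n ?\<beta> t"
      by (simp add: column_stabilizer_def sym_group_carrier G_def tc)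
  qed
  have inj: "inj_on ?conj (col_perms n U)"
  proof (rule inj_onI)
    fix \<sigma> \<sigma>' assume "?conj \<sigma> = ?conj \<sigma>'"
    hence "?conj \<sigma> \<circ> w = ?conj \<sigma>' \<circ> w" by simp
    hence "w \<circ> \<sigma> = w \<circ> \<sigma>'" unfolding cw .
    thus "\<sigma> = \<sigma>'" using G_inj[OF w] by (simp add: fun_eq_iff)
  qed
  have "polytabloid n ?\<beta> t X = (\<Sum>\<sigma>\<in>col_perms n U. of_int (sign (?conj \<sigma>)) * (if X = tabloid_of ?\<beta> (?conj \<sigma> \<circ> t) then 1 else 0))"
    unfolding polytabloid_def stab by (rule sum.reindex[OF inj, unfolded comp_def[of _ ?conj]])
  also have "\<dots> = poly_word n U w X"
    unfolding poly_word_def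
  proof (rule sum.cong[OF refl])
    fix \<sigma> assume \<sigma>: "\<sigma> \<in> col_perms n U"
    have "tabloid_of ?\<beta> (?conj \<sigma> \<circ> t) = tab_word n U (?conj \<sigma> \<circ> w)"
    proof
      fix r
      show "tabloid_of ?\<beta> (?conj \<sigma> \<circ> t) r = tab_word n U (?conj \<sigma> \<circ> w) r"
        unfolding tabloid_of_def tab_word_def rows by (rule image_cong) (auto simp: t)
    qed
    hence 1: "tabloid_of ?\<beta> (?conj \<sigma> \<circ> t) = tab_word n U (w \<circ> \<sigma>)" unfolding cw .
    have "sign (?conj \<sigma>) = sign w * sign \<sigma> * sign (inv' w)"
      using sign_G[OF G_comp[OF w col_perms_G[OF \<sigma>]] G_inv[OF w]] sign_G[OF w col_perms_G[OF \<sigma>]] by simp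
    also have "sign (inv' w) = sign w" using w by (intro sign_inverse) (auto simp: G_def permutation_permutes)
    also have "sign w * sign \<sigma> * sign w = sign \<sigma>" by (simp add: mult_ac)
    finally have 2: "sign (?conj \<sigma>) = sign \<sigma>" .
    show "of_int (sign (?conj \<sigma>)) * (if X = tabloid_of ?\<beta> (?conj \<sigma> \<circ> t) then 1 else 0)
      = of_int (sign \<sigma>) * (if X = tab_word n U (w \<circ> \<sigma>) then 1 else (0 :: complex))" unfolding 1 2 ..
  qed
  finally show "polytabloid n ?\<beta> t X = poly_word n U w X" .
qed

lemma ribbon_specht_module:
  assumes U: "U \<subseteq> {1..<n}"
  shows "specht_module n (ribbon n U) = cfun.span (poly_word n U ` G n)"
proof -
  let ?b = "ribbon_box n U"
  have bij: "bij_betw ?b {1..n} (ribbon n U)" unfolding ribbon_def by (rule inj_on_imp_bij_betw[OF ribbon_box_inj[OF U]])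
  have "{polytabloid n (ribbon n U) t | t. tableau n (ribbon n U) t} = poly_word n U ` G n"
  proof (intro equalityI subsetI)
    fix x assume "x \<in> {polytabloid n (ribbon n U) t | t. tableau n (ribbon n U) t}"
    then obtain t where t: "bij_betw t (ribbon n U) {1..n}" "x = polytabloid n (ribbon n U) t"
      by (auto simp: tableau_def)
    define w where "w = (\<lambda>j. if j \<in> {1..n} then t (?b j) else j)"
    have "bij_betw (t \<circ> ?b) {1..n} {1..n}" by (rule bij_betw_trans[OF bij t(1)])
    moreover have "bij_betw w {1..n} {1..n} = bij_betw (t \<circ> ?b) {1..n} {1..n}"
      by (rule bij_betw_cong) (simp add: w_def)
    ultimately have w: "w \<in> G n" unfolding G_def by (auto intro!: bij_imp_permutes simp: w_def)
    have "x = poly_word n U w" unfolding t(2) by (rule ribbon_polytabloid[OF w]) (simp add: w_def)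
    thus "x \<in> poly_word n U ` G n" using w by blast
  next
    fix x assume "x \<in> poly_word n U ` G n"
    then obtain w where w: "w \<in> G n" "x = poly_word n U w" by blast
    define t where "t = w \<circ> inv_into {1..n} ?b"
    have "bij_betw w {1..n} {1..n}" using w(1) by (auto simp: G_def intro: permutes_imp_bij)
    hence "tableau n (ribbon n U) t"
      unfolding tableau_def t_def by (rule bij_betw_trans[OF bij_betw_inv_into[OF bij]])
    moreover have "x = polytabloid n (ribbon n U) t"
    proof -
      have tj: "t (?b j) = w j" if "j \<in> {1..n}" for j
        unfolding t_def comp_apply inv_into_f_f[OF ribbon_box_inj[OF U] that] ..
      show ?thesis unfolding w(2) by (rule ribbon_polytabloid[OF w(1) tj, symmetric])
    qed
    ultimately show "x \<in> {polytabloid n (ribbon n U) t | t. tableau n (ribbon n U) t}" by blast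
  qed
  thus ?thesis by (simp only: specht_module_def)
qed

lemma perm_action_linear: "flinear (perm_action \<pi>)"
  by (rule flinearI) (auto simp: perm_action_def fscale_def fun_eq_iff)

text \<open>
  Composing with the map from tableaux to tabloids turns functions on tabloids into functions on
  permutations. This map intertwines the actions, sends polytabloids to polytabloids, and is
  injective on functions supported on tabloids of the ribbon.
\<close>

lemma ribbon_specht_character:
  assumes U: "U \<subseteq> {1..<n}" and \<pi>: "\<pi> \<in> G n"
  shows "specht_character n (ribbon n U) \<pi> = trace_on (specht_funs n U) (left_act \<pi>)"
proof -
  let ?P = "poly_word n U ` G n"
  let ?V = "cfun.span ?P"
  \<comment> \<open>Pulling back along the map that sends a permutation to its tabloid.\<close>
  define \<Theta> :: "(tabloid \<Rightarrow> complex) \<Rightarrow> (nat \<Rightarrow> nat) \<Rightarrow> complex"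
    where "\<Theta> = (\<lambda>v w. if w \<in> G n then v (tab_word n U w) else 0)"
  have lin: "flinear \<Theta>" by (rule flinearI) (auto simp: \<Theta>_def fscale_def fun_eq_iff)
  interpret \<Theta>: Vector_Spaces.linear fscale fscale \<Theta> by (rule lin)
  have \<Theta>P: "\<Theta> (poly_word n U w) = polytab_fun n U w" if w: "w \<in> G n" for w
  proof
    fix v
    show "\<Theta> (poly_word n U w) v = polytab_fun n U w v"
      unfolding \<Theta>_def poly_word_def polytab_fun_def
      by (cases "v \<in> G n") (auto intro!: sum.cong simp: tab_word_eq_iff[OF _ G_comp[OF w col_perms_G]])
  qed
  have "\<Theta> ` ?P = polytab_fun n U ` G n" unfolding image_image by (rule image_cong) (auto simp: \<Theta>P)
  hence \<Theta>V: "\<Theta> ` ?V = specht_funs n U" unfolding specht_funs_def \<Theta>.span_image[symmetric] by simp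
  \<comment> \<open>Functions supported on tabloids of the ribbon, on which \<open>\<Theta>\<close> loses no information.\<close>
  define Z where "Z = {v :: tabloid \<Rightarrow> complex. \<forall>X. X \<notin> tab_word n U ` G n \<longrightarrow> v X = 0}"
  have subZ: "cfun.subspace Z" by (rule cfun.subspaceI) (auto simp: Z_def fscale_def)
  have PZ: "poly_word n U w \<in> Z" if w: "w \<in> G n" for w
  proof -
    have "poly_word n U w X = 0" if X: "X \<notin> tab_word n U ` G n" for X
      unfolding poly_word_def
    proof (intro sum.neutral ballI)
      fix \<sigma> assume "\<sigma> \<in> col_perms n U"
      hence "tab_word n U (w \<circ> \<sigma>) \<in> tab_word n U ` G n" using G_comp[OF w col_perms_G] by blast
      hence "X \<noteq> tab_word n U (w \<circ> \<sigma>)" using X by blast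
      thus "of_int (sign \<sigma>) * (if X = tab_word n U (w \<circ> \<sigma>) then 1 else 0) = (0 :: complex)" by simp
    qed
    thus ?thesis by (simp add: Z_def)
  qed
  have VZ: "?V \<subseteq> Z" by (rule cfun.span_minimal[OF _ subZ]) (use PZ in blast)
  have injZ: "inj_on \<Theta> Z"
  proof (rule inj_onI)
    fix v v' assume *: "v \<in> Z" "v' \<in> Z" "\<Theta> v = \<Theta> v'"
    show "v = v'"
    proof
      fix X
      show "v X = v' X"
      proof (cases "X \<in> tab_word n U ` G n")
        case True
        then obtain w where "w \<in> G n" "X = tab_word n U w" by blast
        thus ?thesis using fun_cong[OF *(3), of w] by (simp add: \<Theta>_def)
      next
        case False
        thus ?thesis using *(1,2) unfolding Z_def by simp
      qed
    qed
  qed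
  have comm: "\<Theta> (perm_action \<pi> v) = left_act \<pi> (\<Theta> v)" for v
  proof
    fix w
    have iff: "inv' \<pi> \<circ> w \<in> G n \<longleftrightarrow> w \<in> G n"
      using G_comp[OF G_inv[OF \<pi>], of w] G_comp[OF \<pi>, of "inv' \<pi> \<circ> w"] by (auto simp: G_inv_cancel1[OF \<pi>])
    have "(\<lambda>r. inv' \<pi> ` tab_word n U w r) = tab_word n U (inv' \<pi> \<circ> w)"
      unfolding tab_word_def image_comp ..
    thus "\<Theta> (perm_action \<pi> v) w = left_act \<pi> (\<Theta> v) w"
      unfolding \<Theta>_def perm_action_def left_act_def iff by simp
  qed
  have TZ: "perm_action \<pi> v \<in> Z" if v: "v \<in> Z" for v
  proof -
    have "perm_action \<pi> v X = 0" if X: "X \<notin> tab_word n U ` G n" for X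
    proof -
      have "(\<lambda>r. inv' \<pi> ` X r) \<notin> tab_word n U ` G n"
      proof
        assume "(\<lambda>r. inv' \<pi> ` X r) \<in> tab_word n U ` G n"
        then obtain w where w: "w \<in> G n" "(\<lambda>r. inv' \<pi> ` X r) = tab_word n U w" by blast
        have "X = tab_word n U (\<pi> \<circ> w)"
        proof
          fix r
          have "X r = \<pi> ` inv' \<pi> ` X r" unfolding image_comp by (simp add: comp_def G_inv1[OF \<pi>])
          also have "\<dots> = \<pi> ` tab_word n U w r" using fun_cong[OF w(2), of r] by simp
          also have "\<dots> = tab_word n U (\<pi> \<circ> w) r" unfolding tab_word_def image_comp ..
          finally show "X r = tab_word n U (\<pi> \<circ> w) r" .
        qed
        thus False using X G_comp[OF \<pi> w(1)] by blast
      qed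
      thus ?thesis using v unfolding Z_def perm_action_def by blast
    qed
    thus ?thesis by (simp add: Z_def)
  qed
  have TV: "perm_action \<pi> v \<in> ?V" if v: "v \<in> ?V" for v
  proof -
    have "\<Theta> v \<in> specht_funs n U" unfolding \<Theta>V[symmetric] using v by (rule imageI)
    hence "\<Theta> (perm_action \<pi> v) \<in> \<Theta> ` ?V" unfolding comm \<Theta>V by (rule left_act_specht_funs[OF \<pi>])
    then obtain v' where v': "v' \<in> ?V" "\<Theta> (perm_action \<pi> v) = \<Theta> v'" by blast
    have "v \<in> Z" "v' \<in> Z" using v v'(1) VZ by blast+
    from inj_onD[OF injZ v'(2) TZ[OF this(1)] this(2)] have "perm_action \<pi> v = v'" .
    thus ?thesis using v'(1) by simp
  qed
  obtain B where B: "B \<subseteq> ?P" "cfun.independent B" "?P \<subseteq> cfun.span B"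
    by (rule cfun.maximal_independent_subset)
  have finB: "finite B" using finite_subset[OF B(1)] G_finite by simp
  have spB: "cfun.span B = ?V"
    using cfun.span_mono[OF B(1)] cfun.span_minimal[OF B(3) cfun.subspace_span] by (rule equalityI)
  have "trace_on ?V (perm_action \<pi>) = trace_on (\<Theta> ` ?V) (left_act \<pi>)"
  proof (rule trace_on_transport)
    show "cfun.independent B" by (rule B(2))
    show "finite B" by (rule finB)
    show "cfun.span B = ?V" by (rule spB)
    show "flinear \<Theta>" by (rule lin)
    show "inj_on \<Theta> ?V" by (rule inj_on_subset[OF injZ VZ])
    show "flinear (perm_action \<pi>)" by (rule perm_action_linear)
    show "flinear (left_act \<pi>)" by (rule left_act_linear)
    show "perm_action \<pi> v \<in> ?V" if "v \<in> ?V" for v using that by (rule TV)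
    show "\<Theta> (perm_action \<pi> v) = left_act \<pi> (\<Theta> v)" if "v \<in> ?V" for v by (rule comm)
  qed
  thus ?thesis unfolding specht_character_def ribbon_specht_module[OF U] \<Theta>V .
qed

section \<open>The least common multiple of an initial segment\<close>

text \<open>
  The entries \<open>1 / (n C(n - 1, k))\<close> of Leibniz's harmonic triangle satisfy the Pascal type rule that
  the entry at \<open>(n, k + 1)\<close> is the entry at \<open>(n - 1, k)\<close> minus the entry at \<open>(n, k)\<close>. So the least
  common multiple, which clears the entries \<open>1 / n\<close> of the first column, clears all of them.
\<close>

lemma leibniz_triangle_integer:
  assumes "k < n"
  shows "real (Lcm {1..n}) / real (n * ((n - 1) choose k)) \<in> \<int>"
  using assms
proof (induction k arbitrary: n)
  case 0
  hence "n dvd Lcm {1..n}" by (intro dvd_Lcm) simp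
  then obtain t where t: "Lcm {1..n} = n * t" by (rule dvdE)
  have "real (Lcm {1..n}) / real (n * ((n - 1) choose 0)) = of_nat t" using 0 unfolding t by simp
  thus ?case by simp
next
  case (Suc k)
  obtain m where m: "n = Suc (Suc m)" using Suc.prems by (cases n; cases "n - 1") auto
  have km: "k \<le> m" using Suc.prems m by simp
  let ?L = "real (Lcm {1..n})"
  let ?Q = "real (Suc m choose k)"
  have Q: "?Q > 0" using km by simp
  have "Lcm {1..Suc m} dvd Lcm {1..n}" unfolding m by (rule Lcm_subset) auto
  then obtain t where t: "Lcm {1..n} = Lcm {1..Suc m} * t" by (rule dvdE)
  have "real t * (real (Lcm {1..Suc m}) / real (Suc m * (m choose k))) \<in> \<int>"
    using Suc.IH[of "Suc m"] km by (intro Ints_mult) auto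
  moreover have "?L / real (Suc m * (m choose k)) = real t * (real (Lcm {1..Suc m}) / real (Suc m * (m choose k)))"
    unfolding t of_nat_mult by (simp only: mult_ac times_divide_eq_right)
  ultimately have 1: "?L / real (Suc m * (m choose k)) \<in> \<int>" by (simp only:)
  have 2: "?L / real (n * (Suc m choose k)) \<in> \<int>" using Suc.IH[of n] Suc.prems m by simp
  have abs: "(Suc m - k) * (Suc m choose k) = Suc m * (m choose k)"
    using binomial_absorb_comp[of "Suc m" k] by simp
  have a1: "real (Suc m * (m choose k)) = ?Q * (real m + 1 - real k)"
    unfolding abs[symmetric] using km by (simp add: of_nat_diff mult.commute)
  have "Suc k * (Suc m choose Suc k) = (Suc m - k) * (Suc m choose k)"
    using binomial_absorption[of k "Suc m"] abs by simp
  hence "real (Suc k * (Suc m choose Suc k)) = real ((Suc m - k) * (Suc m choose k))" by (rule arg_cong)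
  hence nat: "real (Suc k) * real (Suc m choose Suc k) = real (Suc m - k) * ?Q" unfolding of_nat_mult .
  have conv: "real (Suc m - k) = real m + 1 - real k" "real (Suc k) = real k + 1" using km by (simp_all add: of_nat_diff)
  have a2: "(real k + 1) * real (Suc m choose Suc k) = (real m + 1 - real k) * ?Q" using nat unfolding conv .
  have pos: "real m + 1 - real k > 0" using km by simp
  have b: "real (Suc m choose Suc k) = (real m + 1 - real k) * ?Q / (real k + 1)"
    using a2 by (simp add: field_simps)
  have "1 / (?Q * (real m + 1 - real k)) - 1 / (real n * ?Q) = (real n - (real m + 1 - real k)) / (real n * ?Q * (real m + 1 - real k))"
    using Q pos m by (simp add: divide_simps)
  also have "real n - (real m + 1 - real k) = real k + 1" using m by simp
  also have "(real k + 1) / (real n * ?Q * (real m + 1 - real k)) = 1 / (real n * real (Suc m choose Suc k))"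
    unfolding b using Q pos m by (simp add: divide_simps)
  finally have "?L / (real n * real (Suc m choose Suc k)) = ?L / (?Q * (real m + 1 - real k)) - ?L / (real n * ?Q)"
    by (metis (no_types, opaque_lifting) mult.right_neutral right_diff_distrib' times_divide_eq_right)
  moreover have "?L / (?Q * (real m + 1 - real k)) - ?L / (real n * ?Q) \<in> \<int>"
    by (rule Ints_diff[OF 1[unfolded a1] 2[unfolded of_nat_mult]])
  moreover have "n - 1 = Suc m" using m by simp
  ultimately show ?case by (simp only: of_nat_mult)
qed

lemma n_binomial_dvd_Lcm:
  assumes "k < n"
  shows "n * ((n - 1) choose k) dvd Lcm {1..n}"
proof -
  let ?a = "n * ((n - 1) choose k)"
  have a: "?a > 0" using assms by simp
  obtain z where "real (Lcm {1..n}) / real ?a = of_int z" using leibniz_triangle_integer[OF assms] by (rule Ints_cases)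
  hence "real (Lcm {1..n}) = of_int z * real ?a" using a by (simp add: field_simps)
  hence "of_int (int (Lcm {1..n})) = (of_int (z * int ?a) :: real)" by simp
  hence "int (Lcm {1..n}) = z * int ?a" by (simp only: of_int_eq_iff)
  hence "int ?a dvd int (Lcm {1..n})" by simp
  thus ?thesis by (simp only: int_dvd_int_iff)
qed

text \<open>
  Before the step the exponent of \<open>p\<close> is \<open>k - 1\<close>, after it the exponent is \<open>k\<close>; other primes do not
  divide \<open>Suc n\<close>.
\<close>

lemma Lcm_prime_power_step:
  assumes p: "prime p" and k: "k \<ge> 1" and m: "Suc n = p ^ k"
  shows "Lcm {1..Suc n} = p * Lcm {1..n}"
proof -
  let ?L = "Lcm {1..n}"
  have p2: "p \<ge> 2" using prime_ge_2_nat[OF p] .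
  have fin: "Lcm {1..j} \<noteq> 0" for j :: nat by (simp add: Lcm_0_iff)
  have nd: "\<not> p ^ k dvd Lcm {1..j}" if "j \<le> n" for j
    using that
  proof (induction j)
    case 0
    show ?case using p2 k by simp
  next
    case (Suc j)
    have "Lcm {1..Suc j} = lcm (Suc j) (Lcm {1..j})" by (simp add: atLeastAtMostSuc_conv)
    hence "multiplicity p (Lcm {1..Suc j}) = max (multiplicity p (Suc j)) (multiplicity p (Lcm {1..j}))"
      using multiplicity_lcm[of "Suc j" "Lcm {1..j}" p] fin[of j] p by simp
    moreover have "multiplicity p (Lcm {1..j}) < k"
      using Suc fin p by (intro multiplicity_lessI) (auto simp: prime_nat_iff)
    moreover have "\<not> p ^ k dvd Suc j" using Suc.prems m by (auto dest: dvd_imp_le)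
    hence "multiplicity p (Suc j) < k" using p by (intro multiplicity_lessI) (auto simp: prime_nat_iff)
    ultimately have "multiplicity p (Lcm {1..Suc j}) < k" by simp
    thus ?case using multiplicity_geI[of "Lcm {1..Suc j}" p k] fin p by (auto simp: prime_nat_iff)
  qed
  have d: "p ^ (k - 1) dvd ?L"
  proof (cases "n = 0")
    case False
    have "p ^ (k - 1) < p ^ k" using p2 k by (intro power_strict_increasing) auto
    hence "p ^ (k - 1) \<le> n" unfolding m[symmetric] less_Suc_eq_le .
    moreover have "1 \<le> p ^ (k - 1)" using p2 by simp
    ultimately show ?thesis by (intro dvd_Lcm) simp
  next
    case True
    hence "p ^ k = 1" using m by simp
    thus ?thesis using p2 k by simp
  qed
  have "gcd (p ^ k) ?L dvd p ^ k" by simp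
  then obtain i where i: "i \<le> k" "gcd (p ^ k) ?L = p ^ i" using divides_primepow_nat[OF p] by blast
  have "i \<noteq> k" using nd[of n] i(2) by (metis gcd_dvd2 le_refl)
  moreover have "p ^ (k - 1) dvd p ^ i" unfolding i(2)[symmetric] using d k by (intro gcd_greatest le_imp_power_dvd) auto
  hence "k - 1 \<le> i" using power_dvd_imp_le[of p "k - 1" i] p2 by simp
  ultimately have ik: "i = k - 1" using i(1) by simp
  have "p ^ k * ?L = p ^ (k - 1) * lcm (p ^ k) ?L" using prod_gcd_lcm_nat[of "p ^ k" ?L] unfolding i(2) ik .
  moreover have "p ^ k = p ^ (k - 1) * p" using k by (metis One_nat_def Suc_diff_le diff_Suc_1 mult.commute power_Suc Suc_le_D)
  ultimately have "p * ?L = lcm (p ^ k) ?L" using p2 by (simp add: mult.assoc)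
  moreover have "Lcm {1..Suc n} = lcm (Suc n) ?L" by (simp add: atLeastAtMostSuc_conv)
  ultimately show ?thesis using m by simp
qed

text \<open>
  A number that is not a prime power is a product of two coprime smaller numbers, both of which
  divide the least common multiple already.
\<close>

lemma Lcm_non_prime_power_step:
  assumes n: "n \<ge> 1" and np: "\<And>p k. prime p \<Longrightarrow> k \<ge> 1 \<Longrightarrow> Suc n \<noteq> p ^ k"
  shows "Lcm {1..Suc n} = Lcm {1..n}"
proof -
  have "Suc n \<noteq> 1" using n by simp
  then obtain p where p: "prime p" "p dvd Suc n" using prime_factor_nat by blast
  have nu: "\<not> is_unit p" using p(1) not_prime_unit by blast
  obtain q where q: "Suc n = p ^ multiplicity p (Suc n) * q" "\<not> p dvd q"
    using multiplicity_decompose'[of "Suc n" p] nu by auto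
  let ?e = "multiplicity p (Suc n)"
  have e: "?e \<ge> 1" using p(2) nu multiplicity_eq_zero_iff[of "Suc n" p] by (cases "?e") auto
  have p2: "p \<ge> 2" using prime_ge_2_nat[OF p(1)] .
  have pe: "p ^ ?e \<ge> 2"
  proof -
    have "p ^ 1 \<le> p ^ ?e" using e p2 by (intro power_increasing) auto
    thus ?thesis using p2 by simp
  qed
  have q0: "q \<noteq> 0" using q(1) by (metis mult_0_right nat.distinct(1))
  have q1: "q \<noteq> 1" using np[OF p(1) e] q(1) by (metis mult.right_neutral)
  have le: "p ^ ?e \<le> n" "q \<le> n"
  proof -
    have "p ^ ?e * 2 \<le> p ^ ?e * q" using q0 q1 by (intro mult_left_mono) auto
    thus "p ^ ?e \<le> n" using q(1) pe by linarith
    have "2 * q \<le> p ^ ?e * q" using pe by (intro mult_right_mono) auto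
    thus "q \<le> n" using q(1) q0 by linarith
  qed
  have "coprime (p ^ ?e) q" using q(2) p(1) by (simp add: prime_imp_coprime)
  moreover have "p ^ ?e dvd Lcm {1..n}" "q dvd Lcm {1..n}" using le pe q0 by (auto intro!: dvd_Lcm)
  ultimately have "p ^ ?e * q dvd Lcm {1..n}" by (rule divides_mult[rotated 2])
  hence "Suc n dvd Lcm {1..n}" using q(1) by simp
  hence "lcm (Suc n) (Lcm {1..n}) = Lcm {1..n}" by (simp add: lcm_proj2_if_dvd)
  thus ?thesis by (simp add: atLeastAtMostSuc_conv)
qed

lemma finite_prime_powers_le: "finite {(p, k). prime (p::nat) \<and> k \<ge> (1::nat) \<and> p ^ k \<le> n}"
proof (rule finite_subset)
  show "{(p, k). prime (p::nat) \<and> k \<ge> (1::nat) \<and> p ^ k \<le> n} \<subseteq> {..n} \<times> {..n}"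
  proof (rule subsetI)
    fix x assume "x \<in> {(p, k). prime (p::nat) \<and> k \<ge> (1::nat) \<and> p ^ k \<le> n}"
    then obtain p k where *: "x = (p, k)" "prime p" "k \<ge> 1" "p ^ k \<le> n" by blast
    have p2: "p \<ge> 2" using prime_ge_2_nat[OF *(2)] .
    hence "k < p ^ k" by (intro power_gt_expt) simp
    moreover have "p \<le> p ^ k" using power_increasing[of 1 k p] *(3) p2 by simp
    ultimately show "x \<in> {..n} \<times> {..n}" using *(1,4) by simp
  qed
qed simp

text \<open>
  Both sides change in the same way from \<open>n\<close> to \<open>Suc n\<close>: if \<open>Suc n = p ^ k\<close>, the pair \<open>(p, k)\<close> is
  the only new one by unique factorization.
\<close>

lemma Lcm_eq_exp_chebyshev: "real (Lcm {1..n}) = exp (chebyshev_second (real n))"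
proof -
  let ?S = "\<lambda>n. {(p, k). prime (p::nat) \<and> k \<ge> (1::nat) \<and> p ^ k \<le> n}"
  have "real (Lcm {1..n}) = exp (\<Sum>(p, k)\<in>?S n. ln (real p))"
  proof (induction n)
    case 0
    have S0: "?S 0 = {}" by (auto simp: prime_gt_0_nat)
    show ?case unfolding S0 by simp
  next
    case (Suc n)
    let ?N = "{(p, k). prime (p::nat) \<and> k \<ge> (1::nat) \<and> p ^ k = Suc n}"
    have S: "?S (Suc n) = ?S n \<union> ?N" by (auto simp: le_Suc_eq)
    have finN: "finite ?N" by (rule finite_subset[OF _ finite_prime_powers_le[of "Suc n"]]) auto
    have "(\<Sum>(p, k)\<in>?S (Suc n). ln (real p)) = (\<Sum>(p, k)\<in>?S n. ln (real p)) + (\<Sum>(p, k)\<in>?N. ln (real p))"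
      unfolding S by (rule sum.union_disjoint[OF finite_prime_powers_le finN]) auto
    hence e: "exp (\<Sum>(p, k)\<in>?S (Suc n). ln (real p)) = real (Lcm {1..n}) * exp (\<Sum>(p, k)\<in>?N. ln (real p))"
      using Suc by (simp add: exp_add)
    show ?case
    proof (cases "\<exists>p k. prime p \<and> k \<ge> 1 \<and> Suc n = p ^ k")
      case True
      then obtain p k where pk: "prime p" "k \<ge> 1" "Suc n = p ^ k" by blast
      have "?N = {(p, k)}"
      proof (intro equalityI subsetI)
        fix x assume "x \<in> ?N"
        then obtain q j where qj: "x = (q, j)" "prime q" "j \<ge> 1" "q ^ j = p ^ k" using pk(3) by auto
        have "q dvd p ^ k" using qj(3,4) by (metis dvd_power less_eq_Suc_le One_nat_def)
        hence "q dvd p" using qj(2) by (rule prime_dvd_power_nat[rotated])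
        hence "q = p" using qj(2) pk(1) primes_dvd_imp_eq by blast
        moreover have "j = k" using qj(4) prime_ge_2_nat[OF pk(1)] unfolding calculation by (simp add: power_inject_exp)
        ultimately show "x \<in> {(p, k)}" using qj(1) by simp
      qed (use pk in auto)
      hence "exp (\<Sum>(p, k)\<in>?N. ln (real p)) = real p" using prime_gt_0_nat[OF pk(1)] by simp
      thus ?thesis unfolding e Lcm_prime_power_step[OF pk] by simp
    next
      case nopp: False
      have N0: "?N = {}"
      proof (rule equals0I)
        fix x assume "x \<in> ?N"
        then obtain p k where "prime p" "k \<ge> 1" "Suc n = p ^ k" by auto
        thus False using nopp by blast
      qed
      have one: "exp (\<Sum>(p, k)\<in>?N. ln (real p)) = 1" unfolding N0 by simp
      show ?thesis
      proof (cases "n = 0")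
        case True
        thus ?thesis unfolding e one by simp
      next
        case False
        have "Lcm {1..Suc n} = Lcm {1..n}"
          by (rule Lcm_non_prime_power_step) (use False nopp in auto)
        thus ?thesis unfolding e one by simp
      qed
    qed
  qed
  moreover have "?S n = {(p, k). prime (p::nat) \<and> k \<ge> (1::nat) \<and> real (p ^ k) \<le> real n}"
    by (simp only: of_nat_le_iff)
  ultimately show ?thesis unfolding chebyshev_second_def by simp
qed

section \<open>Foulkes characters and the hook pairing\<close>

lemma G_carrier: "G n = carrier (sym_group n)"
  by (auto simp: G_def sym_group_carrier)

lemma foulkes_character_ribbon_sum:
  assumes n: "n \<ge> 1" and \<pi>: "\<pi> \<in> G n"
  shows "foulkes_character n i \<pi> = (\<Sum>V | V \<subseteq> {1..<n} \<and> card V = i. trace_on (specht_funs n V) (left_act \<pi>))"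
  unfolding foulkes_character_def sum_border_shapes[OF n]
  by (intro sum.cong refl ribbon_specht_character[OF _ \<pi>]) blast

lemma surj_count_foulkes:
  assumes n: "n \<ge> 1" and k: "k \<ge> 1" "k \<le> n" and \<pi>: "\<pi> \<in> G n"
  shows "of_nat (surj_count n k \<pi>) = (\<Sum>i<n. of_nat ((n - 1 - i) choose (n - k)) * foulkes_character n i \<pi>)"
proof -
  have c: "(if i < k then (n - 1 - i) choose (k - 1 - i) else 0) = (n - 1 - i) choose (n - k)" if i: "i < n" for i
  proof (cases "i < k")
    case True
    have "(n - 1 - i) choose (k - 1 - i) = (n - 1 - i) choose (n - 1 - i - (k - 1 - i))"
      by (rule binomial_symmetric) (use k in simp)
    also have "n - 1 - i - (k - 1 - i) = n - k" using True k by simp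
    finally show ?thesis using True by simp
  next
    case False
    hence "n - 1 - i < n - k" using i k by simp
    thus ?thesis using False by (simp add: binomial_eq_0)
  qed
  show ?thesis
    unfolding surj_count_ribbon_traces[OF n k \<pi>]
  proof (rule sum.cong[OF refl])
    fix i assume "i \<in> {..<n}"
    hence i: "i < n" by simp
    show "of_nat (if i < k then (n - 1 - i) choose (k - 1 - i) else 0) * (\<Sum>V | V \<subseteq> {1..<n} \<and> card V = i. trace_on (specht_funs n V) (left_act \<pi>))
      = of_nat ((n - 1 - i) choose (n - k)) * foulkes_character n i \<pi>"
      unfolding c[OF i] foulkes_character_ribbon_sum[OF n \<pi>] ..
  qed
qed

text \<open>
  Substitute the expansion of the number of surjective words into \<open>x ^ \<ell> = \<Sum>\<^sub>k C(x, k) B\<^sub>k\<close> and sum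
  over \<open>k\<close> by Vandermonde's identity.
\<close>

lemma power_foulkes:
  assumes n: "n \<ge> 1" and \<pi>: "\<pi> \<in> G n"
  shows "(of_nat x :: complex) ^ num_cycles n \<pi> = (\<Sum>i<n. of_nat ((x + (n - 1 - i)) choose n) * foulkes_character n i \<pi>)"
proof -
  let ?\<phi> = "\<lambda>i. foulkes_character n i \<pi>"
  have p: "\<pi> permutes {1..n}" using \<pi> by (simp add: G_def)
  have "(of_nat x :: complex) ^ num_cycles n \<pi> = (\<Sum>k\<le>n. of_nat (x choose k) * of_nat (surj_count n k \<pi>))"
    using arg_cong[OF power_num_cycles_expansion[OF p, of x], of "of_nat :: nat \<Rightarrow> complex"] by simp
  also have "\<dots> = (\<Sum>k\<le>n. \<Sum>i<n. of_nat (x choose k) * of_nat ((n - 1 - i) choose (n - k)) * ?\<phi> i)"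
  proof (rule sum.cong[OF refl])
    fix k assume k: "k \<in> {..n}"
    show "of_nat (x choose k) * of_nat (surj_count n k \<pi>)
      = (\<Sum>i<n. of_nat (x choose k) * of_nat ((n - 1 - i) choose (n - k)) * ?\<phi> i)"
    proof (cases "k = 0")
      case True
      have "(n - 1 - i) choose n = 0" for i using n by (intro binomial_eq_0) simp
      thus ?thesis using True surj_count_zero_letters[OF n] by simp
    next
      case False
      hence "of_nat (surj_count n k \<pi>) = (\<Sum>i<n. of_nat ((n - 1 - i) choose (n - k)) * ?\<phi> i)"
        using k by (intro surj_count_foulkes[OF n _ _ \<pi>]) auto
      thus ?thesis by (simp only: sum_distrib_left mult.assoc)
    qed
  qed
  also have "\<dots> = (\<Sum>i<n. \<Sum>k\<le>n. of_nat (x choose k) * of_nat ((n - 1 - i) choose (n - k)) * ?\<phi> i)"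
    by (rule sum.swap)
  also have "\<dots> = (\<Sum>i<n. of_nat (\<Sum>k\<le>n. (x choose k) * ((n - 1 - i) choose (n - k))) * ?\<phi> i)"
    by (simp only: of_nat_sum of_nat_mult sum_distrib_right)
  finally show ?thesis by (simp only: vandermonde)
qed

definition hook_pairing :: "nat \<Rightarrow> nat \<Rightarrow> ((nat \<Rightarrow> nat) \<Rightarrow> complex) \<Rightarrow> complex" where
  "hook_pairing n k \<chi> = (\<Sum>g | g permutes hook_arm n k. \<Sum>h | h permutes hook_leg k. of_int (sign h) * \<chi> (g \<circ> h))"

text \<open>
  The scalar by which the square of the hook symmetrizer differs from the symmetrizer itself. It is
  the product of the hook lengths.
\<close>

definition hook_norm :: "nat \<Rightarrow> nat \<Rightarrow> nat" where
  "hook_norm n k = fact (n - 1 - k) * fact k * n"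

lemma hook_comp_G:
  assumes "k < n" "g permutes hook_arm n k" "h permutes hook_leg k"
  shows "g \<circ> h \<in> G n"
proof -
  have "g permutes {1..n}" "h permutes {1..n}"
    using permutes_subset[OF assms(2) hook_arm_leg(1)[OF assms(1)]] permutes_subset[OF assms(3) hook_arm_leg(2)[OF assms(1)]] by auto
  thus ?thesis unfolding G_def by (simp add: permutes_compose)
qed

lemma hook_pairing_sum:
  assumes k: "k < n" and eq: "\<And>\<pi>. \<pi> \<in> G n \<Longrightarrow> \<chi> \<pi> = (\<Sum>i\<in>I. c i * \<theta> i \<pi>)"
  shows "hook_pairing n k \<chi> = (\<Sum>i\<in>I. c i * hook_pairing n k (\<theta> i))"
proof -
  let ?A = "{g. g permutes hook_arm n k}" and ?B = "{h. h permutes hook_leg k}"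
  have "hook_pairing n k \<chi> = (\<Sum>p\<in>?A \<times> ?B. \<Sum>i\<in>I. c i * (of_int (sign (snd p)) * \<theta> i (fst p \<circ> snd p)))"
    unfolding hook_pairing_def sum.cartesian_product' fst_conv snd_conv
  proof (intro sum.cong refl)
    fix g h assume "g \<in> ?A" "h \<in> ?B"
    hence "g \<circ> h \<in> G n" using hook_comp_G[OF k] by blast
    from eq[OF this] show "of_int (sign h) * \<chi> (g \<circ> h) = (\<Sum>i\<in>I. c i * (of_int (sign h) * \<theta> i (g \<circ> h)))"
      by (simp only: sum_distrib_left mult.left_commute)
  qed
  also have "\<dots> = (\<Sum>i\<in>I. \<Sum>p\<in>?A \<times> ?B. c i * (of_int (sign (snd p)) * \<theta> i (fst p \<circ> snd p)))"
    by (rule sum.swap)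
  also have "\<dots> = (\<Sum>i\<in>I. c i * hook_pairing n k (\<theta> i))"
    unfolding hook_pairing_def sum_distrib_left[symmetric] sum.cartesian_product' fst_conv snd_conv ..
  finally show ?thesis .
qed

lemma hook_pairing_character_nat:
  assumes k: "k < n" and \<chi>: "character n \<chi>"
  shows "\<exists>m::nat. hook_pairing n k \<chi> = of_nat (hook_norm n k) * of_nat m"
proof -
  note al = hook_arm_leg[OF k]
  have 1: "card (hook_arm n k) - 1 = n - 1 - k" "card (hook_leg k) - 1 = k"
    "card (hook_arm n k) + card (hook_leg k) - 1 = n" using al(4,5) k by auto
  show ?thesis
    using hook_symmetrizer_character_nat[OF \<chi> al(1-3)] unfolding 1 hook_pairing_def hook_norm_def .
qed

lemma hook_norm_pos: "k < n \<Longrightarrow> hook_norm n k > 0"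
  by (simp add: hook_norm_def)

text \<open>
  The values on \<open>(i + 1) ^ \<ell>\<close> for all \<open>i < n\<close> are known. They determine the values on the Foulkes
  characters recursively, since the coefficient of \<open>\<phi>\<^sub>j\<close> in \<open>(i + 1) ^ \<ell>\<close> is 0 for \<open>j > i\<close> and 1 for
  \<open>j = i\<close>.
\<close>

lemma hook_pairing_foulkes:
  assumes n: "n \<ge> 1" and k: "k < n" and i: "i < n"
  shows "hook_pairing n k (foulkes_character n i)
    = (if i = k then of_nat (hook_norm n k * ((n - 1) choose k)) else 0)"
  using i
proof (induction i rule: less_induct)
  case (less i)
  let ?d = "\<lambda>j. (if j = k then of_nat (hook_norm n k * ((n - 1) choose k)) else (0 :: complex))"
  let ?b = "\<lambda>j. of_nat ((i + 1 + (n - 1 - j)) choose n) :: complex"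
  have "hook_pairing n k (\<lambda>\<pi>. of_nat (i + 1) ^ num_cycles n \<pi>) = (\<Sum>j<n. ?b j * hook_pairing n k (foulkes_character n j))"
    by (rule hook_pairing_sum[OF k]) (rule power_foulkes[OF n])
  moreover have "hook_pairing n k (\<lambda>\<pi>. of_nat (i + 1) ^ num_cycles n \<pi>) = ?b k * ?d k"
  proof -
    have v: "hook_power_sum n (i + 1) (hook_arm n k) (hook_leg k) =
        of_nat (fact (n - 1 - k) * fact k * n) * of_nat (((n - 1) choose k) * ((i + 1 + (n - 1 - k)) choose n))"
      by (rule hook_power_sum_value[OF k]) simp
    have "hook_pairing n k (\<lambda>\<pi>. of_nat (i + 1) ^ num_cycles n \<pi>) = hook_power_sum n (i + 1) (hook_arm n k) (hook_leg k)"
      unfolding hook_pairing_def hook_power_sum_def ..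
    thus ?thesis unfolding v hook_norm_def by (simp only: simp_thms if_True of_nat_mult mult_ac)
  qed
  moreover have "?b k * ?d k = (\<Sum>j<n. ?b j * ?d j)"
  proof -
    have "(\<Sum>j<n. ?b j * ?d j) = (\<Sum>j<n. if j = k then ?b j * ?d j else 0)" by (intro sum.cong refl) simp
    thus ?thesis using k by simp
  qed
  ultimately have eq: "(\<Sum>j<n. ?b j * hook_pairing n k (foulkes_character n j)) = (\<Sum>j<n. ?b j * ?d j)" by simp
  \<comment> \<open>The binomial coefficients vanish beyond \<open>i\<close>, so the system is unitriangular.\<close>
  have split: "(\<Sum>j<n. ?b j * f j) = (\<Sum>j<i. ?b j * f j) + f i" for f :: "nat \<Rightarrow> complex"
  proof -
    have "(\<Sum>j<n. ?b j * f j) = (\<Sum>j<Suc i. ?b j * f j)"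
    proof (rule sum.mono_neutral_right)
      show "{..<Suc i} \<subseteq> {..<n}" using less.prems by auto
      show "\<forall>j\<in>{..<n} - {..<Suc i}. ?b j * f j = 0"
      proof
        fix j assume "j \<in> {..<n} - {..<Suc i}"
        hence "i + 1 + (n - 1 - j) < n" by auto
        thus "?b j * f j = 0" by (simp only: binomial_eq_0 of_nat_0 mult_zero_left)
      qed
    qed simp
    also have "\<dots> = (\<Sum>j<i. ?b j * f j) + ?b i * f i" by (rule sum.lessThan_Suc)
    also have "?b i = 1" using less.prems by simp
    finally show ?thesis by simp
  qed
  have "(\<Sum>j<i. ?b j * hook_pairing n k (foulkes_character n j)) = (\<Sum>j<i. ?b j * ?d j)"
    by (intro sum.cong refl) (use less in auto)
  thus ?case using eq unfolding split by simp
qed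

lemma hook_pairing_foulkes_sum:
  assumes n: "n \<ge> 1" and k: "k < n" and eq: "\<And>\<pi>. \<pi> \<in> G n \<Longrightarrow> \<chi> \<pi> = (\<Sum>i<n. c i * foulkes_character n i \<pi>)"
  shows "hook_pairing n k \<chi> = of_nat (hook_norm n k) * (of_nat ((n - 1) choose k) * c k)"
proof -
  have "hook_pairing n k \<chi> = (\<Sum>i<n. c i * hook_pairing n k (foulkes_character n i))"
    by (rule hook_pairing_sum[OF k eq])
  also have "\<dots> = (\<Sum>i<n. if i = k then c i * of_nat (hook_norm n k * ((n - 1) choose k)) else 0)"
    by (intro sum.cong refl) (simp add: hook_pairing_foulkes[OF n k])
  finally show ?thesis using k by (simp add: mult_ac)
qed

lemma foulkes_span:
  assumes n: "n \<ge> 1" and \<chi>: "depends_only_on_num_cycles n \<chi>"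
  shows "\<exists>c. \<forall>\<pi>\<in>G n. \<chi> \<pi> = (\<Sum>i<n. c i * foulkes_character n i \<pi>)"
proof -
  \<comment> \<open>Values for numbers that are not the number of cycles of any permutation are arbitrary.\<close>
  define F where "F = (\<lambda>l. \<chi> (SOME \<pi>. \<pi> \<in> G n \<and> num_cycles n \<pi> = l))"
  have F: "\<chi> \<pi> = F (num_cycles n \<pi>)" if \<pi>: "\<pi> \<in> G n" for \<pi>
  proof -
    let ?s = "SOME \<tau>. \<tau> \<in> G n \<and> num_cycles n \<tau> = num_cycles n \<pi>"
    have "?s \<in> G n \<and> num_cycles n ?s = num_cycles n \<pi>" by (rule someI[of _ \<pi>]) (use \<pi> in simp)
    thus ?thesis using \<chi> \<pi> unfolding depends_only_on_num_cycles_def F_def G_carrier by metis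
  qed
  obtain y :: "nat \<Rightarrow> complex" where y: "\<And>\<pi>. \<pi> permutes {1..n} \<Longrightarrow> num_cycles n \<pi> \<le> n \<Longrightarrow>
      F (num_cycles n \<pi>) = (\<Sum>k=1..n. y k * of_nat (surj_count n k \<pi>))"
    using surj_counts_span[OF n, of n F] by blast
  let ?c = "\<lambda>i. \<Sum>k=1..n. y k * of_nat ((n - 1 - i) choose (n - k))"
  have comb: "\<chi> \<pi> = (\<Sum>i<n. ?c i * foulkes_character n i \<pi>)"
    if \<pi>: "\<pi> \<in> G n" for \<pi>
  proof -
    have "\<chi> \<pi> = (\<Sum>k=1..n. y k * of_nat (surj_count n k \<pi>))"
      unfolding F[OF \<pi>] by (rule y) (use \<pi> num_cycles_bounds(2)[OF n] in \<open>auto simp: G_def\<close>)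
    also have "\<dots> = (\<Sum>k=1..n. y k * (\<Sum>i<n. of_nat ((n - 1 - i) choose (n - k)) * foulkes_character n i \<pi>))"
    proof (rule sum.cong[OF refl])
      fix k assume "k \<in> {1..n}"
      hence "k \<ge> 1" "k \<le> n" by simp_all
      from surj_count_foulkes[OF n this \<pi>]
      show "y k * of_nat (surj_count n k \<pi>) = y k * (\<Sum>i<n. of_nat ((n - 1 - i) choose (n - k)) * foulkes_character n i \<pi>)"
        by (simp only:)
    qed
    also have "\<dots> = (\<Sum>k=1..n. \<Sum>i<n. y k * of_nat ((n - 1 - i) choose (n - k)) * foulkes_character n i \<pi>)"
      by (simp only: sum_distrib_left mult.assoc)
    also have "\<dots> = (\<Sum>i<n. \<Sum>k=1..n. y k * of_nat ((n - 1 - i) choose (n - k)) * foulkes_character n i \<pi>)"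
      by (rule sum.swap)
    finally show ?thesis by (simp only: sum_distrib_right)
  qed
  show ?thesis by (rule exI[of _ ?c], rule ballI, rule comb)
qed

text \<open>
  If a character that depends only on the number of cycles has coefficients \<open>c\<^sub>i\<close>, the hook pairing
  shows that \<open>C(n - 1, i) c\<^sub>i\<close> is a natural number, and \<open>C(n - 1, i)\<close> divides \<open>Lcm {1..n} div n\<close>.
\<close>

lemma Lcm_div_is_multiplier:
  assumes n: "n \<ge> 1"
  shows "foulkes_multiplier n (Lcm {1..n} div n)"
proof -
  let ?s = "Lcm {1..n} div n"
  have nL: "n dvd Lcm {1..n}" using n by (intro dvd_Lcm) simp
  have L0: "Lcm {1..n} \<noteq> 0" by (simp add: Lcm_0_iff)
  have "n \<le> Lcm {1..n}" by (rule dvd_imp_le[OF nL]) (rule neq0_conv[THEN iffD1, OF L0])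
  hence s0: "?s > 0" using n by (simp add: div_greater_zero_iff)
  have dv: "((n - 1) choose i) dvd ?s" if i: "i < n" for i
  proof -
    have "n * ((n - 1) choose i) dvd n * ?s"
      unfolding dvd_mult_div_cancel[OF nL] by (rule n_binomial_dvd_Lcm[OF i])
    thus ?thesis using nat_mult_dvd_cancel1[of n "(n - 1) choose i" ?s] n by linarith
  qed
  have "\<exists>c :: nat \<Rightarrow> nat. \<forall>\<pi>\<in>carrier (sym_group n). of_nat ?s * \<chi> \<pi> = (\<Sum>i<n. of_nat (c i) * foulkes_character n i \<pi>)"
    if \<chi>: "character n \<chi>" "depends_only_on_num_cycles n \<chi>" for \<chi>
  proof -
    obtain c where c: "\<And>\<pi>. \<pi> \<in> G n \<Longrightarrow> \<chi> \<pi> = (\<Sum>i<n. c i * foulkes_character n i \<pi>)"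
      using foulkes_span[OF n \<chi>(2)] by blast
    have "\<exists>m::nat. of_nat ?s * c i = of_nat m" if i: "i < n" for i
    proof -
      obtain m :: nat where m: "hook_pairing n i \<chi> = of_nat (hook_norm n i) * of_nat m"
        using hook_pairing_character_nat[OF i \<chi>(1)] by blast
      have "of_nat (hook_norm n i) * (of_nat ((n - 1) choose i) * c i) = of_nat (hook_norm n i) * of_nat m"
        unfolding m[symmetric] by (rule hook_pairing_foulkes_sum[OF n i, symmetric]) (rule c)
      moreover have "of_nat (hook_norm n i) \<noteq> (0 :: complex)" using hook_norm_pos[OF i] by simp
      ultimately have eq: "of_nat ((n - 1) choose i) * c i = of_nat m" by (simp only: mult_cancel_left simp_thms)
      obtain t where t: "?s = ((n - 1) choose i) * t" using dv[OF i] by (rule dvdE)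
      have "of_nat ?s * c i = of_nat t * (of_nat ((n - 1) choose i) * c i)"
        unfolding t of_nat_mult by (simp only: mult_ac)
      also have "\<dots> = of_nat (t * m)" unfolding eq by simp
      finally show ?thesis by blast
    qed
    hence "\<forall>i. \<exists>m::nat. i < n \<longrightarrow> of_nat ?s * c i = of_nat m" by blast
    from choice[OF this] obtain m :: "nat \<Rightarrow> nat" where m: "\<forall>i. i < n \<longrightarrow> of_nat ?s * c i = of_nat (m i)" ..
    have "of_nat ?s * \<chi> \<pi> = (\<Sum>i<n. of_nat (m i) * foulkes_character n i \<pi>)" if \<pi>: "\<pi> \<in> carrier (sym_group n)" for \<pi>
    proof -
      have "of_nat ?s * \<chi> \<pi> = (\<Sum>i<n. (of_nat ?s * c i) * foulkes_character n i \<pi>)"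
        unfolding c[OF \<pi>[folded G_carrier]] by (simp only: sum_distrib_left mult.assoc)
      also have "\<dots> = (\<Sum>i<n. of_nat (m i) * foulkes_character n i \<pi>)" by (intro sum.cong refl) (use m in simp)
      finally show ?thesis .
    qed
    thus ?thesis by blast
  qed
  thus ?thesis unfolding foulkes_multiplier_def using s0 by blast
qed

text \<open>
  The witness is the permutation character on the surjective words with \<open>k\<close> letters whose weight
  lies in one period. It is the fraction \<open>gcd n k / k\<close> of the function \<open>surj_count n k\<close>, in which
  the coefficient of \<open>foulkes_character n (k - 1)\<close> is 1.
\<close>

lemma foulkes_multiplier_divisible:
  assumes n: "n \<ge> 1" and s: "foulkes_multiplier n s" and k: "k \<ge> 1" "k \<le> n"
  shows "k dvd s * n"
proof -
  let ?g = "gcd n k"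
  define \<psi> :: "(nat \<Rightarrow> nat) \<Rightarrow> complex" where "\<psi> = (\<lambda>\<pi>. \<Sum>r<?g. of_nat (card (weight_words n k r \<pi>)))"
  have ch: "character n \<psi>" unfolding \<psi>_def by (rule character_sum) (auto intro: weight_words_character)
  have kg: "k div ?g > 0" using k by (simp add: div_greater_zero_iff gcd_le2_nat)
  have surj: "of_nat (surj_count n k \<pi>) = of_nat (k div ?g) * \<psi> \<pi>" if "\<pi> \<in> G n" for \<pi>
  proof -
    have "surj_count n k \<pi> = (k div ?g) * (\<Sum>r<?g. card (weight_words n k r \<pi>))"
      by (rule surj_count_weight) (use that k in \<open>auto simp: G_def\<close>)
    thus ?thesis unfolding \<psi>_def by simp
  qed
  have dep: "depends_only_on_num_cycles n \<psi>"
    unfolding depends_only_on_num_cycles_def G_carrier[symmetric]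
  proof (intro ballI impI)
    fix \<pi> \<tau> assume *: "\<pi> \<in> G n" "\<tau> \<in> G n" "num_cycles n \<pi> = num_cycles n \<tau>"
    have "surj_count n k \<pi> = surj_count n k \<tau>" by (rule surj_count_cong) (use * in \<open>auto simp: G_def\<close>)
    hence "of_nat (k div ?g) * \<psi> \<pi> = of_nat (k div ?g) * \<psi> \<tau>" using surj * by metis
    thus "\<psi> \<pi> = \<psi> \<tau>" using kg by simp
  qed
  obtain c :: "nat \<Rightarrow> nat" where c: "\<And>\<pi>. \<pi> \<in> G n \<Longrightarrow> of_nat s * \<psi> \<pi> = (\<Sum>i<n. of_nat (c i) * foulkes_character n i \<pi>)"
    using s ch dep unfolding foulkes_multiplier_def G_carrier by blast
  have k1: "k - 1 < n" using k by simp
  let ?b = "\<lambda>i. of_nat ((n - 1 - i) choose (n - k)) :: complex"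
  have e1: "hook_pairing n (k - 1) (\<lambda>\<pi>. of_nat s * of_nat (surj_count n k \<pi>))
    = of_nat (hook_norm n (k - 1)) * (of_nat ((n - 1) choose (k - 1)) * (of_nat s * ?b (k - 1)))"
  proof (rule hook_pairing_foulkes_sum[OF n k1])
    fix \<pi> assume "\<pi> \<in> G n"
    from surj_count_foulkes[OF n k this]
    show "of_nat s * of_nat (surj_count n k \<pi>) = (\<Sum>i<n. of_nat s * ?b i * foulkes_character n i \<pi>)"
      by (simp only: sum_distrib_left mult.assoc)
  qed
  have e2: "hook_pairing n (k - 1) (\<lambda>\<pi>. of_nat s * of_nat (surj_count n k \<pi>))
    = of_nat (hook_norm n (k - 1)) * (of_nat ((n - 1) choose (k - 1)) * (of_nat (k div ?g) * of_nat (c (k - 1))))"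
  proof (rule hook_pairing_foulkes_sum[OF n k1])
    fix \<pi> assume \<pi>: "\<pi> \<in> G n"
    have "of_nat s * of_nat (surj_count n k \<pi>) = of_nat (k div ?g) * (of_nat s * \<psi> \<pi>)"
      unfolding surj[OF \<pi>] by (simp only: mult_ac)
    thus "of_nat s * of_nat (surj_count n k \<pi>) = (\<Sum>i<n. of_nat (k div ?g) * of_nat (c i) * foulkes_character n i \<pi>)"
      unfolding c[OF \<pi>] by (simp only: sum_distrib_left mult.assoc)
  qed
  have b1: "?b (k - 1) = 1" using k by simp
  have nz: "of_nat (hook_norm n (k - 1)) \<noteq> (0 :: complex)" "of_nat ((n - 1) choose (k - 1)) \<noteq> (0 :: complex)"
    using hook_norm_pos[OF k1] k by (auto simp: binomial_eq_0_iff)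
  have "of_nat s = (of_nat (k div ?g) * of_nat (c (k - 1)) :: complex)"
    using e1 unfolding e2 b1 mult.right_neutral mult_cancel_left using nz by auto
  hence "s = (k div ?g) * c (k - 1)" unfolding of_nat_mult[symmetric] of_nat_eq_iff .
  note s_eq = this
  obtain t where t: "n = ?g * t" by (rule dvdE[OF gcd_dvd1[of n k]])
  have "s * n = s * (?g * t)" using t by (rule arg_cong)
  also have "\<dots> = (k div ?g) * ?g * (c (k - 1) * t)" unfolding s_eq by (simp only: mult_ac)
  also have "(k div ?g) * ?g = k" by (rule dvd_div_mult_self[OF gcd_dvd2])
  finally show ?thesis by (rule dvdI)
qed

theorem theorem1p4:
  fixes n :: nat
  assumes "n \<ge> 1"
  shows "(\<exists>s. foulkes_multiplier n s) \<and>
    real (sigma_min n) = real (Lcm {1..n}) / real n \<and>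
    real (Lcm {1..n}) / real n = exp (chebyshev_second (real n)) / real n"
proof -
  let ?s = "Lcm {1..n} div n"
  have s: "foulkes_multiplier n ?s" by (rule Lcm_div_is_multiplier[OF assms])
  have nL: "n dvd Lcm {1..n}" using assms by (intro dvd_Lcm) simp
  have "?s \<le> s" if s: "foulkes_multiplier n s" for s
  proof -
    have "Lcm {1..n} dvd s * n"
      by (rule Lcm_least) (use foulkes_multiplier_divisible[OF assms s] in auto)
    moreover have "s * n > 0" using s assms by (simp add: foulkes_multiplier_def)
    ultimately have "Lcm {1..n} \<le> s * n" by (rule dvd_imp_le)
    hence "?s \<le> s * n div n" by (rule div_le_mono)
    thus ?thesis using assms by simp
  qed
  hence "sigma_min n = ?s" unfolding sigma_min_def using s by (intro Least_equality) auto
  hence "real (sigma_min n) = real (Lcm {1..n}) / real n" using nL by (simp add: real_of_nat_div)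
  thus ?thesis using s Lcm_eq_exp_chebyshev by auto
qed

end
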